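(* Let $G$ be a group generated by a finite symmetric set $X$ and hyperbolic relative to a collection of subgroups $\mathcal{H}=\{H_i\}_{i=1}^m$. For any relatively quasiconvex subgroup $Q$ of $G$ and any maximal parabolic subgroup $P$ of $G$, there is a constant $C=C(Q,P)\geq 0$ with the following property. If $R$ is a subgroup of $P$ such that 1. $Q\cap P\leq R$, and 2. $|g|_X\geq C$ for any $g\in R\setminus Q$, then the natural homomorphism $$Q\ast_{Q\cap R}R\longrightarrow G$$ (induced by the inclusions $Q\to G$ and $R\to G$) is injective and its image $\langle Q\cup R\rangle$ is a relatively quasiconvex subgroup of $G$. Moreover, every parabolic subgroup of $G$ contained in $\langle Q\cup R\rangle$ is conjugate, by an element of $\langle Q\cup R\rangle$, either to a subgroup of $Q$ or to a subgroup of $R$.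
   Context: Setting. $G$ is a group, $X$ a finite generating set of $G$ closed under inverses, $\mathcal{H}=\{H_i\}_{i=1}^m$ a finite collection of subgroups. $|g|_X$ is the word length and $dist_X(f,g)=|f^{-1}g|_X$. Let $\widetilde{\mathcal{H}}=\bigsqcup_{i=1}^m(\widetilde{H_i}\setminus\{1\})$, where $\widetilde{H_i}$ is a copy of $H_i$, and let $\Gamma=Cayley(G,X\cup\widetilde{\mathcal{H}})$ be the graph with vertex set $G$ and, for each $g\in G$ and each letter $a\in X\sqcup\widetilde{\mathcal{H}}$, an edge from $g$ to $ga$ with label $a$; all edges have length 1. For a path $p$, $p_-$ and $p_+$ are its initial and terminal vertices and $l(p)$ its length. A path $p$ is a $(\lambda,c)$-quasi-geodesic if $l(q)\leq\lambda d(q_-,q_+)+c$ for every subpath $q$ of $p$, $d$ being the metric of $\Gamma$. Components. An $H_i$-component of a path $q$ in $\Gamma$ is a maximal subpath with at least one edge whose label is a word in the alphabet $\widetilde{H_i}\setminus\{1\}$; an $\mathcal{H}$-component is an $H_i$-component for some $i$. Two $\mathcal{H}$-components (of one path or of two paths) are connected if, for some $i$, both are $H_i$-components and their vertices belong to the same left coset of $H_i$. An $\mathcal{H}$-component of $q$ is isolated if it is not connected to a different $\mathcal{H}$-component of $q$. A path is without backtracking if all its $\mathcal{H}$-components are isolated. A vertex of $q$ is phase if it is not an inner vertex of an $\mathcal{H}$-component of $q$. Two paths $p,q$ are $k$-similar if $\max\{dist_X(p_-,q_-),dist_X(p_+,q_+)\}\leq k$. Bounded coset penetration (BCP). $(G,\mathcal{H})$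 satisfies BCP if for all $\lambda\geq1$, $c\geq0$, $k\geq0$ there is an integer $\epsilon(\lambda,c,k)>0$ such that for any two $k$-similar $(\lambda,c)$-quasi-geodesics $p,q$ in $\Gamma$ without backtracking: (i) the sets of phase vertices of $p$ and $q$ are contained in the closed $\epsilon(\lambda,c,k)$-neighborhoods of each other with respect to $dist_X$; (ii) if $s$ is an $\mathcal{H}$-component of $p$ with $dist_X(s_-,s_+)>\epsilon(\lambda,c,k)$, then some $\mathcal{H}$-component of $q$ is connected to $s$; (iii) if $s,t$ are connected $\mathcal{H}$-components of $p,q$ respectively, then $\max\{dist_X(s_-,t_-),dist_X(s_+,t_+)\}\leq\epsilon(\lambda,c,k)$. $G$ is hyperbolic relative to $\mathcal{H}$ if $\Gamma$ is a $\delta$-hyperbolic metric space for some $\delta\ge 0$ and $(G,\mathcal{H})$ satisfies BCP. A subgroup $Q\leq G$ is relatively quasiconvex if there is $\sigma\geq0$ (and then $Q$ is called $\sigma$-quasiconvex) such that for all $f,g\in Q$, every geodesic $p$ in $\Gamma$ from $f$ to $g$ and every vertex $v$ of $p$, there is $w\in Q$ with $dist_X(v,w)\leq\sigma$. A subgroup of $G$ is parabolic if it can be conjugated in $G$ into one of the subgroups in $\mathcal{H}$; a maximal parabolic subgroup of $G$ is a parabolic subgroup not properly contained in another parabolic subgroup. *)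

theory Defs
  imports Complex_Main "HOL-Algebra.Generated_Groups"
begin

section \<open>Words, letters and the Cayley graph\<close>

definition word_length :: "('a, 'b) monoid_scheme \<Rightarrow> 'a set \<Rightarrow> 'a \<Rightarrow> nat" where
  "word_length G X g =
     (LEAST n. \<exists>ws. set ws \<subseteq> X \<and> length ws = n \<and> foldr (mult G) ws \<one>\<^bsub>G\<^esub> = g)"

definition word_dist :: "('a, 'b) monoid_scheme \<Rightarrow> 'a set \<Rightarrow> 'a \<Rightarrow> 'a \<Rightarrow> nat" where
  "word_dist G X f g = word_length G X (inv\<^bsub>G\<^esub> f \<otimes>\<^bsub>G\<^esub> g)"

text \<open>The constructors implement the disjoint union of \<open>X\<close> and of the copies of the sets
  \<open>H i - {\<one>}\<close>: elements of \<open>G\<close> that lie in several of these sets give several letters,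
  hence several parallel edges. The family is indexed by \<open>{1..m}\<close>, repetitions allowed.\<close>

datatype 'a letter = Gen 'a | Per nat 'a

fun letter_val :: "'a letter \<Rightarrow> 'a" where
  "letter_val (Gen x) = x"
| "letter_val (Per i h) = h"

definition per_letters :: "('a, 'b) monoid_scheme \<Rightarrow> (nat \<Rightarrow> 'a set) \<Rightarrow> nat \<Rightarrow> 'a letter set" where
  "per_letters G H i = Per i ` (H i - {\<one>\<^bsub>G\<^esub>})"

definition alphabet ::
  "('a, 'b) monoid_scheme \<Rightarrow> 'a set \<Rightarrow> nat \<Rightarrow> (nat \<Rightarrow> 'a set) \<Rightarrow> 'a letter set" where
  "alphabet G X m H = Gen ` X \<union> (\<Union>i\<in>{1..m}. per_letters G H i)"

text \<open>An edge path is given by its initial vertex and its label. Since \<open>X\<close> and the \<open>H i\<close> are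
  closed under inverses, traversing an edge backwards is reading the inverse letter.\<close>

type_synonym 'a cpath = "'a \<times> 'a letter list"

fun walk :: "('a, 'b) monoid_scheme \<Rightarrow> 'a \<Rightarrow> 'a letter list \<Rightarrow> 'a" where
  "walk G g [] = g"
| "walk G g (a # w) = walk G (g \<otimes>\<^bsub>G\<^esub> letter_val a) w"

definition cayley_path ::
  "('a, 'b) monoid_scheme \<Rightarrow> 'a set \<Rightarrow> nat \<Rightarrow> (nat \<Rightarrow> 'a set) \<Rightarrow> 'a cpath \<Rightarrow> bool" where
  "cayley_path G X m H p \<longleftrightarrow> fst p \<in> carrier G \<and> set (snd p) \<subseteq> alphabet G X m H"

definition path_len :: "'a cpath \<Rightarrow> nat" where
  "path_len p = length (snd p)"

definition path_vertex :: "('a, 'b) monoid_scheme \<Rightarrow> 'a cpath \<Rightarrow> nat \<Rightarrow> 'a" where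
  "path_vertex G p n = walk G (fst p) (take n (snd p))"

definition path_start :: "('a, 'b) monoid_scheme \<Rightarrow> 'a cpath \<Rightarrow> 'a" where
  "path_start G p = path_vertex G p 0"

definition path_end :: "('a, 'b) monoid_scheme \<Rightarrow> 'a cpath \<Rightarrow> 'a" where
  "path_end G p = path_vertex G p (path_len p)"

definition cayley_dist ::
  "('a, 'b) monoid_scheme \<Rightarrow> 'a set \<Rightarrow> nat \<Rightarrow> (nat \<Rightarrow> 'a set) \<Rightarrow> 'a \<Rightarrow> 'a \<Rightarrow> nat" where
  "cayley_dist G X m H f g =
     (LEAST n. \<exists>p. cayley_path G X m H p \<and> path_start G p = f \<and> path_end G p = g
        \<and> path_len p = n)"

definition geodesic_path ::
  "('a, 'b) monoid_scheme \<Rightarrow> 'a set \<Rightarrow> nat \<Rightarrow> (nat \<Rightarrow> 'a set) \<Rightarrow> 'a cpath \<Rightarrow> bool" where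
  "geodesic_path G X m H p \<longleftrightarrow> cayley_path G X m H p \<and>
     path_len p = cayley_dist G X m H (path_start G p) (path_end G p)"

text \<open>The subpaths of \<open>p\<close> are its restrictions to the intervals \<open>i \<le> j \<le> path_len p\<close>.\<close>

definition quasi_geodesic_path ::
  "('a, 'b) monoid_scheme \<Rightarrow> 'a set \<Rightarrow> nat \<Rightarrow> (nat \<Rightarrow> 'a set) \<Rightarrow> real \<Rightarrow> real \<Rightarrow> 'a cpath \<Rightarrow> bool"
where
  "quasi_geodesic_path G X m H \<mu> c p \<longleftrightarrow> cayley_path G X m H p \<and>
     (\<forall>i j. i \<le> j \<and> j \<le> path_len p \<longrightarrow>
        real (j - i) \<le> \<mu> * real (cayley_dist G X m H (path_vertex G p i) (path_vertex G p j)) + c)"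


section \<open>Hyperbolicity of the Cayley graph\<close>

text \<open>The metric graph: its vertices, and for each edge (leaving \<open>g\<close> with label \<open>a\<close>) the
  points at distance \<open>t\<close> from \<open>g\<close> along that edge, for \<open>0 < t < 1\<close>.\<close>

datatype 'a point = Vertex 'a | Inner 'a "'a letter" real

definition cayley_points ::
  "('a, 'b) monoid_scheme \<Rightarrow> 'a set \<Rightarrow> nat \<Rightarrow> (nat \<Rightarrow> 'a set) \<Rightarrow> 'a point set" where
  "cayley_points G X m H = Vertex ` carrier G \<union>
     {Inner g a t | g a t. g \<in> carrier G \<and> a \<in> alphabet G X m H \<and> 0 < t \<and> t < 1}"

text \<open>The vertices through which a path may leave the edge carrying the point, each with its
  distance to the point along the edge.\<close>

fun exits :: "('a, 'b) monoid_scheme \<Rightarrow> 'a point \<Rightarrow> ('a \<times> real) set" where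
  "exits G (Vertex g) = {(g, 0)}"
| "exits G (Inner g a t) = {(g, t), (g \<otimes>\<^bsub>G\<^esub> letter_val a, 1 - t)}"

fun same_edge_dist :: "'a point \<Rightarrow> 'a point \<Rightarrow> real set" where
  "same_edge_dist (Inner g a s) (Inner h b t) = (if g = h \<and> a = b then {\<bar>s - t\<bar>} else {})"
| "same_edge_dist _ _ = {}"

definition point_dist ::
  "('a, 'b) monoid_scheme \<Rightarrow> 'a set \<Rightarrow> nat \<Rightarrow> (nat \<Rightarrow> 'a set) \<Rightarrow> 'a point \<Rightarrow> 'a point \<Rightarrow> real" where
  "point_dist G X m H x y =
     Min ((\<lambda>((u, s), (v, t)). s + real (cayley_dist G X m H u v) + t) ` (exits G x \<times> exits G y)
        \<union> same_edge_dist x y)"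

definition geodesic_segment ::
  "'p set \<Rightarrow> ('p \<Rightarrow> 'p \<Rightarrow> real) \<Rightarrow> (real \<Rightarrow> 'p) \<Rightarrow> real \<Rightarrow> 'p \<Rightarrow> 'p \<Rightarrow> bool" where
  "geodesic_segment M d \<gamma> L x y \<longleftrightarrow> 0 \<le> L \<and> \<gamma> ` {0..L} \<subseteq> M \<and> \<gamma> 0 = x \<and> \<gamma> L = y \<and>
     (\<forall>s\<in>{0..L}. \<forall>t\<in>{0..L}. d (\<gamma> s) (\<gamma> t) = \<bar>s - t\<bar>)"

text \<open>Slim geodesic triangles. It suffices to speak about the first side, since the sides
  are permuted cyclically by renaming.\<close>

definition hyperbolic_space :: "'p set \<Rightarrow> ('p \<Rightarrow> 'p \<Rightarrow> real) \<Rightarrow> real \<Rightarrow> bool" where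
  "hyperbolic_space M d \<delta> \<longleftrightarrow>
     (\<forall>x y z \<alpha> a \<beta> b \<gamma> c.
        geodesic_segment M d \<alpha> a x y \<and> geodesic_segment M d \<beta> b y z \<and> geodesic_segment M d \<gamma> c z x
        \<longrightarrow> (\<forall>p\<in>\<alpha> ` {0..a}. \<exists>q\<in>\<beta> ` {0..b} \<union> \<gamma> ` {0..c}. d p q \<le> \<delta>))"


section \<open>Components and bounded coset penetration\<close>

text \<open>The triple \<open>(i, a, b)\<close> stands for the subpath of \<open>p\<close> between its \<open>a\<close>-th and its \<open>b\<close>-th
  vertex, regarded as an \<open>H i\<close>-component.\<close>

type_synonym component = "nat \<times> nat \<times> nat"

definition per_segment ::
  "('a, 'b) monoid_scheme \<Rightarrow> (nat \<Rightarrow> 'a set) \<Rightarrow> nat \<Rightarrow> 'a cpath \<Rightarrow> nat \<Rightarrow> nat \<Rightarrow> bool" where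
  "per_segment G H i p a b \<longleftrightarrow> a < b \<and> b \<le> path_len p \<and>
     (\<forall>k\<in>{a..<b}. snd p ! k \<in> per_letters G H i)"

fun is_component ::
  "('a, 'b) monoid_scheme \<Rightarrow> nat \<Rightarrow> (nat \<Rightarrow> 'a set) \<Rightarrow> 'a cpath \<Rightarrow> component \<Rightarrow> bool" where
  "is_component G m H p (i, a, b) \<longleftrightarrow> i \<in> {1..m} \<and> per_segment G H i p a b \<and>
     (\<forall>a' b'. a' \<le> a \<and> b \<le> b' \<and> per_segment G H i p a' b' \<longrightarrow> a' = a \<and> b' = b)"

fun comp_vertices :: "('a, 'b) monoid_scheme \<Rightarrow> 'a cpath \<Rightarrow> component \<Rightarrow> 'a set" where
  "comp_vertices G p (i, a, b) = path_vertex G p ` {a..b}"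

fun comp_start :: "('a, 'b) monoid_scheme \<Rightarrow> 'a cpath \<Rightarrow> component \<Rightarrow> 'a" where
  "comp_start G p (i, a, b) = path_vertex G p a"

fun comp_end :: "('a, 'b) monoid_scheme \<Rightarrow> 'a cpath \<Rightarrow> component \<Rightarrow> 'a" where
  "comp_end G p (i, a, b) = path_vertex G p b"

definition connected_comps ::
  "('a, 'b) monoid_scheme \<Rightarrow> (nat \<Rightarrow> 'a set) \<Rightarrow> 'a cpath \<Rightarrow> component \<Rightarrow> 'a cpath \<Rightarrow> component \<Rightarrow> bool"
where
  "connected_comps G H p s q t \<longleftrightarrow> fst s = fst t \<and>
     (\<exists>x\<in>carrier G. comp_vertices G p s \<union> comp_vertices G q t \<subseteq> x <#\<^bsub>G\<^esub> H (fst s))"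

definition isolated_comp ::
  "('a, 'b) monoid_scheme \<Rightarrow> nat \<Rightarrow> (nat \<Rightarrow> 'a set) \<Rightarrow> 'a cpath \<Rightarrow> component \<Rightarrow> bool" where
  "isolated_comp G m H p s \<longleftrightarrow>
     \<not> (\<exists>t. is_component G m H p t \<and> t \<noteq> s \<and> connected_comps G H p s p t)"

definition without_backtracking ::
  "('a, 'b) monoid_scheme \<Rightarrow> nat \<Rightarrow> (nat \<Rightarrow> 'a set) \<Rightarrow> 'a cpath \<Rightarrow> bool" where
  "without_backtracking G m H p \<longleftrightarrow>
     (\<forall>s. is_component G m H p s \<longrightarrow> isolated_comp G m H p s)"

definition phase_vertices ::
  "('a, 'b) monoid_scheme \<Rightarrow> nat \<Rightarrow> (nat \<Rightarrow> 'a set) \<Rightarrow> 'a cpath \<Rightarrow> 'a set" where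
  "phase_vertices G m H p =
     {path_vertex G p n | n. n \<le> path_len p \<and>
        \<not> (\<exists>i a b. is_component G m H p (i, a, b) \<and> a < n \<and> n < b)}"

definition similar_paths ::
  "('a, 'b) monoid_scheme \<Rightarrow> 'a set \<Rightarrow> real \<Rightarrow> 'a cpath \<Rightarrow> 'a cpath \<Rightarrow> bool" where
  "similar_paths G X k p q \<longleftrightarrow>
     real (max (word_dist G X (path_start G p) (path_start G q))
               (word_dist G X (path_end G p) (path_end G q))) \<le> k"

definition in_word_nbhd :: "('a, 'b) monoid_scheme \<Rightarrow> 'a set \<Rightarrow> nat \<Rightarrow> 'a set \<Rightarrow> 'a set \<Rightarrow> bool" where
  "in_word_nbhd G X \<epsilon> A B \<longleftrightarrow> (\<forall>u\<in>A. \<exists>v\<in>B. word_dist G X u v \<le> \<epsilon>)"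

definition bounded_coset_penetration ::
  "('a, 'b) monoid_scheme \<Rightarrow> 'a set \<Rightarrow> nat \<Rightarrow> (nat \<Rightarrow> 'a set) \<Rightarrow> bool" where
  "bounded_coset_penetration G X m H \<longleftrightarrow>
     (\<forall>\<mu> c k. \<mu> \<ge> 1 \<and> c \<ge> 0 \<and> k \<ge> 0 \<longrightarrow> (\<exists>\<epsilon>>0. \<forall>p q.
        quasi_geodesic_path G X m H \<mu> c p \<and> quasi_geodesic_path G X m H \<mu> c q \<and>
        without_backtracking G m H p \<and> without_backtracking G m H q \<and>
        similar_paths G X k p q \<longrightarrow>
          in_word_nbhd G X \<epsilon> (phase_vertices G m H p) (phase_vertices G m H q) \<and>
          in_word_nbhd G X \<epsilon> (phase_vertices G m H q) (phase_vertices G m H p) \<and>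
          (\<forall>s. is_component G m H p s \<and> word_dist G X (comp_start G p s) (comp_end G p s) > \<epsilon> \<longrightarrow>
             (\<exists>t. is_component G m H q t \<and> connected_comps G H p s q t)) \<and>
          (\<forall>s t. is_component G m H p s \<and> is_component G m H q t \<and> connected_comps G H p s q t \<longrightarrow>
             max (word_dist G X (comp_start G p s) (comp_start G q t))
                 (word_dist G X (comp_end G p s) (comp_end G q t)) \<le> \<epsilon>)))"

definition relatively_hyperbolic ::
  "('a, 'b) monoid_scheme \<Rightarrow> 'a set \<Rightarrow> nat \<Rightarrow> (nat \<Rightarrow> 'a set) \<Rightarrow> bool" where
  "relatively_hyperbolic G X m H \<longleftrightarrow>
     (\<exists>\<delta>\<ge>0. hyperbolic_space (cayley_points G X m H) (point_dist G X m H) \<delta>) \<and>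
     bounded_coset_penetration G X m H"


section \<open>Relatively quasiconvex and parabolic subgroups\<close>

definition relatively_quasiconvex ::
  "('a, 'b) monoid_scheme \<Rightarrow> 'a set \<Rightarrow> nat \<Rightarrow> (nat \<Rightarrow> 'a set) \<Rightarrow> 'a set \<Rightarrow> bool" where
  "relatively_quasiconvex G X m H Q \<longleftrightarrow> subgroup Q G \<and>
     (\<exists>\<sigma>::real. \<sigma> \<ge> 0 \<and> (\<forall>f\<in>Q. \<forall>g\<in>Q. \<forall>p.
        geodesic_path G X m H p \<and> path_start G p = f \<and> path_end G p = g \<longrightarrow>
        (\<forall>n\<le>path_len p. \<exists>w\<in>Q. real (word_dist G X (path_vertex G p n) w) \<le> \<sigma>)))"

definition conjugate_set :: "('a, 'b) monoid_scheme \<Rightarrow> 'a \<Rightarrow> 'a set \<Rightarrow> 'a set" where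
  "conjugate_set G g K = (\<lambda>x. g \<otimes>\<^bsub>G\<^esub> x \<otimes>\<^bsub>G\<^esub> inv\<^bsub>G\<^esub> g) ` K"

definition parabolic :: "('a, 'b) monoid_scheme \<Rightarrow> nat \<Rightarrow> (nat \<Rightarrow> 'a set) \<Rightarrow> 'a set \<Rightarrow> bool" where
  "parabolic G m H P \<longleftrightarrow> subgroup P G \<and>
     (\<exists>g\<in>carrier G. \<exists>i\<in>{1..m}. conjugate_set G g P \<subseteq> H i)"

definition maximal_parabolic :: "('a, 'b) monoid_scheme \<Rightarrow> nat \<Rightarrow> (nat \<Rightarrow> 'a set) \<Rightarrow> 'a set \<Rightarrow> bool"
where
  "maximal_parabolic G m H P \<longleftrightarrow> parabolic G m H P \<and> \<not> (\<exists>P'. parabolic G m H P' \<and> P \<subset> P')"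


section \<open>The amalgamated free product of two subgroups along their intersection\<close>

text \<open>Words in the disjoint union of \<open>Q\<close> and \<open>R\<close>, modulo the congruence generated by the
  multiplication tables of \<open>Q\<close> and \<open>R\<close> and by the identification of the two copies of each
  element of \<open>Q \<inter> R\<close>.\<close>

definition amalgam_words :: "'a set \<Rightarrow> 'a set \<Rightarrow> ('a + 'a) list set" where
  "amalgam_words Q R = lists (Q <+> R)"

inductive amalgam_eq ::
  "('a, 'b) monoid_scheme \<Rightarrow> 'a set \<Rightarrow> 'a set \<Rightarrow> ('a + 'a) list \<Rightarrow> ('a + 'a) list \<Rightarrow> bool"
  for G :: "('a, 'b) monoid_scheme" and Q R :: "'a set" where
  refl: "u \<in> amalgam_words Q R \<Longrightarrow> amalgam_eq G Q R u u"
| sym: "amalgam_eq G Q R u v \<Longrightarrow> amalgam_eq G Q R v u"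
| trans: "amalgam_eq G Q R u v \<Longrightarrow> amalgam_eq G Q R v w \<Longrightarrow> amalgam_eq G Q R u w"
| congr: "amalgam_eq G Q R u v \<Longrightarrow> amalgam_eq G Q R u' v' \<Longrightarrow> amalgam_eq G Q R (u @ u') (v @ v')"
| one_l: "amalgam_eq G Q R [Inl \<one>\<^bsub>G\<^esub>] []"
| one_r: "amalgam_eq G Q R [Inr \<one>\<^bsub>G\<^esub>] []"
| mult_l: "a \<in> Q \<Longrightarrow> b \<in> Q \<Longrightarrow> amalgam_eq G Q R [Inl a, Inl b] [Inl (a \<otimes>\<^bsub>G\<^esub> b)]"
| mult_r: "a \<in> R \<Longrightarrow> b \<in> R \<Longrightarrow> amalgam_eq G Q R [Inr a, Inr b] [Inr (a \<otimes>\<^bsub>G\<^esub> b)]"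
| glue: "a \<in> Q \<inter> R \<Longrightarrow> amalgam_eq G Q R [Inl a] [Inr a]"

definition amalgam_rel ::
  "('a, 'b) monoid_scheme \<Rightarrow> 'a set \<Rightarrow> 'a set \<Rightarrow> (('a + 'a) list \<times> ('a + 'a) list) set" where
  "amalgam_rel G Q R = {(u, v). amalgam_eq G Q R u v}"

definition amalgam ::
  "('a, 'b) monoid_scheme \<Rightarrow> 'a set \<Rightarrow> 'a set \<Rightarrow> ('a + 'a) list set monoid" where
  "amalgam G Q R =
     \<lparr>carrier = amalgam_words Q R // amalgam_rel G Q R,
      mult = (\<lambda>A B. \<Union>u\<in>A. \<Union>v\<in>B. amalgam_rel G Q R `` {u @ v}),
      one = amalgam_rel G Q R `` {[]}\<rparr>"

definition amalgam_eval :: "('a, 'b) monoid_scheme \<Rightarrow> ('a + 'a) list \<Rightarrow> 'a" where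
  "amalgam_eval G w = foldr (\<lambda>l g. case_sum id id l \<otimes>\<^bsub>G\<^esub> g) w \<one>\<^bsub>G\<^esub>"

text \<open>The natural homomorphism induced by the inclusions; see \<open>amalgam_hom_class\<close> and
  \<open>amalgam_hom_hom\<close> below.\<close>

definition amalgam_hom :: "('a, 'b) monoid_scheme \<Rightarrow> ('a + 'a) list set \<Rightarrow> 'a" where
  "amalgam_hom G A = the_elem (amalgam_eval G ` A)"

lemma amalgam_eval_simps [simp]:
  "amalgam_eval G [] = \<one>\<^bsub>G\<^esub>"
  "amalgam_eval G (Inl a # w) = a \<otimes>\<^bsub>G\<^esub> amalgam_eval G w"
  "amalgam_eval G (Inr a # w) = a \<otimes>\<^bsub>G\<^esub> amalgam_eval G w"
  by (simp_all add: amalgam_eval_def)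

context
  fixes G :: "('a, 'b) monoid_scheme" and Q R :: "'a set"
  assumes grp: "group G" and sub: "subgroup Q G" "subgroup R G"
begin

interpretation group G by (rule grp)

lemma amalgam_eval_closed: "w \<in> amalgam_words Q R \<Longrightarrow> amalgam_eval G w \<in> carrier G"
  using sub by (induction w) (auto simp: amalgam_words_def subgroup.mem_carrier)

lemma amalgam_eval_append:
  "\<lbrakk>u \<in> amalgam_words Q R; v \<in> amalgam_words Q R\<rbrakk> \<Longrightarrow>
     amalgam_eval G (u @ v) = amalgam_eval G u \<otimes>\<^bsub>G\<^esub> amalgam_eval G v"
proof (induction u)
  case (Cons l u)
  then show ?case
    using sub amalgam_eval_closed[of u] amalgam_eval_closed[of v]
    by (auto simp: amalgam_words_def subgroup.mem_carrier m_assoc)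
qed (simp add: amalgam_eval_closed)

lemma amalgam_eq_sound:
  "amalgam_eq G Q R u v \<Longrightarrow>
     u \<in> amalgam_words Q R \<and> v \<in> amalgam_words Q R \<and> amalgam_eval G u = amalgam_eval G v"
proof (induction rule: amalgam_eq.induct)
  case (congr u v u' v')
  then show ?case
    using amalgam_eval_append by (simp add: amalgam_words_def)
qed (use sub in \<open>auto simp: amalgam_words_def subgroup.one_closed subgroup.m_closed
       subgroup.mem_carrier m_assoc\<close>)

lemma amalgam_equiv: "equiv (amalgam_words Q R) (amalgam_rel G Q R)"
proof (rule equivI)
  show "amalgam_rel G Q R \<subseteq> amalgam_words Q R \<times> amalgam_words Q R"
    using amalgam_eq_sound by (auto simp: amalgam_rel_def)
  show "refl_on (amalgam_words Q R) (amalgam_rel G Q R)"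
    by (auto simp: amalgam_rel_def refl_on_def intro: amalgam_eq.refl)
  show "sym (amalgam_rel G Q R)"
    by (auto simp: amalgam_rel_def sym_def intro: amalgam_eq.sym)
  show "trans (amalgam_rel G Q R)"
    unfolding amalgam_rel_def trans_def using amalgam_eq.trans by blast
qed

lemma amalgam_mult_class:
  assumes "u \<in> amalgam_words Q R" "v \<in> amalgam_words Q R"
  shows "amalgam_rel G Q R `` {u} \<otimes>\<^bsub>amalgam G Q R\<^esub> amalgam_rel G Q R `` {v}
           = amalgam_rel G Q R `` {u @ v}"
proof -
  have eq: "amalgam_rel G Q R `` {u' @ v'} = amalgam_rel G Q R `` {u @ v}"
    if "u' \<in> amalgam_rel G Q R `` {u}" "v' \<in> amalgam_rel G Q R `` {v}" for u' v'
  proof (rule equiv_class_eq[OF amalgam_equiv])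
    have "amalgam_eq G Q R u u'" "amalgam_eq G Q R v v'"
      using that by (auto simp: amalgam_rel_def)
    then show "(u' @ v', u @ v) \<in> amalgam_rel G Q R"
      unfolding amalgam_rel_def using amalgam_eq.congr amalgam_eq.sym by blast
  qed
  have self: "u \<in> amalgam_rel G Q R `` {u}" "v \<in> amalgam_rel G Q R `` {v}"
    using assms equiv_class_self[OF amalgam_equiv] by blast+
  have "(\<Union>u'\<in>amalgam_rel G Q R `` {u}. \<Union>v'\<in>amalgam_rel G Q R `` {v}. amalgam_rel G Q R `` {u' @ v'})
      = (\<Union>u'\<in>amalgam_rel G Q R `` {u}. \<Union>v'\<in>amalgam_rel G Q R `` {v}. amalgam_rel G Q R `` {u @ v})"
    by (intro SUP_cong HOL.refl eq)
  also have "\<dots> = amalgam_rel G Q R `` {u @ v}"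
    using self by blast
  finally show ?thesis
    by (simp add: amalgam_def)
qed

lemma amalgam_hom_class:
  assumes "w \<in> amalgam_words Q R"
  shows "amalgam_hom G (amalgam_rel G Q R `` {w}) = amalgam_eval G w"
proof -
  have "amalgam_eval G ` (amalgam_rel G Q R `` {w}) = {amalgam_eval G w}"
    using assms amalgam_eq_sound by (fastforce simp: amalgam_rel_def intro: amalgam_eq.refl)
  then show ?thesis
    by (simp add: amalgam_hom_def)
qed

lemma amalgam_group: "group (amalgam G Q R)"
proof (rule groupI)
  have nil: "[] \<in> amalgam_words Q R"
    by (simp add: amalgam_words_def)
  have app: "u @ v \<in> amalgam_words Q R" if "u \<in> amalgam_words Q R" "v \<in> amalgam_words Q R" for u v
    using that by (simp add: amalgam_words_def)
  have car: "carrier (amalgam G Q R) = amalgam_words Q R // amalgam_rel G Q R"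
    and one: "\<one>\<^bsub>amalgam G Q R\<^esub> = amalgam_rel G Q R `` {[]}"
    by (simp_all add: amalgam_def)
  note simps = car one amalgam_mult_class nil app quotientI
  show "\<one>\<^bsub>amalgam G Q R\<^esub> \<in> carrier (amalgam G Q R)"
    by (simp add: simps)
  fix x assume x: "x \<in> carrier (amalgam G Q R)"
  show "\<one>\<^bsub>amalgam G Q R\<^esub> \<otimes>\<^bsub>amalgam G Q R\<^esub> x = x"
    using x by (auto simp: simps elim!: quotientE)
  show "\<exists>y\<in>carrier (amalgam G Q R). y \<otimes>\<^bsub>amalgam G Q R\<^esub> x = \<one>\<^bsub>amalgam G Q R\<^esub>"
  proof -
    have "\<exists>v\<in>amalgam_words Q R. amalgam_eq G Q R (v @ w) []" if "w \<in> amalgam_words Q R" for w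
      using that
    proof (induction w)
      case Nil
      then show ?case
        using nil amalgam_eq.refl by fastforce
    next
      case (Cons l w)
      then obtain v where v: "v \<in> amalgam_words Q R" "amalgam_eq G Q R (v @ w) []"
        and w: "w \<in> amalgam_words Q R"
        by (auto simp: amalgam_words_def)
      obtain l' where l': "[l'] \<in> amalgam_words Q R" "amalgam_eq G Q R [l', l] []"
      proof (cases l)
        case (Inl a)
        then have "a \<in> Q" using Cons.prems by (auto simp: amalgam_words_def)
        then have "inv\<^bsub>G\<^esub> a \<in> Q" "inv\<^bsub>G\<^esub> a \<otimes>\<^bsub>G\<^esub> a = \<one>\<^bsub>G\<^esub>"
          using sub by (auto simp: subgroup.m_inv_closed subgroup.mem_carrier)
        then have "amalgam_eq G Q R [Inl (inv\<^bsub>G\<^esub> a), l] []"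
          using amalgam_eq.mult_l[of "inv\<^bsub>G\<^esub> a" Q a G R] \<open>a \<in> Q\<close> Inl
            amalgam_eq.trans amalgam_eq.one_l by metis
        then show ?thesis
          using that[of "Inl (inv\<^bsub>G\<^esub> a)"] \<open>inv\<^bsub>G\<^esub> a \<in> Q\<close> by (auto simp: amalgam_words_def)
      next
        case (Inr a)
        then have "a \<in> R" using Cons.prems by (auto simp: amalgam_words_def)
        then have "inv\<^bsub>G\<^esub> a \<in> R" "inv\<^bsub>G\<^esub> a \<otimes>\<^bsub>G\<^esub> a = \<one>\<^bsub>G\<^esub>"
          using sub by (auto simp: subgroup.m_inv_closed subgroup.mem_carrier)
        then have "amalgam_eq G Q R [Inr (inv\<^bsub>G\<^esub> a), l] []"
          using amalgam_eq.mult_r[of "inv\<^bsub>G\<^esub> a" R a G Q] \<open>a \<in> R\<close> Inr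
            amalgam_eq.trans amalgam_eq.one_r by metis
        then show ?thesis
          using that[of "Inr (inv\<^bsub>G\<^esub> a)"] \<open>inv\<^bsub>G\<^esub> a \<in> R\<close> by (auto simp: amalgam_words_def)
      qed
      have "amalgam_eq G Q R ((v @ [l', l]) @ w) ((v @ []) @ w)"
        using v(1) w l'(2) by (intro amalgam_eq.congr amalgam_eq.refl)
      then have "amalgam_eq G Q R ((v @ [l']) @ l # w) []"
        using v(2) amalgam_eq.trans by fastforce
      then show ?case
        using app[OF v(1) l'(1)] by blast
    qed
    moreover obtain w where w: "w \<in> amalgam_words Q R" "x = amalgam_rel G Q R `` {w}"
      using x by (auto simp: simps elim!: quotientE)
    ultimately obtain v where v: "v \<in> amalgam_words Q R" "amalgam_eq G Q R (v @ w) []"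
      by blast
    then have "amalgam_rel G Q R `` {v @ w} = amalgam_rel G Q R `` {[]}"
      by (intro equiv_class_eq[OF amalgam_equiv]) (simp add: amalgam_rel_def)
    then show ?thesis
      using v w by (intro bexI[of _ "amalgam_rel G Q R `` {v}"]) (auto simp: simps)
  qed
  fix y assume y: "y \<in> carrier (amalgam G Q R)"
  show "x \<otimes>\<^bsub>amalgam G Q R\<^esub> y \<in> carrier (amalgam G Q R)"
    using x y by (auto simp: simps elim!: quotientE)
  fix z assume "z \<in> carrier (amalgam G Q R)"
  then show "x \<otimes>\<^bsub>amalgam G Q R\<^esub> y \<otimes>\<^bsub>amalgam G Q R\<^esub> z = x \<otimes>\<^bsub>amalgam G Q R\<^esub> (y \<otimes>\<^bsub>amalgam G Q R\<^esub> z)"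
    using x y by (auto simp: simps elim!: quotientE)
qed

lemma amalgam_hom_hom: "amalgam_hom G \<in> hom (amalgam G Q R) G"
proof (rule homI)
  fix x assume "x \<in> carrier (amalgam G Q R)"
  then obtain u where u: "u \<in> amalgam_words Q R" "x = amalgam_rel G Q R `` {u}"
    by (auto simp: amalgam_def elim!: quotientE)
  then show "amalgam_hom G x \<in> carrier G"
    by (simp add: amalgam_hom_class amalgam_eval_closed)
  fix y assume "y \<in> carrier (amalgam G Q R)"
  then obtain v where v: "v \<in> amalgam_words Q R" "y = amalgam_rel G Q R `` {v}"
    by (auto simp: amalgam_def elim!: quotientE)
  have "u @ v \<in> amalgam_words Q R"
    using u v by (simp add: amalgam_words_def)
  then show "amalgam_hom G (x \<otimes>\<^bsub>amalgam G Q R\<^esub> y) = amalgam_hom G x \<otimes>\<^bsub>G\<^esub> amalgam_hom G y"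
    using u v by (simp add: amalgam_mult_class amalgam_hom_class amalgam_eval_append)
qed

end

end

theory Submission
  imports Defs
begin

text \<open>
  By maximality \<open>P = h H\<^sub>i h\<inverse>\<close> for some \<open>i\<close> and \<open>h\<close>, so the cosets \<open>f P\<close> are, up to right
  multiplication by \<open>h\<close>, the peripheral cosets \<open>f h H\<^sub>i\<close>. Distances are measured in two ways: in the
  Cayley graph, where peripheral cosets have diameter at most one, and in the word metric of \<open>X\<close>,
  which sees how far a path travels inside a coset.

  The geometric input is \<open>geodesic_penetrates\<close>. Let \<open>a\<close> and \<open>b\<close> be points of a peripheral coset closest
  to \<open>x\<close> and \<open>y\<close> in the Cayley graph. If \<open>a\<close> and \<open>b\<close> are far apart in the word metric, then every
  geodesic from \<open>x\<close> to \<open>y\<close> has an edge in that coset which starts near \<open>a\<close> and ends near \<open>b\<close>. To see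
  this, go from \<open>x\<close> to \<open>a\<close>, cross the coset in one edge, and go from \<open>b\<close> to \<open>y\<close>. Slim triangles show
  that the two legs either separate quickly or run close together just outside the coset. In the first
  case the path is a quasi-geodesic without backtracking and bounded coset penetration compares it with
  the geodesic; the second case is impossible, because then bounded coset penetration for a detour of
  bounded length bounds the distance from \<open>a\<close> to \<open>b\<close>. As a geodesic between two points of a coset is
  at most one edge, a coset has a bounded projection to every other coset of the same subgroup
  (\<open>distinct_coset_projection\<close>).

  Now let \<open>g = q\<^sub>0 r\<^sub>1 q\<^sub>1 \<dots> r\<^sub>n q\<^sub>n\<close> with \<open>r\<^sub>j \<in> R - Q\<close> and with the inner \<open>q\<^sub>j\<close> in \<open>Q - R\<close>, and let \<open>f\<^sub>j\<close> be
  the product of the factors before \<open>r\<^sub>j\<close>. Consecutive cosets \<open>f\<^sub>j h H\<^sub>i\<close> are different since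
  \<open>Q \<inter> P \<subseteq> R\<close>. Quasiconvexity of \<open>Q\<close> shows that the points \<open>q h\<close> with \<open>q \<in> Q\<close> project to \<open>h H\<^sub>i\<close> near
  \<open>Q \<inter> P\<close> (\<open>projection_near_intersection\<close>). So the two neighbours of the coset \<open>f\<^sub>j h H\<^sub>i\<close> project near
  \<open>f\<^sub>j z\<close> and \<open>f\<^sub>j r\<^sub>j z'\<close> with \<open>z, z' \<in> Q \<inter> P\<close>; these points differ by \<open>z\<inverse> r\<^sub>j z' \<in> R - Q\<close>, which is
  long by hypothesis. By induction on the number of factors, a geodesic from \<open>h\<close> to \<open>g h\<close> passes through
  all the cosets \<open>f\<^sub>j h H\<^sub>i\<close> in order (\<open>nearest_to_basepoint\<close>, \<open>track_through_syllable\<close>), and between two of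
  them it stays near a translate of \<open>Q\<close> by an element of the subgroup \<open>W\<close> generated by \<open>Q\<close> and \<open>R\<close>.

  The assertions of the theorem follow. The geodesic has at least \<open>n\<close> edges, so \<open>g \<noteq> \<one>\<close> if \<open>n \<ge> 1\<close>, and
  the natural map is injective by the normal form of elements of the amalgam. The geodesic stays near \<open>W\<close>,
  so \<open>W\<close> is relatively quasiconvex. Finally, the elements of a parabolic subgroup move \<open>h\<close> by a bounded
  amount, so if they lie in \<open>W\<close> their numbers \<open>n\<close> are bounded; and a subgroup of an amalgam with bounded
  syllable lengths is conjugate into a factor (\<open>bounded_subgroup_conjugate\<close>).
\<close>

section \<open>Word metrics\<close>

lemma (in group) cancel_inv_left [simp]:
  assumes "k \<in> carrier G" "g \<in> carrier G"
  shows "inv k \<otimes> (k \<otimes> g) = g" "k \<otimes> (inv k \<otimes> g) = g"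
  using assms by (simp_all add: m_assoc[symmetric])

text \<open>The lemmas below serve two metrics: the word metric of \<open>X\<close> and, with the values of all letters as
  generators, the metric of the Cayley graph.\<close>

locale symmetric_generators = group G for G :: "('a, 'b) monoid_scheme" (structure) +
  fixes Y :: "'a set"
  assumes gens_closed: "Y \<subseteq> carrier G"
    and gens_inv: "\<And>y. y \<in> Y \<Longrightarrow> inv y \<in> Y"
    and gens_generate: "generate G Y = carrier G"
begin

lemma word_closed: "set ws \<subseteq> Y \<Longrightarrow> foldr (\<otimes>) ws \<one> \<in> carrier G"
  using gens_closed by (induction ws) auto

lemma word_append:
  "set us \<subseteq> Y \<Longrightarrow> set vs \<subseteq> Y \<Longrightarrow>
     foldr (\<otimes>) (us @ vs) \<one> = foldr (\<otimes>) us \<one> \<otimes> foldr (\<otimes>) vs \<one>"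
proof (induction us)
  case (Cons u us)
  then show ?case
    using gens_closed word_closed[of us] word_closed[of vs] by (auto simp: m_assoc)
qed (simp add: word_closed)

lemma word_inverse:
  "set ws \<subseteq> Y \<Longrightarrow> foldr (\<otimes>) (rev (map (m_inv G) ws)) \<one> = inv (foldr (\<otimes>) ws \<one>)"
proof (induction ws)
  case (Cons w ws)
  then have "foldr (\<otimes>) (rev (map (m_inv G) ws) @ [inv w]) \<one> = inv (foldr (\<otimes>) ws \<one>) \<otimes> inv w"
    using gens_inv gens_closed by (subst word_append) (auto simp: subset_iff)
  then show ?case
    using Cons gens_closed word_closed[of ws] by (auto simp: inv_mult_group)
qed simp

lemma word_exists:
  assumes "g \<in> carrier G"
  shows "\<exists>ws. set ws \<subseteq> Y \<and> foldr (\<otimes>) ws \<one> = g"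
proof -
  have "g \<in> generate G Y"
    using assms gens_generate by simp
  then show ?thesis
  proof induction
    case one
    show ?case by (rule exI[of _ "[]"]) simp
  next
    case (incl h)
    then show ?case using gens_closed by (intro exI[of _ "[h]"]) auto
  next
    case (inv h)
    then show ?case using gens_closed gens_inv by (intro exI[of _ "[inv h]"]) auto
  next
    case (eng g h)
    then obtain us vs where "set us \<subseteq> Y" "foldr (\<otimes>) us \<one> = g" "set vs \<subseteq> Y" "foldr (\<otimes>) vs \<one> = h"
      by blast
    then show ?case
      using word_append by (intro exI[of _ "us @ vs"]) auto
  qed
qed

lemma word_length_le: "set ws \<subseteq> Y \<Longrightarrow> word_length G Y (foldr (\<otimes>) ws \<one>) \<le> length ws"
  unfolding word_length_def by (rule Least_le) auto

lemma shortest_word: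
  assumes "g \<in> carrier G"
  obtains ws where "set ws \<subseteq> Y" "length ws = word_length G Y g" "foldr (\<otimes>) ws \<one> = g"
proof -
  let ?P = "\<lambda>n. \<exists>ws. set ws \<subseteq> Y \<and> length ws = n \<and> foldr (\<otimes>) ws \<one> = g"
  have "\<exists>n. ?P n"
    using word_exists[OF assms] by auto
  then have "?P (word_length G Y g)"
    unfolding word_length_def by (rule LeastI_ex)
  then show ?thesis
    using that by blast
qed

lemma word_length_one [simp]: "word_length G Y \<one> = 0"
  using word_length_le[of "[]"] by simp

lemma word_length_gen: "y \<in> Y \<Longrightarrow> word_length G Y y \<le> 1"
  using word_length_le[of "[y]"] gens_closed by auto

lemma word_length_eq_0: "g \<in> carrier G \<Longrightarrow> word_length G Y g = 0 \<longleftrightarrow> g = \<one>"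
  by (metis shortest_word foldr_Nil id_apply length_0_conv word_length_one)

lemma word_length_mult:
  assumes "g \<in> carrier G" "h \<in> carrier G"
  shows "word_length G Y (g \<otimes> h) \<le> word_length G Y g + word_length G Y h"
proof -
  obtain us where us: "set us \<subseteq> Y" "length us = word_length G Y g" "foldr (\<otimes>) us \<one> = g"
    using shortest_word[OF assms(1)] .
  obtain vs where vs: "set vs \<subseteq> Y" "length vs = word_length G Y h" "foldr (\<otimes>) vs \<one> = h"
    using shortest_word[OF assms(2)] .
  show ?thesis
    using word_length_le[of "us @ vs"] word_append[OF us(1) vs(1)] us vs by auto
qed

lemma word_length_inv_le:
  assumes "g \<in> carrier G"
  shows "word_length G Y (inv g) \<le> word_length G Y g"
proof -
  obtain us where us: "set us \<subseteq> Y" "length us = word_length G Y g" "foldr (\<otimes>) us \<one> = g"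
    using shortest_word[OF assms(1)] .
  show ?thesis
    using word_length_le[of "rev (map (m_inv G) us)"] word_inverse[OF us(1)] us gens_inv by auto
qed

lemma word_length_inv [simp]: "g \<in> carrier G \<Longrightarrow> word_length G Y (inv g) = word_length G Y g"
  by (metis inv_closed inv_inv le_antisym word_length_inv_le)

lemma word_dist_self [simp]: "f \<in> carrier G \<Longrightarrow> word_dist G Y f f = 0"
  by (simp add: word_dist_def)

lemma word_dist_eq_0: "f \<in> carrier G \<Longrightarrow> g \<in> carrier G \<Longrightarrow> word_dist G Y f g = 0 \<longleftrightarrow> f = g"
  by (metis inv_closed inv_equality inv_inv l_inv m_closed word_dist_def word_length_eq_0)

lemma word_dist_sym:
  assumes "f \<in> carrier G" "g \<in> carrier G"
  shows "word_dist G Y f g = word_dist G Y g f"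
proof -
  have "inv f \<otimes> g = inv (inv g \<otimes> f)"
    using assms by (simp add: inv_mult_group)
  then show ?thesis
    using assms by (simp add: word_dist_def)
qed

lemma word_dist_triangle:
  assumes "f \<in> carrier G" "g \<in> carrier G" "h \<in> carrier G"
  shows "word_dist G Y f h \<le> word_dist G Y f g + word_dist G Y g h"
proof -
  have "inv f \<otimes> h = (inv f \<otimes> g) \<otimes> (inv g \<otimes> h)"
    using assms by (simp add: m_assoc)
  then show ?thesis
    using assms word_length_mult[of "inv f \<otimes> g" "inv g \<otimes> h"] by (simp add: word_dist_def)
qed

lemma word_dist_translate:
  assumes "k \<in> carrier G" "f \<in> carrier G" "g \<in> carrier G"
  shows "word_dist G Y (k \<otimes> f) (k \<otimes> g) = word_dist G Y f g"
proof -
  have "inv (k \<otimes> f) \<otimes> (k \<otimes> g) = inv f \<otimes> g"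
    using assms by (simp add: inv_mult_group m_assoc)
  then show ?thesis
    using assms by (simp add: word_dist_def)
qed

lemma word_dist_mult_right:
  "f \<in> carrier G \<Longrightarrow> g \<in> carrier G \<Longrightarrow> word_dist G Y f (f \<otimes> g) = word_length G Y g"
  by (simp add: word_dist_def m_assoc[symmetric])

lemma finite_word_ball:
  assumes "finite Y"
  shows "finite {g \<in> carrier G. word_length G Y g \<le> n}"
proof (rule finite_subset)
  show "{g \<in> carrier G. word_length G Y g \<le> n}
          \<subseteq> (\<lambda>ws. foldr (\<otimes>) ws \<one>) ` {ws. set ws \<subseteq> Y \<and> length ws \<le> n}"
  proof
    fix g assume "g \<in> {g \<in> carrier G. word_length G Y g \<le> n}"
    then obtain ws where "set ws \<subseteq> Y" "length ws \<le> n" "foldr (\<otimes>) ws \<one> = g"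
      by (metis (no_types, lifting) mem_Collect_eq shortest_word)
    then show "g \<in> (\<lambda>ws. foldr (\<otimes>) ws \<one>) ` {ws. set ws \<subseteq> Y \<and> length ws \<le> n}"
      by auto
  qed
  show "finite ((\<lambda>ws. foldr (\<otimes>) ws \<one>) ` {ws. set ws \<subseteq> Y \<and> length ws \<le> n})"
    using finite_lists_length_le[OF assms] by simp
qed

end

section \<open>Geodesics in the Cayley graph\<close>

locale peripheral_cayley = group G for G :: "('a, 'b) monoid_scheme" (structure) +
  fixes X :: "'a set" and m :: nat and H :: "nat \<Rightarrow> 'a set"
  assumes X_closed: "X \<subseteq> carrier G"
    and X_finite: "finite X"
    and X_inv: "\<And>x. x \<in> X \<Longrightarrow> inv x \<in> X"
    and X_generate: "generate G X = carrier G"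
    and H_subgroup: "\<And>i. i \<in> {1..m} \<Longrightarrow> subgroup (H i) G"
begin

abbreviation "lx \<equiv> word_length G X"
abbreviation "dx \<equiv> word_dist G X"
abbreviation "dg \<equiv> cayley_dist G X m H"
abbreviation "letters \<equiv> alphabet G X m H"

sublocale X: symmetric_generators G X
  by unfold_locales (use X_closed X_inv X_generate in auto)

lemma H_closed: "i \<in> {1..m} \<Longrightarrow> h \<in> H i \<Longrightarrow> h \<in> carrier G"
  using H_subgroup subgroup.mem_carrier by metis

lemma letter_val_letters: "letter_val ` letters = X \<union> (\<Union>i\<in>{1..m}. H i - {\<one>})"
  unfolding alphabet_def per_letters_def image_Un image_UN image_image by simp

lemma letter_val_closed: "l \<in> letters \<Longrightarrow> letter_val l \<in> carrier G"
  using letter_val_letters X_closed H_closed by blast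

sublocale C: symmetric_generators G "letter_val ` letters"
proof
  show sub: "letter_val ` letters \<subseteq> carrier G"
    using letter_val_closed by blast
  show "inv y \<in> letter_val ` letters" if "y \<in> letter_val ` letters" for y
  proof -
    from that consider "y \<in> X" | i where "i \<in> {1..m}" "y \<in> H i" "y \<noteq> \<one>"
      unfolding letter_val_letters by blast
    then show ?thesis
    proof cases
      case 1
      then show ?thesis unfolding letter_val_letters using X_inv by blast
    next
      case 2
      then have "inv y \<in> H i" "inv y \<noteq> \<one>"
        using H_subgroup[of i] H_closed[of i y]
        by (auto simp: subgroup.m_inv_closed inv_eq_1_iff)
      with 2 show ?thesis unfolding letter_val_letters by blast
    qed
  qed
  show "generate G (letter_val ` letters) = carrier G"
  proof
    show "generate G (letter_val ` letters) \<subseteq> carrier G"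
      by (rule generate_incl[OF sub])
    show "carrier G \<subseteq> generate G (letter_val ` letters)"
      using mono_generate[of X "letter_val ` letters"] X_generate
      unfolding letter_val_letters by blast
  qed
qed

lemma walk_eq:
  "g \<in> carrier G \<Longrightarrow> set w \<subseteq> letters \<Longrightarrow>
     walk G g w = g \<otimes> foldr (\<otimes>) (map letter_val w) \<one>"
proof (induction w arbitrary: g)
  case (Cons l w)
  then have "foldr (\<otimes>) (map letter_val w) \<one> \<in> carrier G"
    by (intro C.word_closed) auto
  then show ?case
    using Cons letter_val_closed by (auto simp: m_assoc)
qed simp

lemma walk_closed: "g \<in> carrier G \<Longrightarrow> set w \<subseteq> letters \<Longrightarrow> walk G g w \<in> carrier G"
  using letter_val_closed by (induction w arbitrary: g) auto

lemma walk_append: "walk G g (u @ v) = walk G (walk G g u) v"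
  by (induction u arbitrary: g) auto

lemma path_start_simp [simp]: "path_start G (x, w) = x"
  by (simp add: path_start_def path_vertex_def)

lemma path_len_simp [simp]: "path_len (x, w) = length w"
  by (simp add: path_len_def)

abbreviation "vertex x w \<equiv> path_vertex G (x, w)"

lemma path_vertex_0 [simp]: "vertex x w 0 = x"
  by (simp add: path_vertex_def)

lemma path_end_simp: "path_end G (x, w) = walk G x w"
  by (simp add: path_end_def path_vertex_def)

lemma path_vertex_length [simp]: "vertex x w (length w) = walk G x w"
  by (simp add: path_vertex_def)

lemma cayley_path_simp: "cayley_path G X m H (x, w) \<longleftrightarrow> x \<in> carrier G \<and> set w \<subseteq> letters"
  by (simp add: cayley_path_def)

lemma path_vertex_closed:
  "x \<in> carrier G \<Longrightarrow> set w \<subseteq> letters \<Longrightarrow> vertex x w n \<in> carrier G"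
  unfolding path_vertex_def by (rule walk_closed) (auto dest: in_set_takeD)

lemma path_vertex_Suc:
  "n < length w \<Longrightarrow>
     vertex x w (Suc n) = vertex x w n \<otimes> letter_val (w ! n)"
  by (simp add: path_vertex_def take_Suc_conv_app_nth walk_append)

lemma path_vertex_append1:
  "n \<le> length u \<Longrightarrow> vertex x (u @ v) n = vertex x u n"
  by (simp add: path_vertex_def)

lemma path_vertex_append2:
  "n \<ge> length u \<Longrightarrow> vertex x (u @ v) n = vertex (walk G x u) v (n - length u)"
  by (simp add: path_vertex_def walk_append)

lemma path_vertex_drop:
  "k + n \<le> length w \<Longrightarrow>
     vertex (vertex x w k) (drop k w) n = vertex x w (k + n)"
  by (simp add: path_vertex_def walk_append[symmetric] take_add)

lemma path_vertex_take:
  "n \<le> k \<Longrightarrow> vertex x (take k w) n = vertex x w n"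
  by (simp add: path_vertex_def min_def)

text \<open>A path from \<open>f\<close> to \<open>g\<close> is a word in the letters with value \<open>f\<inverse> g\<close>. Forgetting from which
  of the sets \<open>X\<close> and \<open>H i\<close> a letter is taken does not change the length, so the graph metric is the word
  metric of the set of letter values.\<close>

lemma cayley_dist_eq:
  assumes "f \<in> carrier G" "g \<in> carrier G"
  shows "dg f g = word_dist G (letter_val ` letters) f g"
proof -
  have "(\<exists>p. cayley_path G X m H p \<and> path_start G p = f \<and> path_end G p = g \<and> path_len p = n)
     \<longleftrightarrow> (\<exists>ws. set ws \<subseteq> letter_val ` letters \<and> length ws = n \<and> foldr (\<otimes>) ws \<one> = inv f \<otimes> g)"
    (is "?L \<longleftrightarrow> ?R") for n
  proof
    assume ?L
    then obtain w where w: "set w \<subseteq> letters" "walk G f w = g" "length w = n"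
      by (auto simp: cayley_path_simp path_end_simp)
    have "foldr (\<otimes>) (map letter_val w) \<one> \<in> carrier G"
      using w by (intro C.word_closed) auto
    then have "foldr (\<otimes>) (map letter_val w) \<one> = inv f \<otimes> g"
      using w walk_eq[OF assms(1) w(1)] assms by (simp add: inv_solve_left)
    with w show ?R
      by (intro exI[of _ "map letter_val w"]) auto
  next
    assume ?R
    then obtain ws where ws: "ws \<in> lists (letter_val ` letters)" "length ws = n"
      "foldr (\<otimes>) ws \<one> = inv f \<otimes> g"
      by auto
    then obtain w where w: "set w \<subseteq> letters" "ws = map letter_val w"
      unfolding lists_image by auto
    have "walk G f w = g"
      using walk_eq[OF assms(1) w(1)] ws w assms by (simp add: m_assoc[symmetric])
    then show ?L
      using assms w ws by (intro exI[of _ "(f, w)"]) (auto simp: cayley_path_simp path_end_simp)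
  qed
  then show ?thesis
    unfolding cayley_dist_def word_dist_def word_length_def by presburger
qed

lemma dg_self [simp]: "f \<in> carrier G \<Longrightarrow> dg f f = 0"
  by (simp add: cayley_dist_eq)

lemma dg_eq_0: "f \<in> carrier G \<Longrightarrow> g \<in> carrier G \<Longrightarrow> dg f g = 0 \<longleftrightarrow> f = g"
  by (simp add: cayley_dist_eq C.word_dist_eq_0)

lemma dg_sym: "f \<in> carrier G \<Longrightarrow> g \<in> carrier G \<Longrightarrow> dg f g = dg g f"
  by (simp add: cayley_dist_eq C.word_dist_sym)

lemma dg_triangle:
  "f \<in> carrier G \<Longrightarrow> g \<in> carrier G \<Longrightarrow> h \<in> carrier G \<Longrightarrow> dg f h \<le> dg f g + dg g h"
  by (simp add: cayley_dist_eq C.word_dist_triangle)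

lemma dg_translate:
  "k \<in> carrier G \<Longrightarrow> f \<in> carrier G \<Longrightarrow> g \<in> carrier G \<Longrightarrow> dg (k \<otimes> f) (k \<otimes> g) = dg f g"
  by (simp add: cayley_dist_eq C.word_dist_translate)

lemma dg_walk_le:
  assumes "x \<in> carrier G" "set w \<subseteq> letters"
  shows "dg x (walk G x w) \<le> length w"
  unfolding cayley_dist_def using assms
  by (intro Least_le exI[of _ "(x, w)"]) (auto simp: cayley_path_simp path_end_simp)

definition geodesic :: "'a \<Rightarrow> 'a letter list \<Rightarrow> 'a \<Rightarrow> bool" where
  "geodesic x w y \<longleftrightarrow> x \<in> carrier G \<and> set w \<subseteq> letters \<and> walk G x w = y \<and> length w = dg x y"

lemma geodesic_path_iff:
  "geodesic_path G X m H (x, w) \<and> path_end G (x, w) = y \<longleftrightarrow> geodesic x w y"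
  by (auto simp: geodesic_path_def geodesic_def cayley_path_simp path_end_simp)

lemma geodesic_exists:
  assumes "x \<in> carrier G" "y \<in> carrier G"
  obtains w where "geodesic x w y"
proof -
  obtain ws where ws: "set ws \<subseteq> letter_val ` letters" "length ws = dg x y"
    "foldr (\<otimes>) ws \<one> = inv x \<otimes> y"
    using C.shortest_word[of "inv x \<otimes> y"] assms cayley_dist_eq[OF assms] by (auto simp: word_dist_def)
  from ws(1) have "ws \<in> lists (letter_val ` letters)"
    by auto
  then obtain w where w: "set w \<subseteq> letters" "ws = map letter_val w"
    unfolding lists_image by auto
  have "walk G x w = y"
    using walk_eq[OF assms(1) w(1)] ws w assms by (simp add: m_assoc[symmetric])
  then show ?thesis
    using that[of w] assms w ws by (auto simp: geodesic_def)
qed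

lemma geodesic_closed:
  assumes "geodesic x w y"
  shows "x \<in> carrier G" "y \<in> carrier G" "set w \<subseteq> letters" "vertex x w n \<in> carrier G"
  using assms walk_closed path_vertex_closed unfolding geodesic_def by blast+

lemma dg_path_vertices_le:
  assumes "x \<in> carrier G" "set w \<subseteq> letters" "i \<le> j" "j \<le> length w"
  shows "dg (vertex x w i) (vertex x w j) \<le> j - i"
proof -
  let ?v = "vertex x w i" and ?u = "take (j - i) (drop i w)"
  have "walk G ?v ?u = vertex x w j"
    using path_vertex_drop[of i "j - i" w x] assms by (simp add: path_vertex_def)
  moreover have "set ?u \<subseteq> letters"
    using assms(2) by (meson set_drop_subset set_take_subset subset_trans)
  ultimately show ?thesis
    using dg_walk_le[of ?v ?u] path_vertex_closed[OF assms(1,2)] assms by simp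
qed

lemma geodesic_dist:
  assumes "geodesic x w y" "i \<le> j" "j \<le> length w"
  shows "dg (vertex x w i) (vertex x w j) = j - i"
proof -
  note cl = geodesic_closed[OF assms(1)]
  let ?v = "vertex x w"
  have y: "?v (length w) = y"
    using assms(1) by (metis geodesic_def path_vertex_length)
  have "length w = dg x y"
    using assms by (simp add: geodesic_def)
  also have "\<dots> \<le> dg (?v 0) (?v i) + dg (?v i) (?v j) + dg (?v j) (?v (length w))"
    using dg_triangle[of x "?v i" y] dg_triangle[of "?v i" "?v j" y] cl y by simp
  finally have "length w \<le> dg (?v 0) (?v i) + dg (?v i) (?v j) + dg (?v j) (?v (length w))" .
  then show ?thesis
    using dg_path_vertices_le[OF cl(1,3), of 0 i] dg_path_vertices_le[OF cl(1,3), of i j]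
      dg_path_vertices_le[OF cl(1,3), of j "length w"] assms by linarith
qed

lemma geodesic_drop:
  assumes "geodesic x w y" "k \<le> length w"
  shows "geodesic (vertex x w k) (drop k w) y"
  using assms geodesic_closed[OF assms(1)] geodesic_dist[OF assms(1), of k "length w"]
    path_vertex_drop[of k "length w - k" w x]
  by (auto simp: geodesic_def path_vertex_def dest: in_set_dropD)

lemma geodesic_take:
  assumes "geodesic x w y" "k \<le> length w"
  shows "geodesic x (take k w) (vertex x w k)"
  using assms geodesic_closed[OF assms(1)] geodesic_dist[OF assms(1), of 0 k]
  by (auto simp: geodesic_def path_vertex_def dest: in_set_takeD)

lemma geodesic_append:
  assumes "geodesic x u y" "geodesic y v z" "dg x y + dg y z = dg x z"
  shows "geodesic x (u @ v) z"
  using assms by (auto simp: geodesic_def walk_append)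

lemma geodesic_vertex_between:
  assumes "geodesic x w y" "k \<le> length w"
  shows "dg x (vertex x w k) = k" "dg (vertex x w k) y = length w - k"
    "dg x (vertex x w k) + dg (vertex x w k) y = dg x y"
  using geodesic_dist[OF assms(1), of 0 k] geodesic_dist[OF assms(1), of k "length w"] assms
    path_vertex_length[of x w]
  by (auto simp: geodesic_def simp del: path_vertex_length)

end

section \<open>Slim triangles of vertices\<close>

context peripheral_cayley
begin

text \<open>A vertex lies on some geodesic from \<open>x\<close> to \<open>y\<close> if and only if it satisfies this equation of
  distances, so slimness can be stated without choosing geodesics.\<close>

definition between :: "'a \<Rightarrow> 'a \<Rightarrow> 'a \<Rightarrow> bool" where
  "between x p y \<longleftrightarrow> p \<in> carrier G \<and> dg x p + dg p y = dg x y"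

lemma geodesic_through:
  assumes "x \<in> carrier G" "y \<in> carrier G" "between x p y"
  obtains w k where "geodesic x w y" "k \<le> length w" "vertex x w k = p"
proof -
  have p: "p \<in> carrier G"
    using assms by (simp add: between_def)
  obtain u v where uv: "geodesic x u p" "geodesic p v y"
    using geodesic_exists assms(1,2) p by metis
  then have "geodesic x (u @ v) y"
    using assms(3) by (intro geodesic_append) (auto simp: between_def)
  moreover have "vertex x (u @ v) (length u) = p"
    using uv(1) by (metis geodesic_def order_refl path_vertex_append1 path_vertex_length)
  ultimately show ?thesis
    using that[of "u @ v" "length u"] by simp
qed

lemma geodesic_between: "geodesic x w y \<Longrightarrow> k \<le> length w \<Longrightarrow> between x (vertex x w k) y"
  using geodesic_vertex_between(3) geodesic_closed(4) by (simp add: between_def)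

lemma between_sym:
  "x \<in> carrier G \<Longrightarrow> y \<in> carrier G \<Longrightarrow> between x p y \<longleftrightarrow> between y p x"
  unfolding between_def by (metis add.commute dg_sym)

text \<open>The isometric map from an interval to the metric graph that traverses an edge path.\<close>

definition segment :: "'a \<Rightarrow> 'a letter list \<Rightarrow> real \<Rightarrow> 'a point" where
  "segment x w t = (let n = nat \<lfloor>t\<rfloor> in
     if t = real n then Vertex (vertex x w n)
     else Inner (vertex x w n) (w ! n) (t - real n))"

lemma segment_nat: "segment x w (real n) = Vertex (vertex x w n)"
  by (simp add: segment_def)

lemma geodesic_dist_abs:
  assumes "geodesic x w y" "i \<le> length w" "j \<le> length w"
  shows "real (dg (vertex x w i) (vertex x w j)) = \<bar>real i - real j\<bar>"
proof (cases "i \<le> j")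
  case True
  then show ?thesis using geodesic_dist[OF assms(1), of i j] assms by simp
next
  case False
  then show ?thesis
    using geodesic_dist[OF assms(1), of j i] assms geodesic_closed[OF assms(1)]
      dg_sym[of "vertex x w i" "vertex x w j"] by simp
qed

lemma segment_inner:
  assumes "0 \<le> t" "t \<le> real (length w)" "t \<noteq> real (nat \<lfloor>t\<rfloor>)"
  obtains n where "nat \<lfloor>t\<rfloor> = n" "n < length w" "real n < t" "t < real n + 1"
    "segment x w t = Inner (vertex x w n) (w ! n) (t - real n)"
proof (rule that[OF HOL.refl])
  let ?n = "nat \<lfloor>t\<rfloor>"
  show 1: "real ?n < t"
    using assms by linarith
  show "t < real ?n + 1"
    using assms by linarith
  show "?n < length w"
    using 1 assms(2) by linarith
  show "segment x w t = Inner (vertex x w ?n) (w ! ?n) (t - real ?n)"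
    using assms(3) by (simp add: segment_def Let_def)
qed

text \<open>A point of a segment can be left only through vertices of the path, and the distance to such a
  vertex is the difference of the parameters. This turns all candidates for \<open>point_dist\<close> between two
  points of a geodesic into lengths of broken lines on the real axis.\<close>

lemma exits_segment:
  assumes "0 \<le> t" "t \<le> real (length w)" "(u, s) \<in> exits G (segment x w t)"
  shows "\<exists>n\<le>length w. u = vertex x w n \<and> s = \<bar>t - real n\<bar>"
proof (cases "t = real (nat \<lfloor>t\<rfloor>)")
  case True
  then have "segment x w t = Vertex (vertex x w (nat \<lfloor>t\<rfloor>))"
    by (simp add: segment_def)
  then show ?thesis
    using assms True by (intro exI[of _ "nat \<lfloor>t\<rfloor>"]) auto
next
  case False
  then obtain n where n: "n < length w" "real n < t" "t < real n + 1"
    "segment x w t = Inner (vertex x w n) (w ! n) (t - real n)"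
    using segment_inner[OF assms(1,2)] by metis
  then have "(u = vertex x w n \<and> s = \<bar>t - real n\<bar>) \<or>
      (u = vertex x w (Suc n) \<and> s = \<bar>t - real (Suc n)\<bar>)"
    using assms(3) path_vertex_Suc[OF n(1)] by auto
  moreover have "n \<le> length w" "Suc n \<le> length w"
    using n(1) by auto
  ultimately show ?thesis
    by blast
qed

lemma floor_exit:
  assumes "0 \<le> t" "t \<le> real (length w)"
  shows "(vertex x w (nat \<lfloor>t\<rfloor>), t - real (nat \<lfloor>t\<rfloor>)) \<in> exits G (segment x w t)"
  by (auto simp: segment_def Let_def)

lemma ceiling_exit:
  assumes "0 \<le> t" "t \<le> real (length w)"
  shows "(vertex x w (nat \<lceil>t\<rceil>), real (nat \<lceil>t\<rceil>) - t) \<in> exits G (segment x w t)"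
proof (cases "t = real (nat \<lfloor>t\<rfloor>)")
  case True
  then have "nat \<lceil>t\<rceil> = nat \<lfloor>t\<rfloor>"
    by (metis ceiling_of_nat floor_of_nat)
  then show ?thesis
    using floor_exit[OF assms, of x] True by simp
next
  case False
  then obtain n where n: "nat \<lfloor>t\<rfloor> = n" "n < length w" "real n < t" "t < real n + 1"
    "segment x w t = Inner (vertex x w n) (w ! n) (t - real n)"
    using segment_inner[OF assms(1,2)] by metis
  then have "nat \<lceil>t\<rceil> = Suc n"
    by linarith
  with n show ?thesis
    using path_vertex_Suc[OF n(2)] by simp
qed

lemma finite_exits: "finite (exits G p)"
  by (cases p) auto

lemma finite_same_edge_dist: "finite (same_edge_dist p q)"
  by (cases p; cases q) auto

lemma finite_point_dist_candidates:
  "finite ((\<lambda>((u, s), (v, t)). s + real (dg u v) + t) ` (exits G p \<times> exits G q) \<union> same_edge_dist p q)"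
  using finite_exits finite_same_edge_dist by blast

text \<open>A geodesic visits a vertex only once, so two of its points lie in the interior of one edge only if
  they belong to the same step of the path.\<close>

lemma same_edge_dist_segment:
  assumes geo: "geodesic x w y"
    and s: "0 \<le> s" "s \<le> real (length w)" and t: "0 \<le> t" "t \<le> real (length w)"
  shows "same_edge_dist (segment x w s) (segment x w t) \<subseteq> {\<bar>s - t\<bar>}"
proof (cases "s = real (nat \<lfloor>s\<rfloor>) \<or> t = real (nat \<lfloor>t\<rfloor>)")
  case True
  then show ?thesis
  proof
    assume "s = real (nat \<lfloor>s\<rfloor>)"
    then show ?thesis
      by (metis empty_subsetI same_edge_dist.simps(2) segment_nat)
  next
    assume "t = real (nat \<lfloor>t\<rfloor>)"
    then show ?thesis
      by (cases "segment x w s") (metis empty_subsetI same_edge_dist.simps(2,3) segment_nat)+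
  qed
next
  case False
  then obtain n k where n: "n < length w"
      "segment x w s = Inner (vertex x w n) (w ! n) (s - real n)"
    and k: "k < length w"
      "segment x w t = Inner (vertex x w k) (w ! k) (t - real k)"
    using segment_inner[OF s] segment_inner[OF t] by metis
  have "vertex x w n = vertex x w k \<Longrightarrow> n = k"
    using geodesic_dist_abs[OF geo, of n k] n k geodesic_closed(4)[OF geo] by simp
  then show ?thesis
    using n k by auto
qed

lemma point_dist_segment:
  assumes geo: "geodesic x w y"
    and s: "0 \<le> s" "s \<le> real (length w)" and t: "0 \<le> t" "t \<le> real (length w)"
  shows "point_dist G X m H (segment x w s) (segment x w t) = \<bar>s - t\<bar>"
proof -
  let ?p = "segment x w s" and ?q = "segment x w t" and ?v = "vertex x w"
  let ?A = "(\<lambda>((u, s), (v, t)). s + real (dg u v) + t) ` (exits G ?p \<times> exits G ?q) \<union> same_edge_dist ?p ?q"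
  have "Min ?A = \<bar>s - t\<bar>"
  proof (rule Min_eqI[OF finite_point_dist_candidates])
    fix r assume "r \<in> ?A"
    then show "\<bar>s - t\<bar> \<le> r"
    proof
      assume "r \<in> same_edge_dist ?p ?q"
      then show ?thesis
        using same_edge_dist_segment[OF assms] by auto
    next
      assume "r \<in> (\<lambda>((u, s), (v, t)). s + real (dg u v) + t) ` (exits G ?p \<times> exits G ?q)"
      then obtain u a v b where uv: "(u, a) \<in> exits G ?p" "(v, b) \<in> exits G ?q"
        "r = a + real (dg u v) + b"
        by auto
      obtain i where i: "i \<le> length w" "u = ?v i" "a = \<bar>s - real i\<bar>"
        using exits_segment[OF s uv(1)] by blast
      obtain j where j: "j \<le> length w" "v = ?v j" "b = \<bar>t - real j\<bar>"
        using exits_segment[OF t uv(2)] by blast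
      show ?thesis
        unfolding uv(3) i j geodesic_dist_abs[OF geo i(1) j(1)] by linarith
    qed
  next
    have cand: "a + real (dg u v) + b \<in> ?A"
      if "(u, a) \<in> exits G ?p" "(v, b) \<in> exits G ?q" for u a v b
      using that by (intro UnI1 image_eqI[of _ _ "((u, a), (v, b))"]) auto
    consider "\<lceil>s\<rceil> \<le> \<lfloor>t\<rfloor>" | "\<lceil>t\<rceil> \<le> \<lfloor>s\<rfloor>" | "\<lfloor>t\<rfloor> < \<lceil>s\<rceil>" "\<lfloor>s\<rfloor> < \<lceil>t\<rceil>"
      by linarith
    then show "\<bar>s - t\<bar> \<in> ?A"
    proof cases
      case 1
      have le: "nat \<lceil>s\<rceil> \<le> length w" "nat \<lfloor>t\<rfloor> \<le> length w" "s \<le> t"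
        using s t 1 by linarith+
      have "real (nat \<lceil>s\<rceil>) \<le> real (nat \<lfloor>t\<rfloor>)"
        using 1 by linarith
      then have "(real (nat \<lceil>s\<rceil>) - s) + real (dg (?v (nat \<lceil>s\<rceil>)) (?v (nat \<lfloor>t\<rfloor>))) + (t - real (nat \<lfloor>t\<rfloor>)) = \<bar>s - t\<bar>"
        unfolding geodesic_dist_abs[OF geo le(1,2)] using le(3) by linarith
      moreover have "(real (nat \<lceil>s\<rceil>) - s) + real (dg (?v (nat \<lceil>s\<rceil>)) (?v (nat \<lfloor>t\<rfloor>))) + (t - real (nat \<lfloor>t\<rfloor>)) \<in> ?A"
        by (rule cand[OF ceiling_exit[OF s] floor_exit[OF t]])
      ultimately show ?thesis
        by (simp only:)
    next
      case 2
      have le: "nat \<lceil>t\<rceil> \<le> length w" "nat \<lfloor>s\<rfloor> \<le> length w" "t \<le> s"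
        using s t 2 by linarith+
      have "real (nat \<lceil>t\<rceil>) \<le> real (nat \<lfloor>s\<rfloor>)"
        using 2 by linarith
      then have "(s - real (nat \<lfloor>s\<rfloor>)) + real (dg (?v (nat \<lfloor>s\<rfloor>)) (?v (nat \<lceil>t\<rceil>))) + (real (nat \<lceil>t\<rceil>) - t) = \<bar>s - t\<bar>"
        unfolding geodesic_dist_abs[OF geo le(2,1)] using le(3) by linarith
      moreover have "(s - real (nat \<lfloor>s\<rfloor>)) + real (dg (?v (nat \<lfloor>s\<rfloor>)) (?v (nat \<lceil>t\<rceil>))) + (real (nat \<lceil>t\<rceil>) - t) \<in> ?A"
        by (rule cand[OF floor_exit[OF s] ceiling_exit[OF t]])
      ultimately show ?thesis
        by (simp only:)
    next
      case 3
      then have fl: "\<lfloor>s\<rfloor> = \<lfloor>t\<rfloor>"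
        by linarith
      have ni: "s \<noteq> real (nat \<lfloor>s\<rfloor>)" "t \<noteq> real (nat \<lfloor>t\<rfloor>)"
        using 3 fl by (metis ceiling_of_nat floor_of_nat less_irrefl)+
      have "\<bar>(s - real (nat \<lfloor>s\<rfloor>)) - (t - real (nat \<lfloor>t\<rfloor>))\<bar> \<in> same_edge_dist ?p ?q"
        using fl ni by (simp add: segment_def Let_def)
      then show ?thesis
        using fl by simp
    qed
  qed
  then show ?thesis
    by (simp add: point_dist_def)
qed

lemma segment_in_points:
  assumes "geodesic x w y" "0 \<le> t" "t \<le> real (length w)"
  shows "segment x w t \<in> cayley_points G X m H"
proof (cases "t = real (nat \<lfloor>t\<rfloor>)")
  case True
  then show ?thesis
    using geodesic_closed(4)[OF assms(1)] by (auto simp: segment_def cayley_points_def)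
next
  case False
  then obtain n where n: "n < length w" "real n < t" "t < real n + 1"
    "segment x w t = Inner (vertex x w n) (w ! n) (t - real n)"
    using segment_inner[OF assms(2,3)] by metis
  have "w ! n \<in> letters"
    using n(1) geodesic_closed(3)[OF assms(1)] nth_mem by blast
  then show ?thesis
    using n geodesic_closed(4)[OF assms(1)] by (auto simp: cayley_points_def)
qed

lemma geodesic_segment_segment:
  assumes "geodesic x w y"
  shows "geodesic_segment (cayley_points G X m H) (point_dist G X m H)
           (segment x w) (real (length w)) (Vertex x) (Vertex y)"
  unfolding geodesic_segment_def
proof (intro conjI ballI)
  show "segment x w 0 = Vertex x"
    using segment_nat[of x w 0] by simp
  show "segment x w (real (length w)) = Vertex y"
    using assms by (metis geodesic_def path_vertex_length segment_nat)
qed (use segment_in_points[OF assms] point_dist_segment[OF assms] in auto)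

text \<open>A nearby point in the interior of an edge can be replaced by the exit through which the distance
  to it is realised.\<close>

lemma close_to_segment:
  assumes "geodesic x w y" "q \<in> segment x w ` {0..real (length w)}"
    and "point_dist G X m H (Vertex p) q \<le> \<delta>"
  shows "\<exists>v. between x v y \<and> real (dg p v) \<le> \<delta>"
proof -
  obtain t where t: "0 \<le> t" "t \<le> real (length w)" "q = segment x w t"
    using assms(2) by auto
  let ?A = "(\<lambda>((u, s), (v, t)). s + real (dg u v) + t) ` (exits G (Vertex p) \<times> exits G q)
    \<union> same_edge_dist (Vertex p) q"
  have "?A \<noteq> {}"
    using floor_exit[OF t(1,2), of x] t(3) by auto
  then have "point_dist G X m H (Vertex p) q \<in> ?A"
    unfolding point_dist_def using finite_point_dist_candidates by (intro Min_in)
  then obtain v b where vb: "(v, b) \<in> exits G q" "point_dist G X m H (Vertex p) q = real (dg p v) + b"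
    by auto
  obtain n where n: "n \<le> length w" "v = vertex x w n" "b = \<bar>t - real n\<bar>"
    using exits_segment[OF t(1,2)] vb(1) t(3) by blast
  have "between x v y"
    using geodesic_between[OF assms(1) n(1)] n(2) by simp
  then show ?thesis
    using vb(2) n(3) assms(3) by (intro exI[of _ v]) auto
qed

definition slim :: "nat \<Rightarrow> bool" where
  "slim D \<longleftrightarrow> (\<forall>x y z p. x \<in> carrier G \<longrightarrow> y \<in> carrier G \<longrightarrow> z \<in> carrier G \<longrightarrow> between x p y \<longrightarrow>
    (\<exists>q. (between y q z \<or> between z q x) \<and> dg p q \<le> D))"

lemma slim_vertex_triangles:
  assumes "hyperbolic_space (cayley_points G X m H) (point_dist G X m H) \<delta>"
  shows "slim (nat \<lfloor>\<delta>\<rfloor>)"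
  unfolding slim_def
proof (intro allI impI)
  fix x y z p
  assume xyz: "x \<in> carrier G" "y \<in> carrier G" "z \<in> carrier G" and p: "between x p y"
  obtain u k where u: "geodesic x u y" "k \<le> length u" "vertex x u k = p"
    using geodesic_through[OF xyz(1,2) p] .
  obtain v where v: "geodesic y v z"
    using geodesic_exists xyz by metis
  obtain w where w: "geodesic z w x"
    using geodesic_exists xyz by metis
  have "Vertex p \<in> segment x u ` {0..real (length u)}"
    using u(2,3) segment_nat[of x u k] by (intro image_eqI[of _ _ "real k"]) auto
  then obtain q where q: "q \<in> segment y v ` {0..real (length v)} \<union> segment z w ` {0..real (length w)}"
    "point_dist G X m H (Vertex p) q \<le> \<delta>"
    using assms u(1) v w geodesic_segment_segment unfolding hyperbolic_space_def by meson
  then have "\<exists>q. (between y q z \<or> between z q x) \<and> real (dg p q) \<le> \<delta>"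
    using close_to_segment[OF v _ q(2)] close_to_segment[OF w _ q(2)] by blast
  then show "\<exists>q. (between y q z \<or> between z q x) \<and> dg p q \<le> nat \<lfloor>\<delta>\<rfloor>"
    by (metis le_nat_floor)
qed

end

section \<open>Paths visiting every peripheral coset at most once\<close>

context peripheral_cayley
begin

text \<open>The coset \<open>a H i\<close> is represented by any of its elements, so that two components are connected
  exactly if this relation holds between their initial vertices.\<close>

definition same_coset :: "nat \<Rightarrow> 'a \<Rightarrow> 'a \<Rightarrow> bool" where
  "same_coset i a b \<longleftrightarrow> inv a \<otimes> b \<in> H i"

lemma same_coset_refl: "i \<in> {1..m} \<Longrightarrow> a \<in> carrier G \<Longrightarrow> same_coset i a a"
  using H_subgroup by (simp add: same_coset_def subgroup.one_closed)

lemma same_coset_sym: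
  assumes "i \<in> {1..m}" "a \<in> carrier G" "b \<in> carrier G" "same_coset i a b"
  shows "same_coset i b a"
proof -
  have "inv (inv a \<otimes> b) \<in> H i"
    using assms H_subgroup by (simp add: same_coset_def subgroup.m_inv_closed)
  then show ?thesis
    using assms by (simp add: same_coset_def inv_mult_group)
qed

lemma same_coset_trans:
  assumes "i \<in> {1..m}" "a \<in> carrier G" "b \<in> carrier G" "c \<in> carrier G"
    "same_coset i a b" "same_coset i b c"
  shows "same_coset i a c"
proof -
  have "(inv a \<otimes> b) \<otimes> (inv b \<otimes> c) \<in> H i"
    using assms H_subgroup by (simp add: same_coset_def subgroup.m_closed)
  then show ?thesis
    using assms by (simp add: same_coset_def m_assoc)
qed

lemma same_coset_translate:
  assumes "g \<in> carrier G" "a \<in> carrier G" "b \<in> carrier G"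
  shows "same_coset i (g \<otimes> a) (g \<otimes> b) \<longleftrightarrow> same_coset i a b"
  using assms by (simp add: same_coset_def inv_mult_group m_assoc)

lemma mem_l_coset_iff:
  assumes "i \<in> {1..m}" "x \<in> carrier G" "a \<in> carrier G"
  shows "a \<in> x <# H i \<longleftrightarrow> same_coset i x a"
proof
  assume "a \<in> x <# H i"
  then obtain h where "h \<in> H i" "a = x \<otimes> h"
    by (auto simp: l_coset_def)
  then show "same_coset i x a"
    using assms H_closed by (simp add: same_coset_def)
next
  assume "same_coset i x a"
  then have "inv x \<otimes> a \<in> H i" "a = x \<otimes> (inv x \<otimes> a)"
    using assms by (simp_all add: same_coset_def)
  then show "a \<in> x <# H i"
    unfolding l_coset_def by blast
qed

lemma dg_same_coset_le:
  assumes "i \<in> {1..m}" "a \<in> carrier G" "b \<in> carrier G" "same_coset i a b"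
  shows "dg a b \<le> 1"
proof (cases "inv a \<otimes> b = \<one>")
  case True
  then show ?thesis
    using assms by (simp add: cayley_dist_eq word_dist_def)
next
  case False
  then have "inv a \<otimes> b \<in> letter_val ` letters"
    using assms unfolding letter_val_letters same_coset_def by blast
  then show ?thesis
    using C.word_length_gen assms by (simp add: cayley_dist_eq word_dist_def)
qed

definition peripheral_edge :: "nat \<Rightarrow> 'a letter list \<Rightarrow> nat \<Rightarrow> bool" where
  "peripheral_edge i w n \<longleftrightarrow> n < length w \<and> w ! n \<in> per_letters G H i"

lemma peripheral_edge_index:
  assumes "set w \<subseteq> letters" "peripheral_edge i w n"
  shows "i \<in> {1..m}"
proof -
  have "w ! n \<in> letters" "w ! n \<in> per_letters G H i"
    using assms nth_mem by (auto simp: peripheral_edge_def)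
  then show ?thesis
    by (auto simp: alphabet_def per_letters_def)
qed

lemma peripheral_edge_same_coset:
  assumes "x \<in> carrier G" "set w \<subseteq> letters" "peripheral_edge i w n"
  shows "same_coset i (vertex x w n) (vertex x w (Suc n))"
proof -
  have h: "letter_val (w ! n) \<in> H i" "n < length w"
    using assms(3) by (auto simp: peripheral_edge_def per_letters_def)
  moreover have "letter_val (w ! n) \<in> carrier G"
    using h H_closed peripheral_edge_index[OF assms(2,3)] by blast
  ultimately show ?thesis
    using path_vertex_closed[OF assms(1,2)] by (simp add: path_vertex_Suc same_coset_def)
qed

lemma same_coset_geodesic:
  assumes j: "j \<in> {1..m}" and cl: "u \<in> carrier G" "v \<in> carrier G" and uv: "same_coset j u v"
  obtains w where "geodesic u w v" "\<And>i l. peripheral_edge i w l \<Longrightarrow> l = 0 \<and> i = j"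
proof (cases "u = v")
  case True
  then show ?thesis
    using that[of "[]"] cl by (simp add: geodesic_def peripheral_edge_def)
next
  case False
  let ?h = "inv u \<otimes> v"
  have "?h \<noteq> \<one>"
    using False C.word_dist_eq_0[of u v] cl by (auto simp: word_dist_def)
  then have h: "Per j ?h \<in> per_letters G H j"
    using uv by (simp add: per_letters_def same_coset_def)
  moreover have "dg u v = 1"
    using dg_same_coset_le[OF j cl uv] False dg_eq_0[OF cl] by linarith
  ultimately have "geodesic u [Per j ?h] v"
    using cl j by (auto simp: geodesic_def alphabet_def)
  then show ?thesis
    using that[of "[Per j ?h]"] by (auto simp: peripheral_edge_def per_letters_def)
qed

text \<open>In such a path every component is a single edge. Hence all its vertices are phase vertices and it
  has no backtracking; components can be named by positions in the label.\<close>

definition tight :: "'a \<Rightarrow> 'a letter list \<Rightarrow> bool" where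
  "tight x w \<longleftrightarrow> x \<in> carrier G \<and> set w \<subseteq> letters \<and>
     (\<forall>i n n'. n < n' \<and> peripheral_edge i w n \<and> peripheral_edge i w n' \<longrightarrow>
        \<not> same_coset i (vertex x w n) (vertex x w n'))"

lemma tight_per_segment:
  assumes "tight x w" "per_segment G H i (x, w) a b"
  shows "b = Suc a"
proof (rule ccontr)
  assume "b \<noteq> Suc a"
  then have "peripheral_edge i w a" "peripheral_edge i w (Suc a)"
    using assms(2) by (auto simp: per_segment_def peripheral_edge_def)
  moreover have "x \<in> carrier G" "set w \<subseteq> letters"
    using assms(1) by (simp_all add: tight_def)
  ultimately show False
    using assms(1) peripheral_edge_same_coset unfolding tight_def by blast
qed

lemma tight_component_iff:
  assumes "tight x w"
  shows "is_component G m H (x, w) (i, a, b) \<longleftrightarrow> b = Suc a \<and> peripheral_edge i w a"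
proof
  assume "is_component G m H (x, w) (i, a, b)"
  then have "per_segment G H i (x, w) a b"
    by simp
  then show "b = Suc a \<and> peripheral_edge i w a"
    using tight_per_segment[OF assms] by (auto simp: per_segment_def peripheral_edge_def)
next
  assume *: "b = Suc a \<and> peripheral_edge i w a"
  then have "per_segment G H i (x, w) a b"
    by (auto simp: per_segment_def peripheral_edge_def)
  moreover have "i \<in> {1..m}"
    using * assms peripheral_edge_index by (auto simp: tight_def)
  moreover have "a' = a \<and> b' = b" if "a' \<le> a" "b \<le> b'" "per_segment G H i (x, w) a' b'" for a' b'
    using tight_per_segment[OF assms that(3)] that(1,2) * by auto
  ultimately show "is_component G m H (x, w) (i, a, b)"
    by auto
qed

lemma connected_comps_edges:
  assumes "x \<in> carrier G" "set w \<subseteq> letters" "y \<in> carrier G" "set u \<subseteq> letters"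
    and "peripheral_edge i w a" "peripheral_edge i u b"
  shows "connected_comps G H (x, w) (i, a, Suc a) (y, u) (i, b, Suc b)
    \<longleftrightarrow> same_coset i (vertex x w a) (vertex y u b)"
proof -
  let ?v = "vertex x w" and ?v' = "vertex y u"
  have i: "i \<in> {1..m}"
    using assms peripheral_edge_index by blast
  have cl: "?v n \<in> carrier G" "?v' n \<in> carrier G" for n
    using assms path_vertex_closed by auto
  have st: "same_coset i (?v a) (?v (Suc a))" "same_coset i (?v' b) (?v' (Suc b))"
    using assms peripheral_edge_same_coset by auto
  have sets: "{a..Suc a} = {a, Suc a}" "{b..Suc b} = {b, Suc b}"
    by auto
  have eq: "connected_comps G H (x, w) (i, a, Suc a) (y, u) (i, b, Suc b)
    \<longleftrightarrow> (\<exists>z\<in>carrier G. same_coset i z (?v a) \<and> same_coset i z (?v (Suc a)) \<and>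
                same_coset i z (?v' b) \<and> same_coset i z (?v' (Suc b)))"
    unfolding connected_comps_def comp_vertices.simps sets using cl i by (auto simp: mem_l_coset_iff)
  show ?thesis
    unfolding eq using st cl i same_coset_sym same_coset_trans same_coset_refl by meson
qed

lemma tight_without_backtracking:
  assumes "tight x w"
  shows "without_backtracking G m H (x, w)"
  unfolding without_backtracking_def isolated_comp_def
proof (intro allI impI notI)
  fix s assume s: "is_component G m H (x, w) s"
  assume "\<exists>t. is_component G m H (x, w) t \<and> t \<noteq> s \<and> connected_comps G H (x, w) s (x, w) t"
  then obtain t where t: "is_component G m H (x, w) t" "t \<noteq> s" "connected_comps G H (x, w) s (x, w) t"
    by blast
  obtain i a where s': "s = (i, a, Suc a)" "peripheral_edge i w a"
    using s tight_component_iff[OF assms] by (cases s) auto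
  obtain j b where t': "t = (j, b, Suc b)" "peripheral_edge j w b"
    using t(1) tight_component_iff[OF assms] by (cases t) auto
  have ij: "j = i"
    using t(3) s' t' by (simp add: connected_comps_def)
  have xw: "x \<in> carrier G" "set w \<subseteq> letters"
    using assms by (auto simp: tight_def)
  have "same_coset i (vertex x w a) (vertex x w b)"
    using t(3) connected_comps_edges[OF xw xw s'(2)] t' s' ij by simp
  moreover then have "same_coset i (vertex x w b) (vertex x w a)"
    using same_coset_sym xw path_vertex_closed peripheral_edge_index s'(2) by metis
  moreover have "a \<noteq> b"
    using t(2) s' t' ij by auto
  ultimately show False
    using assms s'(2) t'(2) ij unfolding tight_def by (metis linorder_neqE_nat)
qed

lemma tight_phase_vertices:
  assumes "tight x w"
  shows "phase_vertices G m H (x, w) = {vertex x w n | n. n \<le> length w}"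
proof -
  have "\<not> (\<exists>i a b. is_component G m H (x, w) (i, a, b) \<and> a < n \<and> n < b)" for n
    unfolding tight_component_iff[OF assms] by auto
  then show ?thesis
    unfolding phase_vertices_def by simp
qed

text \<open>A \<open>(1, c)\<close>-quasi-geodesic; only the additive constant varies in the argument.\<close>

definition almost_geodesic :: "nat \<Rightarrow> 'a \<Rightarrow> 'a letter list \<Rightarrow> bool" where
  "almost_geodesic c x w \<longleftrightarrow> (\<forall>i j. i \<le> j \<and> j \<le> length w \<longrightarrow>
     j - i \<le> dg (vertex x w i) (vertex x w j) + c)"

lemma tight_almost_geodesic_path:
  assumes "tight x w" "almost_geodesic c x w"
  shows "quasi_geodesic_path G X m H 1 (real c) (x, w)"
  unfolding quasi_geodesic_path_def
proof (intro conjI allI impI)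
  show "cayley_path G X m H (x, w)"
    using assms(1) by (simp add: tight_def cayley_path_simp)
  fix i j assume "i \<le> j \<and> j \<le> path_len (x, w)"
  then have "j - i \<le> dg (vertex x w i) (vertex x w j) + c"
    using assms(2) by (simp add: almost_geodesic_def)
  then show "real (j - i) \<le> 1 * real (dg (vertex x w i) (vertex x w j)) + real c"
    by linarith
qed

lemma geodesic_almost_geodesic: "geodesic x w y \<Longrightarrow> almost_geodesic c x w"
  using geodesic_dist by (auto simp: almost_geodesic_def)

text \<open>Two edges in one coset would lie on a stretch of length at least two between points of that coset,
  whose distance is at most one.\<close>

lemma geodesic_tight:
  assumes "geodesic x w y"
  shows "tight x w"
  unfolding tight_def
proof (intro conjI allI impI notI)
  note cl = geodesic_closed[OF assms]
  show "x \<in> carrier G" "set w \<subseteq> letters"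
    using cl by auto
  fix i n n'
  let ?v = "vertex x w"
  assume *: "n < n' \<and> peripheral_edge i w n \<and> peripheral_edge i w n'" "same_coset i (?v n) (?v n')"
  then have i: "i \<in> {1..m}" and len: "Suc n' \<le> length w"
    using peripheral_edge_index cl(3) by (auto simp: peripheral_edge_def)
  have "same_coset i (?v n) (?v (Suc n'))"
    using same_coset_trans[OF i] peripheral_edge_same_coset[OF cl(1,3)] * cl(4) by blast
  then have "dg (?v n) (?v (Suc n')) \<le> 1"
    using dg_same_coset_le[OF i] cl(4) by blast
  then show False
    using geodesic_dist[OF assms, of n "Suc n'"] * len by linarith
qed

text \<open>The hypotheses under which bounded coset penetration applies to two tight paths.\<close>

definition comparable :: "nat \<Rightarrow> nat \<Rightarrow> 'a \<Rightarrow> 'a letter list \<Rightarrow> 'a \<Rightarrow> 'a letter list \<Rightarrow> bool" where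
  "comparable c k x w y u \<longleftrightarrow> tight x w \<and> tight y u \<and> almost_geodesic c x w \<and> almost_geodesic c y u \<and>
     dx x y \<le> k \<and> dx (walk G x w) (walk G y u) \<le> k"

lemma geodesics_comparable:
  "geodesic x w x' \<Longrightarrow> geodesic y u y' \<Longrightarrow> dx x y \<le> k \<Longrightarrow> dx x' y' \<le> k \<Longrightarrow> comparable c k x w y u"
  by (simp add: comparable_def geodesic_tight geodesic_almost_geodesic) (simp add: geodesic_def)

lemma bcp_tight:
  assumes "bounded_coset_penetration G X m H"
  obtains \<epsilon> :: nat where
    "\<And>x w y u n. comparable c k x w y u \<Longrightarrow> n \<le> length w \<Longrightarrow>
       \<exists>n'\<le>length u. dx (vertex x w n) (vertex y u n') \<le> \<epsilon>"
    "\<And>x w y u i n. comparable c k x w y u \<Longrightarrow> peripheral_edge i w n \<Longrightarrow>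
       dx (vertex x w n) (vertex x w (Suc n)) > \<epsilon> \<Longrightarrow>
       \<exists>n'. peripheral_edge i u n' \<and> same_coset i (vertex x w n) (vertex y u n')"
    "\<And>x w y u i n n'. comparable c k x w y u \<Longrightarrow> peripheral_edge i w n \<Longrightarrow> peripheral_edge i u n' \<Longrightarrow>
       same_coset i (vertex x w n) (vertex y u n') \<Longrightarrow>
       dx (vertex x w n) (vertex y u n') \<le> \<epsilon> \<and>
       dx (vertex x w (Suc n)) (vertex y u (Suc n')) \<le> \<epsilon>"
proof -
  let ?bcp = "\<lambda>\<epsilon> p q. in_word_nbhd G X \<epsilon> (phase_vertices G m H p) (phase_vertices G m H q) \<and>
          in_word_nbhd G X \<epsilon> (phase_vertices G m H q) (phase_vertices G m H p) \<and>
          (\<forall>s. is_component G m H p s \<and> dx (comp_start G p s) (comp_end G p s) > \<epsilon> \<longrightarrow>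
             (\<exists>t. is_component G m H q t \<and> connected_comps G H p s q t)) \<and>
          (\<forall>s t. is_component G m H p s \<and> is_component G m H q t \<and> connected_comps G H p s q t \<longrightarrow>
             max (dx (comp_start G p s) (comp_start G q t))
                 (dx (comp_end G p s) (comp_end G q t)) \<le> \<epsilon>)"
  have "1 \<le> (1::real) \<and> 0 \<le> real c \<and> 0 \<le> real k"
    by simp
  then obtain \<epsilon> where \<epsilon>: "\<forall>p q. quasi_geodesic_path G X m H 1 (real c) p \<and>
        quasi_geodesic_path G X m H 1 (real c) q \<and>
        without_backtracking G m H p \<and> without_backtracking G m H q \<and>
        similar_paths G X (real k) p q \<longrightarrow> ?bcp \<epsilon> p q"
    using assms[unfolded bounded_coset_penetration_def, THEN spec[of _ 1], THEN spec[of _ "real c"],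
      THEN spec[of _ "real k"], THEN mp] by blast
  have both: "?bcp \<epsilon> (x, w) (y, u)"
    if "comparable c k x w y u" for x w y u
  proof -
    have "similar_paths G X (real k) (x, w) (y, u)"
      using that by (simp add: similar_paths_def path_end_simp comparable_def)
    then show ?thesis
      using \<epsilon>[THEN spec[of _ "(x, w)"], THEN spec[of _ "(y, u)"], THEN mp] that
        tight_almost_geodesic_path tight_without_backtracking unfolding comparable_def by blast
  qed
  show ?thesis
  proof (rule that)
    fix x w y u n
    assume a: "comparable c k x w y u" and n: "n \<le> length w"
    then have t: "tight x w" "tight y u"
      by (simp_all add: comparable_def)
    show "\<exists>n'\<le>length u. dx (vertex x w n) (vertex y u n') \<le> \<epsilon>"
      using both[OF a] n unfolding in_word_nbhd_def tight_phase_vertices[OF t(1)] tight_phase_vertices[OF t(2)]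
      by blast
  next
    fix x w y u i n
    assume a: "comparable c k x w y u" and e: "peripheral_edge i w n"
      "dx (vertex x w n) (vertex x w (Suc n)) > \<epsilon>"
    then have t: "tight x w" "tight y u"
      by (simp_all add: comparable_def)
    have "is_component G m H (x, w) (i, n, Suc n)"
      using tight_component_iff[OF t(1)] e(1) by simp
    then obtain s where s: "is_component G m H (y, u) s" "connected_comps G H (x, w) (i, n, Suc n) (y, u) s"
      using both[OF a] e(2) by (metis comp_end.simps comp_start.simps)
    then obtain n' where s': "s = (i, n', Suc n')" "peripheral_edge i u n'"
      using tight_component_iff[OF t(2)] by (metis connected_comps_def fst_conv prod_cases3)
    then show "\<exists>n'. peripheral_edge i u n' \<and> same_coset i (vertex x w n) (vertex y u n')"
      using s connected_comps_edges[OF _ _ _ _ e(1) s'(2)] t unfolding tight_def by blast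
  next
    fix x w y u i n n'
    assume a: "comparable c k x w y u" and e: "peripheral_edge i w n"
      "peripheral_edge i u n'" "same_coset i (vertex x w n) (vertex y u n')"
    then have t: "tight x w" "tight y u"
      by (simp_all add: comparable_def)
    have "is_component G m H (x, w) (i, n, Suc n)" "is_component G m H (y, u) (i, n', Suc n')"
      using tight_component_iff t e(1,2) by simp_all
    moreover have "connected_comps G H (x, w) (i, n, Suc n) (y, u) (i, n', Suc n')"
      using connected_comps_edges[OF _ _ _ _ e(1,2)] t e(3) unfolding tight_def by blast
    ultimately have "max (dx (comp_start G (x, w) (i, n, Suc n)) (comp_start G (y, u) (i, n', Suc n')))
                 (dx (comp_end G (x, w) (i, n, Suc n)) (comp_end G (y, u) (i, n', Suc n'))) \<le> \<epsilon>"
      using both[OF a] by blast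
    then show "dx (vertex x w n) (vertex y u n') \<le> \<epsilon> \<and>
        dx (vertex x w (Suc n)) (vertex y u (Suc n')) \<le> \<epsilon>"
      by simp
  qed
qed

end

section \<open>Closest points in peripheral cosets\<close>

context peripheral_cayley
begin

definition nearest :: "nat \<Rightarrow> 'a \<Rightarrow> 'a \<Rightarrow> 'a \<Rightarrow> bool" where
  "nearest i g x a \<longleftrightarrow> a \<in> carrier G \<and> same_coset i g a \<and>
     (\<forall>b\<in>carrier G. same_coset i g b \<longrightarrow> dg x a \<le> dg x b)"

lemma nearest_exists:
  assumes "i \<in> {1..m}" "g \<in> carrier G"
  obtains a where "nearest i g x a"
proof -
  have "\<exists>a. (a \<in> carrier G \<and> same_coset i g a) \<and>
      (\<forall>b. b \<in> carrier G \<and> same_coset i g b \<longrightarrow> dg x a \<le> dg x b)"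
    using assms same_coset_refl by (intro ex_has_least_nat[of _ g]) auto
  then show ?thesis
    using that unfolding nearest_def by blast
qed

lemma nearest_closed: "nearest i g x a \<Longrightarrow> a \<in> carrier G"
  by (simp add: nearest_def)

lemma nearest_between:
  assumes "x \<in> carrier G" "nearest i g x a" "between x u a"
  shows "nearest i g u a"
  unfolding nearest_def
proof (intro conjI ballI impI)
  show "a \<in> carrier G" "same_coset i g a"
    using assms(2) by (auto simp: nearest_def)
  fix b assume b: "b \<in> carrier G" "same_coset i g b"
  then have "dg x a \<le> dg x b"
    using assms(2) by (simp add: nearest_def)
  moreover have "dg x b \<le> dg x u + dg u b" "dg x u + dg u a = dg x a"
    using assms b dg_triangle by (auto simp: between_def)
  ultimately show "dg u a \<le> dg u b"
    by linarith
qed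

lemma nearest_same_coset:
  assumes "i \<in> {1..m}" "g \<in> carrier G" "nearest i g x a" "nearest i g y b"
  shows "same_coset i a b"
  using assms same_coset_sym same_coset_trans unfolding nearest_def by meson

lemma nearest_representative:
  assumes "i \<in> {1..m}" "g \<in> carrier G" "g' \<in> carrier G" "same_coset i g g'"
  shows "nearest i g x a \<longleftrightarrow> nearest i g' x a"
proof -
  have "same_coset i g b \<longleftrightarrow> same_coset i g' b" if "b \<in> carrier G" for b
    using assms that same_coset_sym same_coset_trans by meson
  then show ?thesis
    unfolding nearest_def by blast
qed

lemma nearest_translate:
  assumes k: "k \<in> carrier G" "g \<in> carrier G" "x \<in> carrier G" and a: "nearest i g x a"
  shows "nearest i (k \<otimes> g) (k \<otimes> x) (k \<otimes> a)"
  unfolding nearest_def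
proof (intro conjI ballI impI)
  have cl: "a \<in> carrier G" "same_coset i g a"
    using a by (auto simp: nearest_def)
  then show "k \<otimes> a \<in> carrier G" "same_coset i (k \<otimes> g) (k \<otimes> a)"
    using k by (auto simp: same_coset_translate)
  fix b assume b: "b \<in> carrier G" "same_coset i (k \<otimes> g) b"
  have kb: "k \<otimes> (inv k \<otimes> b) = b" "inv k \<otimes> b \<in> carrier G"
    using k b by auto
  then have "same_coset i g (inv k \<otimes> b)"
    using same_coset_translate[OF k(1,2) kb(2)] b by simp
  then have "dg x a \<le> dg x (inv k \<otimes> b)"
    using a kb by (simp add: nearest_def)
  then show "dg (k \<otimes> x) (k \<otimes> a) \<le> dg (k \<otimes> x) b"
    using dg_translate[OF k(1,3) cl(1)] dg_translate[OF k(1,3) kb(2)] kb(1) by simp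
qed

text \<open>A geodesic to a closest point of a coset meets the coset only at its end.\<close>

lemma nearest_geodesic_avoids:
  assumes "nearest i g x a" "geodesic x w a" "n < length w"
  shows "\<not> same_coset i g (vertex x w n)"
proof
  assume "same_coset i g (vertex x w n)"
  then have "dg x a \<le> dg x (vertex x w n)"
    using assms(1) geodesic_closed(4)[OF assms(2)] by (simp add: nearest_def)
  then show False
    using geodesic_vertex_between(1)[OF assms(2)] assms(2,3) by (simp add: geodesic_def)
qed

text \<open>The path that follows a geodesic to a closest point, crosses the coset in one edge
  and leaves it along a geodesic.\<close>

context
  fixes i g x a y b A B
  assumes i: "i \<in> {1..m}" and gx: "g \<in> carrier G" "x \<in> carrier G" "y \<in> carrier G"
    and na: "nearest i g x a" and nb: "nearest i g y b" and ab: "a \<noteq> b"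
    and A: "geodesic x A a" and B: "geodesic b B y"
begin

abbreviation (input) "crossing \<equiv> A @ Per i (inv a \<otimes> b) # B"

lemma crossing_letter: "Per i (inv a \<otimes> b) \<in> per_letters G H i"
proof -
  have "inv a \<otimes> b \<in> H i"
    using nearest_same_coset[OF i gx(1) na nb] by (simp add: same_coset_def)
  moreover have "inv a \<otimes> b \<noteq> \<one>"
    using ab na nb C.word_dist_eq_0[of a b] by (auto simp: word_dist_def nearest_def)
  ultimately show ?thesis
    by (simp add: per_letters_def)
qed

lemma crossing_letters: "set crossing \<subseteq> letters"
  using geodesic_closed(3)[OF A] geodesic_closed(3)[OF B] crossing_letter i
  by (auto simp: alphabet_def)

lemma crossing_closed: "a \<in> carrier G" "b \<in> carrier G"
  using na nb nearest_closed by auto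

lemma walk_A: "walk G x A = a"
  using A by (simp add: geodesic_def)

lemma crossing_vertex_left:
  "n \<le> length A \<Longrightarrow> vertex x crossing n = vertex x A n"
  by (simp add: path_vertex_append1)

lemma crossing_vertex_right:
  assumes "n > length A"
  shows "vertex x crossing n = vertex b B (n - Suc (length A))"
proof -
  have "vertex x crossing n = vertex a (Per i (inv a \<otimes> b) # B) (n - length A)"
    using assms walk_A by (simp add: path_vertex_append2)
  moreover obtain k where "n - length A = Suc k"
    using assms by (metis Suc_diff_Suc)
  moreover then have "vertex a (Per i (inv a \<otimes> b) # B) (n - length A) = vertex b B k"
    "k = n - Suc (length A)"
    using crossing_closed by (auto simp: path_vertex_def)
  ultimately show ?thesis by simp
qed

lemma crossing_vertices:
  "vertex x crossing (length A) = a" "vertex x crossing (Suc (length A)) = b"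
  using crossing_vertex_left[of "length A"] crossing_vertex_right[of "Suc (length A)"] walk_A by simp_all

lemma walk_crossing: "walk G x crossing = y"
  using crossing_closed B walk_A by (simp add: walk_append geodesic_def)

lemma crossing_edge_middle: "peripheral_edge i crossing (length A)"
  using crossing_letter by (simp add: peripheral_edge_def)

lemma crossing_edge_left:
  "n < length A \<Longrightarrow> peripheral_edge j crossing n \<Longrightarrow> peripheral_edge j A n"
  by (simp add: peripheral_edge_def nth_append)

lemma crossing_edge_right:
  assumes "n > length A" "peripheral_edge j crossing n"
  shows "peripheral_edge j B (n - Suc (length A))"
proof -
  obtain k where "n = length A + Suc k"
    using assms(1) less_iff_Suc_add by auto
  then show ?thesis
    using assms(2) by (simp add: peripheral_edge_def nth_append)
qed

lemma left_avoids: "n < length A \<Longrightarrow> \<not> same_coset i g (vertex x A n)"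
  using nearest_geodesic_avoids[OF na A] .

lemma right_avoids:
  assumes "0 < n" "n \<le> length B"
  shows "\<not> same_coset i g (vertex b B n)"
proof
  assume "same_coset i g (vertex b B n)"
  then have "dg y b \<le> dg y (vertex b B n)"
    using nb geodesic_closed(4)[OF B] by (simp add: nearest_def)
  then have "dg b y \<le> dg (vertex b B n) y"
    using dg_sym crossing_closed gx geodesic_closed(4)[OF B] by metis
  then show False
    using geodesic_vertex_between(2)[OF B assms(2)] B assms by (simp add: geodesic_def)
qed

text \<open>The legs \<open>A\<close> and \<open>B\<close> are geodesics that meet the coset of \<open>g\<close> only in \<open>a\<close> and in \<open>b\<close>. So no edge of a
  leg lies in the coset of the middle edge, and no two edges of one leg lie in one coset. What remains
  is a coset visited by both legs, which is excluded by hypothesis.\<close>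

lemma crossing_tight:
  assumes free: "\<And>j n k. peripheral_edge j A n \<Longrightarrow> peripheral_edge j B k \<Longrightarrow>
      \<not> same_coset j (vertex x A n) (vertex b B k)"
  shows "tight x crossing"
  unfolding tight_def
proof (intro conjI allI impI notI)
  show "x \<in> carrier G" "set crossing \<subseteq> letters"
    using gx crossing_letters by auto
  note clA = geodesic_closed[OF A] and clB = geodesic_closed[OF B]
  fix j n n'
  let ?v = "vertex x crossing"
  assume *: "n < n' \<and> peripheral_edge j crossing n \<and> peripheral_edge j crossing n'"
    and sc: "same_coset j (?v n) (?v n')"
  then have j: "j \<in> {1..m}" and n: "n < n'"
    using peripheral_edge_index crossing_letters by blast+
  have mid: "j = i" if "n = length A \<or> n' = length A"
    using that * by (auto simp: peripheral_edge_def per_letters_def)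
  consider "n' < length A" | "n' = length A" | "n < length A" "length A < n'"
    | "n = length A" | "length A < n"
    using n by linarith
  then show False
  proof cases
    case 1
    then show False
      using crossing_edge_left * sc geodesic_tight[OF A] crossing_vertex_left n unfolding tight_def
      by (metis less_imp_le order_less_trans)
  next
    case 2
    then have "same_coset i (vertex x A n) a"
      using mid sc crossing_vertex_left n crossing_vertices(1) by auto
    then have "same_coset i g (vertex x A n)"
      using na i gx same_coset_sym same_coset_trans clA crossing_closed unfolding nearest_def by meson
    then show False
      using left_avoids n 2 by blast
  next
    case 3
    then show False
      using free[of j n "n' - Suc (length A)"] crossing_edge_left crossing_edge_right * sc
        crossing_vertex_left[of n] crossing_vertex_right[of n'] by simp
  next
    case 4
    let ?k = "n' - Suc (length A)"
    have e: "peripheral_edge i B ?k"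
      using crossing_edge_right[of n' j] 4 n * mid by simp
    have "same_coset i a (vertex b B ?k)"
      using sc 4 n mid crossing_vertices(1) crossing_vertex_right by simp
    then have "same_coset i a (vertex b B (Suc ?k))"
      using same_coset_trans[OF i] crossing_closed clB(4) peripheral_edge_same_coset[OF clB(1,3) e] by blast
    then have "same_coset i g (vertex b B (Suc ?k))"
      using na same_coset_trans[OF i] gx crossing_closed clB(4) unfolding nearest_def by blast
    then show False
      using right_avoids[of "Suc ?k"] e by (simp add: peripheral_edge_def)
  next
    case 5
    let ?k = "n - Suc (length A)" and ?k' = "n' - Suc (length A)"
    have "peripheral_edge j B ?k" "peripheral_edge j B ?k'" "?k < ?k'"
      "same_coset j (vertex b B ?k) (vertex b B ?k')"
      using crossing_edge_right[of n j] crossing_edge_right[of n' j] 5 n * sc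
        crossing_vertex_right[of n] crossing_vertex_right[of n'] by auto
    then show False
      using geodesic_tight[OF B] unfolding tight_def by blast
  qed
qed

lemma crossing_almost_geodesic:
  assumes far: "\<And>u v. between x u a \<Longrightarrow> between b v y \<Longrightarrow> dg u a + dg b v + 1 \<le> dg u v + c"
  shows "almost_geodesic c x crossing"
  unfolding almost_geodesic_def
proof (intro allI impI)
  fix k l
  let ?v = "vertex x crossing"
  assume kl: "k \<le> l \<and> l \<le> length crossing"
  consider "l \<le> length A" | "k \<le> length A" "length A < l" | "length A < k"
    by linarith
  then show "l - k \<le> dg (?v k) (?v l) + c"
  proof cases
    case 1
    then show ?thesis
      using geodesic_dist[OF A, of k l] kl by (simp add: crossing_vertex_left)
  next
    case 2
    let ?l = "l - Suc (length A)"
    have l: "?l \<le> length B"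
      using kl by auto
    have "dg (vertex x A k) a = length A - k" "dg b (vertex b B ?l) = ?l"
      using geodesic_vertex_between(2)[OF A 2(1)] geodesic_vertex_between(1)[OF B l] by auto
    then have "(length A - k) + ?l + 1 \<le> dg (vertex x A k) (vertex b B ?l) + c"
      using far[OF geodesic_between[OF A 2(1)] geodesic_between[OF B l]] by simp
    then show ?thesis
      using 2 by (simp add: crossing_vertex_left crossing_vertex_right)
  next
    case 3
    then have "k - Suc (length A) \<le> l - Suc (length A)" "l - Suc (length A) \<le> length B"
      using kl by auto
    then show ?thesis
      using 3 kl geodesic_dist[OF B, of "k - Suc (length A)" "l - Suc (length A)"]
      by (simp add: crossing_vertex_right)
  qed
qed

text \<open>If both legs visit one coset, they can be cut off there. The shorter legs are joined by a geodesic
  inside the common coset; it contains no edge in the coset of \<open>g\<close>, since a leg does not enter that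
  coset before it ends.\<close>

lemma crossing_shortcut:
  assumes e: "peripheral_edge j A n" "peripheral_edge j B k"
    and sc: "same_coset j (vertex x A n) (vertex b B k)"
  obtains u v w where "between x u a" "between b v y" "geodesic u w v" "dg u v \<le> 1" "dg u a < dg x a"
    "\<And>l. peripheral_edge i w l \<Longrightarrow> \<not> same_coset i g (vertex u w l)"
proof -
  note clA = geodesic_closed[OF A] and clB = geodesic_closed[OF B]
  let ?u = "vertex x A (Suc n)" and ?v = "vertex b B k"
  have j: "j \<in> {1..m}"
    using peripheral_edge_index[OF clA(3) e(1)] .
  have len: "n < length A" "k < length B"
    using e by (auto simp: peripheral_edge_def)
  have btw: "between x ?u a" "between b ?v y"
    using geodesic_between[OF A, of "Suc n"] geodesic_between[OF B, of k] len by auto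
  have step: "same_coset j (vertex x A n) ?u"
    using peripheral_edge_same_coset[OF clA(1,3) e(1)] .
  then have uv: "same_coset j ?u ?v"
    using same_coset_trans[OF j clA(4) clA(4) clB(4) same_coset_sym[OF j clA(4) clA(4)] sc] by blast
  have du: "dg ?u a < dg x a"
    using geodesic_vertex_between(2)[OF A, of "Suc n"] len A by (simp add: geodesic_def)
  have dv: "dg ?u ?v \<le> 1"
    using dg_same_coset_le[OF j clA(4) clB(4) uv] .
  obtain w where w: "geodesic ?u w ?v" "\<And>i' l. peripheral_edge i' w l \<Longrightarrow> l = 0 \<and> i' = j"
    using same_coset_geodesic[OF j clA(4) clB(4) uv] by metis
  have "\<not> same_coset i g (vertex ?u w l)" if l: "peripheral_edge i w l" for l
  proof
    assume c: "same_coset i g (vertex ?u w l)"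
    have "l = 0" "j = i"
      using w(2)[OF l] by auto
    then have "same_coset i g ?u" "same_coset i (vertex x A n) ?u"
      using c step by simp_all
    then have "same_coset i g (vertex x A n)"
      using same_coset_trans[OF i gx(1) clA(4) clA(4) _ same_coset_sym[OF i clA(4) clA(4)]] by blast
    then show False
      using left_avoids len by blast
  qed
  then show ?thesis
    using that[OF btw w(1) dv du] by blast
qed

end

text \<open>Legs of bounded length form, together with the edge from \<open>a\<close> to \<open>b\<close>, a path of bounded length, which
  is almost geodesic for trivial reasons. If the path is tight, bounded coset penetration compares it
  with the geodesic from \<open>x\<close> to \<open>y\<close>, which has no edge in the coset; so the edge from \<open>a\<close> to \<open>b\<close> is short
  in the word metric. If it is not tight, the legs visit a common coset and are cut off there, and the
  claim follows by induction on the total length of the legs.\<close>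

lemma nearest_short_detour:
  assumes "bounded_coset_penetration G X m H"
  obtains E :: nat where
    "\<And>i g x y a b w. \<lbrakk>i \<in> {1..m}; g \<in> carrier G; x \<in> carrier G; y \<in> carrier G;
       nearest i g x a; nearest i g y b; dg x a \<le> N; dg y b \<le> N; geodesic x w y;
       \<And>l. peripheral_edge i w l \<Longrightarrow> \<not> same_coset i g (vertex x w l)\<rbrakk> \<Longrightarrow> dx a b \<le> E"
proof -
  \<comment> \<open>The path through \<open>a\<close> and \<open>b\<close> has at most \<open>2 * N + 1\<close> edges.\<close>
  obtain E where E:
    "\<And>x w y u i n. comparable (2 * N + 1) 0 x w y u \<Longrightarrow> peripheral_edge i w n \<Longrightarrow>
        dx (vertex x w n) (vertex x w (Suc n)) > E \<Longrightarrow>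
        \<exists>n'. peripheral_edge i u n' \<and> same_coset i (vertex x w n) (vertex y u n')"
    by (rule bcp_tight[OF assms, of "2 * N + 1" 0]) blast
  have "dx a b \<le> E"
    if "i \<in> {1..m}" "g \<in> carrier G" "x \<in> carrier G" "y \<in> carrier G"
       "nearest i g x a" "nearest i g y b" "dg x a \<le> N" "dg y b \<le> N" "geodesic x w y"
       "\<And>l. peripheral_edge i w l \<Longrightarrow> \<not> same_coset i g (vertex x w l)"
     for i g x y a b w
    using that
  proof (induction "dg x a + dg y b" arbitrary: x y w rule: less_induct)
    case less
    have cl: "a \<in> carrier G" "b \<in> carrier G"
      using less.prems nearest_closed by blast+
    show ?case
    proof (cases "a = b")
      case True
      then show ?thesis using cl by simp
    next
      case False
      obtain A where A: "geodesic x A a"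
        using geodesic_exists less.prems(3) cl by metis
      obtain B where B: "geodesic b B y"
        using geodesic_exists less.prems(4) cl by metis
      note loc = less.prems(1-6) False A B
      show ?thesis
      proof (cases "\<exists>j n k. peripheral_edge j A n \<and> peripheral_edge j B k \<and>
          same_coset j (vertex x A n) (vertex b B k)")
        case True
        then obtain u v w' where uv: "between x u a" "between b v y" "geodesic u w' v" "dg u a < dg x a"
            "\<And>l. peripheral_edge i w' l \<Longrightarrow> \<not> same_coset i g (vertex u w' l)"
          using crossing_shortcut[OF loc] by metis
        have v: "between y v b"
          using uv(2) between_sym cl less.prems(4) by blast
        have le: "dg u a \<le> N" "dg v b \<le> dg y b"
          using uv(4) less.prems(7) v by (auto simp: between_def)
        show ?thesis
        proof (rule less.hyps[OF _ less.prems(1,2) _ _ _ _ _ _ uv(3,5)])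
          show "dg u a + dg v b < dg x a + dg y b"
            using uv(4) le by linarith
          show "u \<in> carrier G" "v \<in> carrier G"
            using uv by (auto simp: between_def)
          show "nearest i g u a" "nearest i g v b"
            using nearest_between less.prems uv v by blast+
          show "dg u a \<le> N" "dg v b \<le> N"
            using le less.prems(8) by auto
        qed
      next
        case nocross: False
        let ?W = "A @ Per i (inv a \<otimes> b) # B"
        have t: "tight x ?W"
          using crossing_tight[OF loc] nocross by blast
        have q: "almost_geodesic (2 * N + 1) x ?W"
        proof (rule crossing_almost_geodesic[OF loc])
          fix u v assume "between x u a" "between b v y"
          then have "dg u a \<le> dg x a" "dg b v \<le> dg y b"
            using dg_sym[of b y] cl less.prems(4) by (auto simp: between_def)
          then show "dg u a + dg b v + 1 \<le> dg u v + (2 * N + 1)"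
            using less.prems(7,8) by linarith
        qed
        have "dx x x \<le> 0" "dx (walk G x ?W) (walk G x w) \<le> 0"
          using walk_crossing[OF loc] less.prems(9,3,4) by (simp_all add: geodesic_def)
        then have comp: "comparable (2 * N + 1) 0 x ?W x w"
          using t q geodesic_tight[OF less.prems(9)] geodesic_almost_geodesic[OF less.prems(9)]
          by (simp add: comparable_def)
        show ?thesis
        proof (rule ccontr)
          assume "\<not> dx a b \<le> E"
          then have "dx (vertex x ?W (length A)) (vertex x ?W (Suc (length A))) > E"
            using crossing_vertices[OF loc] by simp
          from E[OF comp crossing_edge_middle[OF loc] this]
          obtain l where l: "peripheral_edge i w l" "same_coset i a (vertex x w l)"
            using crossing_vertices[OF loc] by auto
          have "same_coset i g a"
            using less.prems(5) by (simp add: nearest_def)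
          then have "same_coset i g (vertex x w l)"
            using l(2) same_coset_trans less.prems(1,2) cl geodesic_closed(4)[OF less.prems(9)] by blast
          then show False
            using less.prems(10)[OF l(1)] by blast
        qed
      qed
    qed
  qed
  then show ?thesis
    using that by blast
qed

end

section \<open>Geodesics between points with distant projections\<close>

context peripheral_cayley
begin

lemma between_closed: "between x p y \<Longrightarrow> p \<in> carrier G"
  by (simp add: between_def)

text \<open>If the first leg is shorter than \<open>2 * D + 2\<close>, the first alternative holds by the triangle inequality.
  Otherwise take its point \<open>u'\<close> at distance \<open>2 * D + 2\<close> from \<open>a\<close> and apply slimness to the quadrangle
  \<open>u, a, b, v\<close>, whose side from \<open>a\<close> to \<open>b\<close> has length at most one. If \<open>u'\<close> is near the side
  from \<open>u\<close> to \<open>v\<close>, that side makes a detour close to the coset and is almost as long as both legs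
  together. If it is near the second leg, the legs run close to each other at a distance from the coset
  that is larger than the distance between them. It is too far from \<open>a\<close> to be near the side from \<open>a\<close> to
  \<open>b\<close>.\<close>

lemma nearest_legs_diverge:
  assumes D: "slim D" and i: "i \<in> {1..m}" and gx: "g \<in> carrier G" "x \<in> carrier G" "y \<in> carrier G"
    and na: "nearest i g x a" and nb: "nearest i g y b"
    and u: "between x u a" and v: "between b v y"
  shows "dg u a + dg b v \<le> dg u v + (6 * D + 5) \<or>
    (\<exists>u' v'. between u u' a \<and> between b v' v \<and> dg u' a = 2 * D + 2 \<and> dg u' v' \<le> 2 * D)"
proof -
  have cl: "a \<in> carrier G" "b \<in> carrier G" "u \<in> carrier G" "v \<in> carrier G"
    using na nb u v by (auto simp: nearest_def between_def)
  note tri = dg_triangle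
  have ab: "dg a b \<le> 1" "dg b a \<le> 1"
    using dg_same_coset_le[OF i] nearest_same_coset[OF i gx(1) na nb] dg_sym cl by metis+
  show ?thesis
  proof (cases "dg u a < 2 * D + 2")
    case True
    have "dg b v \<le> dg b a + dg a v" "dg a v \<le> dg a u + dg u v" "dg a u = dg u a"
      using tri[OF cl(2,1,4)] tri[OF cl(1,3,4)] dg_sym[OF cl(1,3)] by auto
    then show ?thesis
      using ab True by linarith
  next
    case False
    obtain w where w: "geodesic u w a"
      using geodesic_exists cl by metis
    then have lw: "length w = dg u a"
      by (simp add: geodesic_def)
    define u' where "u' = vertex u w (length w - (2 * D + 2))"
    have u': "between u u' a" "dg u' a = 2 * D + 2"
      using geodesic_between[OF w, of "length w - (2 * D + 2)"]
        geodesic_vertex_between(2)[OF w, of "length w - (2 * D + 2)"] lw False unfolding u'_def by auto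
    have clu': "u' \<in> carrier G"
      using u' between_closed by blast
    obtain q where q: "between a q v \<or> between v q u" "dg u' q \<le> D"
      using D u'(1) cl unfolding slim_def by metis
    have clq: "q \<in> carrier G"
      using q between_closed by blast
    show ?thesis
    proof (cases "between v q u")
      case True
      have "dg v q + dg q u = dg v u" "dg v u = dg u v" "dg u u' + dg u' a = dg u a"
        using True u'(1) cl by (auto simp: between_def dg_sym)
      moreover have "dg u u' \<le> dg u q + dg q u'" "dg b v \<le> dg b a + dg a v" "dg a v \<le> dg a u' + dg u' v"
        "dg u' v \<le> dg u' q + dg q v"
        using cl clq clu' by (auto intro: tri)
      moreover have "dg u q = dg q u" "dg q u' = dg u' q" "dg a u' = dg u' a" "dg q v = dg v q"
        using cl clq clu' by (auto simp: dg_sym)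
      ultimately show ?thesis
        using ab u'(2) q(2) by linarith
    next
      case False
      then have "between a q v"
        using q(1) by blast
      then obtain q' where q': "between v q' b \<or> between b q' a" "dg q q' \<le> D"
        using D cl unfolding slim_def by metis
      have clq': "q' \<in> carrier G"
        using q' between_closed by blast
      have d: "dg u' q' \<le> 2 * D"
        using tri[of u' q q'] q(2) q'(2) clu' clq clq' by simp
      have "\<not> between b q' a"
      proof
        assume "between b q' a"
        then have "dg q' a \<le> 1"
          using ab by (simp add: between_def)
        then show False
          using tri[of u' q' a] d u'(2) cl clu' clq' by simp
      qed
      then have "between b q' v"
        using q'(1) between_sym cl by blast
      then show ?thesis
        using u' d by blast
    qed
  qed
qed

text \<open>If the legs run close together outside the coset, the geodesic that joins them there is too short to
  reach the coset, and \<open>nearest_short_detour\<close> bounds the distance from \<open>a\<close> to \<open>b\<close>. It does the same if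
  the legs visit a common coset, since diverging legs can do so only near \<open>a\<close> and \<open>b\<close>. If \<open>a\<close> and \<open>b\<close> are
  far apart, the crossing path is therefore tight and almost geodesic, and bounded coset penetration
  provides the required edge of the geodesic.\<close>

lemma geodesic_penetrates:
  assumes D: "slim D" and bcp: "bounded_coset_penetration G X m H"
  obtains E :: nat where
    "\<And>i g x y a b w. \<lbrakk>i \<in> {1..m}; g \<in> carrier G; x \<in> carrier G; y \<in> carrier G;
       nearest i g x a; nearest i g y b; dx a b > E; geodesic x w y\<rbrakk> \<Longrightarrow>
       \<exists>n. peripheral_edge i w n \<and> same_coset i g (vertex x w n) \<and>
         dx a (vertex x w n) \<le> E \<and> dx b (vertex x w (Suc n)) \<le> E"
proof -
  \<comment> \<open>A bound for the lengths of both legs in the two uses of \<open>nearest_short_detour\<close>, and an additive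
    constant for the crossing path.\<close>
  define N where "N = 6 * D + 6"
  obtain E1 where E1:
    "\<And>i g x y a b w. \<lbrakk>i \<in> {1..m}; g \<in> carrier G; x \<in> carrier G; y \<in> carrier G;
       nearest i g x a; nearest i g y b; dg x a \<le> N; dg y b \<le> N; geodesic x w y;
       \<And>l. peripheral_edge i w l \<Longrightarrow> \<not> same_coset i g (vertex x w l)\<rbrakk> \<Longrightarrow> dx a b \<le> E1"
    by (rule nearest_short_detour[OF bcp, of N]) blast
  obtain E2 where E2:
    "\<And>x w y u i n. comparable N 0 x w y u \<Longrightarrow> peripheral_edge i w n \<Longrightarrow>
       dx (vertex x w n) (vertex x w (Suc n)) > E2 \<Longrightarrow>
       \<exists>n'. peripheral_edge i u n' \<and> same_coset i (vertex x w n) (vertex y u n')"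
    "\<And>x w y u i n n'. comparable N 0 x w y u \<Longrightarrow> peripheral_edge i w n \<Longrightarrow> peripheral_edge i u n' \<Longrightarrow>
       same_coset i (vertex x w n) (vertex y u n') \<Longrightarrow>
       dx (vertex x w n) (vertex y u n') \<le> E2 \<and>
       dx (vertex x w (Suc n)) (vertex y u (Suc n')) \<le> E2"
    by (rule bcp_tight[OF bcp, of N 0]) blast
  show ?thesis
  proof (rule that[of "max E1 E2"])
    fix i g x y a b w
    assume i: "i \<in> {1..m}" and gx: "g \<in> carrier G" "x \<in> carrier G" "y \<in> carrier G"
      and na: "nearest i g x a" and nb: "nearest i g y b" and far: "dx a b > max E1 E2"
      and w: "geodesic x w y"
    have cl: "a \<in> carrier G" "b \<in> carrier G"
      using na nb nearest_closed by blast+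
    have ab: "a \<noteq> b"
      using far cl by auto
    obtain A where A: "geodesic x A a"
      using geodesic_exists gx cl by metis
    obtain B where B: "geodesic b B y"
      using geodesic_exists gx cl by metis
    note loc = i gx na nb ab A B
    have diverge: "dg u a + dg b v \<le> dg u v + (6 * D + 5)" if uv: "between x u a" "between b v y" for u v
    proof (rule ccontr)
      assume "\<not> ?thesis"
      then obtain u' v' where u': "between u u' a" "dg u' a = 2 * D + 2" and v': "between b v' v"
        and d: "dg u' v' \<le> 2 * D"
        using nearest_legs_diverge[OF D i gx na nb uv] by blast
      have clu: "u \<in> carrier G" "v \<in> carrier G" "u' \<in> carrier G" "v' \<in> carrier G"
        using uv u' v' between_closed by blast+
      have nu: "nearest i g u' a"
        using nearest_between[OF clu(1) nearest_between[OF gx(2) na uv(1)] u'(1)] .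
      have "between y v b" "between v v' b"
        using uv(2) v' between_sym cl clu gx by blast+
      then have nv: "nearest i g v' b"
        using nearest_between[OF clu(2) nearest_between[OF gx(3) nb]] by blast
      have "dg v' b \<le> dg v' a"
        using nv na cl by (simp add: nearest_def)
      moreover have "dg v' a \<le> dg v' u' + dg u' a"
        using dg_triangle clu cl by blast
      moreover have "dg v' u' = dg u' v'"
        using dg_sym clu by blast
      ultimately have short: "dg u' a \<le> N" "dg v' b \<le> N"
        using u'(2) d by (auto simp: N_def)
      obtain z where z: "geodesic u' z v'"
        using geodesic_exists clu by metis
      have "\<not> same_coset i g (vertex u' z l)" if "peripheral_edge i z l" for l
      proof
        assume "same_coset i g (vertex u' z l)"
        then have "dg u' a \<le> dg u' (vertex u' z l)"
          using nu geodesic_closed(4)[OF z] by (simp add: nearest_def)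
        also have "\<dots> = l"
          using geodesic_vertex_between(1)[OF z] that by (simp add: peripheral_edge_def)
        also have "\<dots> \<le> length z"
          using that by (simp add: peripheral_edge_def)
        also have "\<dots> \<le> 2 * D"
          using z d by (simp add: geodesic_def)
        finally show False
          using u'(2) by simp
      qed
      then have "dx a b \<le> E1"
        by (intro E1[OF i gx(1) clu(3,4) nu nv short z])
      then show False
        using far by simp
    qed
    have nocross: "\<not> same_coset j (vertex x A n) (vertex b B k)"
      if e: "peripheral_edge j A n" "peripheral_edge j B k" for j n k
    proof
      assume "same_coset j (vertex x A n) (vertex b B k)"
      from crossing_shortcut[OF loc e this] obtain u v z where
        uv: "between x u a" "between b v y" and z: "geodesic u z v" "dg u v \<le> 1"
        "\<And>l. peripheral_edge i z l \<Longrightarrow> \<not> same_coset i g (vertex u z l)"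
        by metis
      have clu: "u \<in> carrier G" "v \<in> carrier G"
        using uv between_closed by blast+
      have nu: "nearest i g u a" and nv: "nearest i g v b"
        using nearest_between[OF gx(2) na uv(1)] nearest_between[OF gx(3) nb] uv(2) between_sym cl gx
        by blast+
      have "dg v b = dg b v"
        using dg_sym cl clu by blast
      then have "dg u a \<le> N" "dg v b \<le> N"
        using diverge[OF uv] z(2) by (simp_all add: N_def)
      then have "dx a b \<le> E1"
        using E1[OF i gx(1) clu nu nv _ _ z(1,3)] by blast
      then show False
        using far by simp
    qed
    let ?W = "A @ Per i (inv a \<otimes> b) # B"
    have "tight x ?W"
      using crossing_tight[OF loc nocross] .
    moreover have "almost_geodesic N x ?W"
      using crossing_almost_geodesic[OF loc, of N] diverge by (force simp: N_def)
    moreover have "dx x x \<le> 0" "dx (walk G x ?W) (walk G x w) \<le> 0"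
      using walk_crossing[OF loc] w gx by (simp_all add: geodesic_def)
    ultimately have comp: "comparable N 0 x ?W x w"
      using geodesic_tight[OF w] geodesic_almost_geodesic[OF w] by (simp add: comparable_def)
    have "dx (vertex x ?W (length A)) (vertex x ?W (Suc (length A))) > E2"
      using far crossing_vertices[OF loc] by simp
    from E2(1)[OF comp crossing_edge_middle[OF loc] this]
    obtain n where n: "peripheral_edge i w n"
      "same_coset i (vertex x ?W (length A)) (vertex x w n)"
      by blast
    have "same_coset i g a" "same_coset i a (vertex x w n)"
      using na n(2) crossing_vertices[OF loc] by (simp_all add: nearest_def)
    then have "same_coset i g (vertex x w n)"
      using same_coset_trans[OF i gx(1) cl(1) geodesic_closed(4)[OF w]] by blast
    then show "\<exists>n. peripheral_edge i w n \<and> same_coset i g (vertex x w n) \<and>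
         dx a (vertex x w n) \<le> max E1 E2 \<and> dx b (vertex x w (Suc n)) \<le> max E1 E2"
      using E2(2)[OF comp crossing_edge_middle[OF loc] n] n(1) crossing_vertices[OF loc]
      by (intro exI[of _ n]) auto
  qed
qed

definition penetration_constant :: "nat \<Rightarrow> bool" where
  "penetration_constant E \<longleftrightarrow> (\<forall>i g x y a b w. i \<in> {1..m} \<longrightarrow> g \<in> carrier G \<longrightarrow>
     x \<in> carrier G \<longrightarrow> y \<in> carrier G \<longrightarrow> nearest i g x a \<longrightarrow> nearest i g y b \<longrightarrow> dx a b > E \<longrightarrow>
     geodesic x w y \<longrightarrow> (\<exists>n. peripheral_edge i w n \<and> same_coset i g (vertex x w n) \<and>
         dx a (vertex x w n) \<le> E \<and> dx b (vertex x w (Suc n)) \<le> E))"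

text \<open>A geodesic between two points of a coset is at most one edge, and that edge does not lie in a
  different coset.\<close>

lemma distinct_coset_projection:
  assumes E: "penetration_constant E" and i: "i \<in> {1..m}"
    and cl: "g \<in> carrier G" "y \<in> carrier G" "z \<in> carrier G"
    and yz: "same_coset i y z" and g: "\<not> same_coset i g y"
    and na: "nearest i g y a" and nb: "nearest i g z b"
  shows "dx a b \<le> E"
proof (rule ccontr)
  assume "\<not> dx a b \<le> E"
  then have far: "dx a b > E"
    by simp
  obtain w where w: "geodesic y w z" "\<And>j l. peripheral_edge j w l \<Longrightarrow> l = 0 \<and> j = i"
    using same_coset_geodesic[OF i cl(2,3) yz] by metis
  then obtain n where "peripheral_edge i w n" "same_coset i g (vertex y w n)"
    using E[unfolded penetration_constant_def, rule_format, OF i cl na nb far w(1)] by blast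
  then show False
    using g w(2)[of i n] by simp
qed

lemma relatively_hyperbolic_penetration_constant:
  assumes "relatively_hyperbolic G X m H"
  obtains E where "penetration_constant E"
proof -
  obtain \<delta> where "hyperbolic_space (cayley_points G X m H) (point_dist G X m H) \<delta>"
    using assms by (auto simp: relatively_hyperbolic_def)
  then have "slim (nat \<lfloor>\<delta>\<rfloor>)"
    by (rule slim_vertex_triangles)
  then show ?thesis
    using geodesic_penetrates assms that unfolding relatively_hyperbolic_def penetration_constant_def
    by metis
qed

end

section \<open>Alternating products of two subgroups\<close>

lemma (in group) conjugate_set_subgroup:
  assumes "g \<in> carrier G" "subgroup K G"
  shows "subgroup (conjugate_set G g K) G"
proof (rule subgroupI)
  have cl: "k \<in> carrier G" if "k \<in> K" for k
    using assms(2) that subgroup.mem_carrier by metis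
  show "conjugate_set G g K \<subseteq> carrier G"
    using cl assms(1) by (auto simp: conjugate_set_def)
  show "conjugate_set G g K \<noteq> {}"
    using subgroup.one_closed[OF assms(2)] by (auto simp: conjugate_set_def)
  fix x assume "x \<in> conjugate_set G g K"
  then obtain k where k: "k \<in> K" "x = g \<otimes> k \<otimes> inv g"
    by (auto simp: conjugate_set_def)
  then have "inv x = g \<otimes> inv k \<otimes> inv g" "inv k \<in> K"
    using cl assms by (simp_all add: inv_mult_group m_assoc subgroup.m_inv_closed)
  then show "inv x \<in> conjugate_set G g K"
    by (auto simp: conjugate_set_def)
  fix y assume "y \<in> conjugate_set G g K"
  then obtain l where l: "l \<in> K" "y = g \<otimes> l \<otimes> inv g"
    by (auto simp: conjugate_set_def)
  then have "x \<otimes> y = g \<otimes> (k \<otimes> l) \<otimes> inv g" "k \<otimes> l \<in> K"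
    using k cl assms by (simp_all add: m_assoc subgroup.m_closed)
  then show "x \<otimes> y \<in> conjugate_set G g K"
    by (auto simp: conjugate_set_def)
qed

lemma (in group) conjugate_set_mult:
  assumes "g \<in> carrier G" "g' \<in> carrier G" "K \<subseteq> carrier G"
  shows "conjugate_set G g (conjugate_set G g' K) = conjugate_set G (g \<otimes> g') K"
proof -
  have "g \<otimes> (g' \<otimes> k \<otimes> inv g') \<otimes> inv g = (g \<otimes> g') \<otimes> k \<otimes> inv (g \<otimes> g')" if "k \<in> K" for k
    using that assms by (simp add: inv_mult_group m_assoc subset_iff)
  then show ?thesis
    unfolding conjugate_set_def image_image by (intro image_cong) auto
qed

text \<open>Products \<open>r\<^sub>1 s\<^sub>1 r\<^sub>2 \<dots> s\<^sub>n\<^sub>-\<^sub>1 r\<^sub>n\<close> with factors alternately from \<open>R - Q\<close> and \<open>Q - R\<close>. That both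
  end factors are from \<open>R\<close> makes the notion invariant under inversion and under multiplication by
  elements of \<open>Q \<inter> R\<close>.\<close>

inductive alternating :: "('a, 'b) monoid_scheme \<Rightarrow> 'a set \<Rightarrow> 'a set \<Rightarrow> nat \<Rightarrow> 'a \<Rightarrow> bool"
  for G Q R where
  single: "r \<in> R \<Longrightarrow> r \<notin> Q \<Longrightarrow> alternating G Q R 1 r"
| extend: "alternating G Q R n a \<Longrightarrow> s \<in> Q \<Longrightarrow> s \<notin> R \<Longrightarrow> r \<in> R \<Longrightarrow> r \<notin> Q \<Longrightarrow>
     alternating G Q R (Suc n) (a \<otimes>\<^bsub>G\<^esub> s \<otimes>\<^bsub>G\<^esub> r)"

locale two_subgroups = group G for G :: "('a, 'b) monoid_scheme" (structure) +
  fixes Q R :: "'a set"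
  assumes Q_subgroup: "subgroup Q G" and R_subgroup: "subgroup R G"
begin

abbreviation "alt \<equiv> alternating G Q R"
abbreviation "W \<equiv> generate G (Q \<union> R)"

lemma Q_closed: "q \<in> Q \<Longrightarrow> q \<in> carrier G" and R_closed: "r \<in> R \<Longrightarrow> r \<in> carrier G"
  using Q_subgroup R_subgroup subgroup.mem_carrier by metis+

lemma W_subgroup: "subgroup W G"
  using Q_closed R_closed by (intro generate_is_subgroup) blast

lemma Q_simps [simp]:
  "\<one> \<in> Q" "q \<in> Q \<Longrightarrow> inv q \<in> Q" "q \<in> Q \<Longrightarrow> q' \<in> Q \<Longrightarrow> q \<otimes> q' \<in> Q"
  using Q_subgroup by (auto simp: subgroup.one_closed subgroup.m_inv_closed subgroup.m_closed)

lemma R_simps [simp]: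
  "\<one> \<in> R" "r \<in> R \<Longrightarrow> inv r \<in> R" "r \<in> R \<Longrightarrow> r' \<in> R \<Longrightarrow> r \<otimes> r' \<in> R"
  using R_subgroup by (auto simp: subgroup.one_closed subgroup.m_inv_closed subgroup.m_closed)

lemma subgroup_mult_iff:
  assumes "subgroup S G" "z \<in> S" "g \<in> carrier G"
  shows "g \<otimes> z \<in> S \<longleftrightarrow> g \<in> S" "z \<otimes> g \<in> S \<longleftrightarrow> g \<in> S"
proof -
  have z: "z \<in> carrier G"
    using assms subgroup.mem_carrier by metis
  have "g \<in> S" if "g \<otimes> z \<in> S"
  proof -
    have "(g \<otimes> z) \<otimes> inv z \<in> S"
      using that assms by (simp add: subgroup.m_closed subgroup.m_inv_closed)
    then show ?thesis using z assms by (simp add: m_assoc)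
  qed
  moreover have "g \<in> S" if "z \<otimes> g \<in> S"
  proof -
    have "inv z \<otimes> (z \<otimes> g) \<in> S"
      using that assms by (simp add: subgroup.m_closed subgroup.m_inv_closed)
    then show ?thesis using z assms by simp
  qed
  ultimately show "g \<otimes> z \<in> S \<longleftrightarrow> g \<in> S" "z \<otimes> g \<in> S \<longleftrightarrow> g \<in> S"
    using subgroup.m_closed[OF assms(1)] assms(2) by blast+
qed

lemmas Q_iff = subgroup_mult_iff[OF Q_subgroup]
lemmas R_iff = subgroup_mult_iff[OF R_subgroup]

lemma inv_mem_Q: "q \<in> carrier G \<Longrightarrow> inv q \<in> Q \<longleftrightarrow> q \<in> Q"
  using Q_simps(2)[of "inv q"] by auto

lemma inv_mem_R: "q \<in> carrier G \<Longrightarrow> inv q \<in> R \<longleftrightarrow> q \<in> R"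
  using R_simps(2)[of "inv q"] by auto

lemma alt_closed: "alt n a \<Longrightarrow> a \<in> carrier G"
  by (induction rule: alternating.induct) (auto simp: Q_closed R_closed)

lemma alt_pos: "alt n a \<Longrightarrow> 1 \<le> n"
  by (induction rule: alternating.induct) auto

lemma alt_concat:
  "alt k b \<Longrightarrow> alt n a \<Longrightarrow> s \<in> Q \<Longrightarrow> s \<notin> R \<Longrightarrow> alt (n + k) (a \<otimes> s \<otimes> b)"
proof (induction rule: alternating.induct)
  case (single r)
  then show ?case using alternating.extend by simp
next
  case (extend k b t r)
  then have "alt (Suc (n + k)) ((a \<otimes> s \<otimes> b) \<otimes> t \<otimes> r)"
    by (intro alternating.extend) auto
  moreover have "(a \<otimes> s \<otimes> b) \<otimes> t \<otimes> r = a \<otimes> s \<otimes> (b \<otimes> t \<otimes> r)"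
    using extend alt_closed[of n a] alt_closed[of k b] by (simp add: Q_closed R_closed m_assoc)
  ultimately show ?case by simp
qed

lemma alt_first:
  "alt n b \<Longrightarrow> (n = 1 \<and> b \<in> R \<and> b \<notin> Q) \<or>
     (\<exists>r s c k. n = Suc k \<and> r \<in> R \<and> r \<notin> Q \<and> s \<in> Q \<and> s \<notin> R \<and> alt k c \<and> b = r \<otimes> s \<otimes> c)"
proof (induction rule: alternating.induct)
  case (extend n a s r)
  from extend.IH show ?case
  proof
    assume a: "n = 1 \<and> a \<in> R \<and> a \<notin> Q"
    show ?thesis
      by (rule disjI2, rule exI[of _ a], rule exI[of _ s], rule exI[of _ r], rule exI[of _ 1])
        (use a extend.hyps alternating.single in auto)
  next
    assume "\<exists>r s c k. n = Suc k \<and> r \<in> R \<and> r \<notin> Q \<and> s \<in> Q \<and> s \<notin> R \<and> alt k c \<and> a = r \<otimes> s \<otimes> c"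
    then obtain r' s' c k where c: "n = Suc k" "r' \<in> R" "r' \<notin> Q" "s' \<in> Q" "s' \<notin> R" "alt k c"
      "a = r' \<otimes> s' \<otimes> c"
      by blast
    have "a \<otimes> s \<otimes> r = r' \<otimes> s' \<otimes> (c \<otimes> s \<otimes> r)"
      using c extend alt_closed[of k c] by (simp add: Q_closed R_closed m_assoc)
    moreover have "alt (Suc k) (c \<otimes> s \<otimes> r)"
      using c extend by (intro alternating.extend)
    ultimately show ?thesis
      using c(1-5) by blast
  qed
qed auto

lemma alt_last:
  assumes "alt n b"
  shows "(n = 1 \<and> b \<in> R \<and> b \<notin> Q) \<or>
     (\<exists>r s c k. n = Suc k \<and> r \<in> R \<and> r \<notin> Q \<and> s \<in> Q \<and> s \<notin> R \<and> alt k c \<and> b = c \<otimes> s \<otimes> r)"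
  using assms by cases blast+

lemma alt_inv: "alt n a \<Longrightarrow> alt n (inv a)"
proof (induction rule: alternating.induct)
  case (single r)
  then have "inv r \<in> R" "inv r \<notin> Q"
    by (auto simp: inv_mem_Q R_closed)
  then show ?case by (rule alternating.single)
next
  case (extend n a s r)
  have "alt (1 + n) (inv r \<otimes> inv s \<otimes> inv a)"
    using extend by (intro alt_concat alternating.single) (auto simp: inv_mem_Q inv_mem_R Q_closed R_closed)
  moreover have "inv (a \<otimes> s \<otimes> r) = inv r \<otimes> inv s \<otimes> inv a"
    using extend alt_closed[of n a] by (simp add: Q_closed R_closed inv_mult_group m_assoc)
  ultimately show ?case by simp
qed

lemma alt_mult_right: "alt n a \<Longrightarrow> z \<in> Q \<Longrightarrow> z \<in> R \<Longrightarrow> alt n (a \<otimes> z)"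
proof (induction rule: alternating.cases)
  case (single r)
  then have "r \<otimes> z \<in> R" "r \<otimes> z \<notin> Q"
    by (auto simp: Q_iff R_closed)
  then show ?case
    unfolding single by (rule alternating.single)
next
  case (extend n a s r)
  then have "alt (Suc n) (a \<otimes> s \<otimes> (r \<otimes> z))"
    by (intro alternating.extend) (auto simp: Q_iff R_closed)
  then show ?case
    using extend alt_closed[of n a] by (simp add: Q_closed R_closed m_assoc)
qed

lemma alt_mult_left:
  assumes "alt n a" "z \<in> Q" "z \<in> R"
  shows "alt n (z \<otimes> a)"
proof -
  have "alt n (inv (inv a \<otimes> inv z))"
    using assms by (intro alt_inv alt_mult_right) auto
  then show ?thesis
    using assms alt_closed[of n a] by (simp add: inv_mult_group Q_closed)
qed

text \<open>The elements of the generated subgroup whose normal form has \<open>n\<close> factors from \<open>R - Q\<close>.\<close>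

definition reduced :: "nat \<Rightarrow> 'a \<Rightarrow> bool" where
  "reduced n g \<longleftrightarrow> (\<exists>q\<in>Q. \<exists>q'\<in>Q. \<exists>a. alt n a \<and> g = q \<otimes> a \<otimes> q')"

lemma reducedI: "alt n a \<Longrightarrow> q \<in> Q \<Longrightarrow> q' \<in> Q \<Longrightarrow> g = q \<otimes> a \<otimes> q' \<Longrightarrow> reduced n g"
  unfolding reduced_def by blast

lemma alt_reduced: "alt n a \<Longrightarrow> reduced n a"
  using alt_closed by (intro reducedI[of n a \<one> \<one>]) auto

lemma reduced_mult:
  assumes "reduced n g" "q \<in> Q" "q' \<in> Q"
  shows "reduced n (q \<otimes> g \<otimes> q')"
proof -
  obtain s s' a where a: "s \<in> Q" "s' \<in> Q" "alt n a" "g = s \<otimes> a \<otimes> s'"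
    using assms(1) by (auto simp: reduced_def)
  then show ?thesis
    using assms alt_closed[of n a] by (intro reducedI[of n a "q \<otimes> s" "s' \<otimes> q'"]) (auto simp: Q_closed m_assoc)
qed

end

text \<open>The condition says that a normal form with a factor from \<open>R - Q\<close> has a value outside \<open>Q\<close>; it holds
  exactly if the natural map from the amalgam is injective.\<close>

locale faithful_subgroups = two_subgroups +
  assumes alt_not_Q: "alt n a \<Longrightarrow> a \<notin> Q"
begin

lemma reduced_not_Q:
  assumes "reduced n g"
  shows "g \<notin> Q"
proof
  assume g: "g \<in> Q"
  obtain s s' a where a: "s \<in> Q" "s' \<in> Q" "alt n a" "g = s \<otimes> a \<otimes> s'"
    using assms(1) by (auto simp: reduced_def)
  then have "a \<in> Q"
    using g alt_closed[of n a] by (simp add: Q_iff Q_closed)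
  then show False
    using alt_not_Q a(3) by blast
qed

text \<open>The product of the factors of \<open>a\<close> and \<open>b\<close> that meet must lie in \<open>Q \<inter> R\<close>, as otherwise \<open>a b\<close> would again
  be alternating up to factors from \<open>Q\<close>, and so outside \<open>Q\<close>. Hence the factors of \<open>a\<close> and \<open>b\<close> cancel in pairs.\<close>

lemma alt_mult_in_Q: "alt n a \<Longrightarrow> alt l b \<Longrightarrow> a \<otimes> b \<in> Q \<Longrightarrow> n = l"
proof (induction n arbitrary: a l b rule: less_induct)
  case (less n)
  have cl: "a \<in> carrier G" "b \<in> carrier G"
    using less.prems alt_closed by auto
  from alt_last[OF less.prems(1)] consider
    (1) "n = 1" "a \<in> R" "a \<notin> Q"
  | (2) r s c k where "n = Suc k" "r \<in> R" "r \<notin> Q" "s \<in> Q" "s \<notin> R" "alt k c" "a = c \<otimes> s \<otimes> r"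
    by blast
  then show ?case
  proof cases
    case 1
    from alt_first[OF less.prems(2)] consider
      (1) "l = 1" "b \<in> R" "b \<notin> Q"
    | (2) r' s' c' k' where "l = Suc k'" "r' \<in> R" "r' \<notin> Q" "s' \<in> Q" "s' \<notin> R" "alt k' c'"
       "b = r' \<otimes> s' \<otimes> c'"
      by blast
    then show ?thesis
    proof cases
      case 1
      then show ?thesis using \<open>n = 1\<close> by simp
    next
      case 2
      have eq: "a \<otimes> b = (a \<otimes> r') \<otimes> s' \<otimes> c'"
        using 2 cl alt_closed[OF 2(6)] by (simp add: Q_closed R_closed m_assoc)
      show ?thesis
      proof (cases "a \<otimes> r' \<in> Q")
        case True
        then have "c' \<in> Q"
          using less.prems(3) 2 alt_closed[OF 2(6)] unfolding eq by (simp add: Q_iff Q_closed)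
        then show ?thesis
          using alt_not_Q 2(6) by blast
      next
        case False
        then have "alt (1 + k') (a \<otimes> b)"
          unfolding eq using 1 2 by (intro alt_concat alternating.single) auto
        then show ?thesis
          using alt_not_Q less.prems(3) by blast
      qed
    qed
  next
    case 2
    note A = 2
    have clA: "r \<in> carrier G" "s \<in> carrier G" "c \<in> carrier G"
      using A alt_closed Q_closed R_closed by auto
    from alt_first[OF less.prems(2)] consider
      (1) "l = 1" "b \<in> R" "b \<notin> Q"
    | (2) r' s' c' k' where "l = Suc k'" "r' \<in> R" "r' \<notin> Q" "s' \<in> Q" "s' \<notin> R" "alt k' c'"
       "b = r' \<otimes> s' \<otimes> c'"
      by blast
    then show ?thesis
    proof cases
      case 1
      have eq: "a \<otimes> b = c \<otimes> s \<otimes> (r \<otimes> b)"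
        using A(7) clA cl by (simp add: m_assoc)
      show ?thesis
      proof (cases "r \<otimes> b \<in> Q")
        case True
        then have "c \<in> Q"
          using less.prems(3) A clA cl unfolding eq by (simp add: Q_iff)
        then show ?thesis
          using alt_not_Q A(6) by blast
      next
        case False
        then have "alt (Suc k) (a \<otimes> b)"
          unfolding eq using 1 A by (intro alternating.extend) auto
        then show ?thesis
          using alt_not_Q less.prems(3) by blast
      qed
    next
      case 2
      have clB: "r' \<in> carrier G" "s' \<in> carrier G" "c' \<in> carrier G"
        using 2 alt_closed Q_closed R_closed by auto
      have eq: "a \<otimes> b = c \<otimes> s \<otimes> (r \<otimes> r') \<otimes> s' \<otimes> c'"
        using A(7) 2(7) clA clB by (simp add: m_assoc)
      show ?thesis
      proof (cases "r \<otimes> r' \<in> Q")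
        case rr: True
        define t where "t = s \<otimes> (r \<otimes> r') \<otimes> s'"
        have t: "t \<in> Q"
          using rr A 2 by (simp add: t_def)
        have eq': "a \<otimes> b = c \<otimes> t \<otimes> c'"
          using eq clA clB by (simp add: t_def m_assoc)
        show ?thesis
        proof (cases "t \<in> R")
          case True
          have "alt k (c \<otimes> t)"
            using A(6) t True by (rule alt_mult_right)
          then have "k = k'"
            using less.IH[of k "c \<otimes> t" k' c'] 2(6) less.prems(3) eq' A(1) by simp
          then show ?thesis
            using A(1) 2(1) by simp
        next
          case False
          then have "alt (k + k') (a \<otimes> b)"
            unfolding eq' using A(6) 2(6) t by (intro alt_concat)
          then show ?thesis
            using alt_not_Q less.prems(3) by blast
        qed
      next
        case False
        then have "alt (Suc k + k') (a \<otimes> b)"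
          unfolding eq using A 2 by (intro alt_concat alternating.extend) auto
        then show ?thesis
          using alt_not_Q less.prems(3) by blast
      qed
    qed
  qed
qed

lemma reduced_unique:
  assumes "reduced n g" "reduced l g"
  shows "n = l"
proof -
  obtain s s' a where a: "s \<in> Q" "s' \<in> Q" "alt n a" "g = s \<otimes> a \<otimes> s'"
    using assms(1) by (auto simp: reduced_def)
  obtain t t' b where b: "t \<in> Q" "t' \<in> Q" "alt l b" "g = t \<otimes> b \<otimes> t'"
    using assms(2) by (auto simp: reduced_def)
  have cl: "a \<in> carrier G" "b \<in> carrier G" "s \<in> carrier G" "s' \<in> carrier G" "t \<in> carrier G" "t' \<in> carrier G"
    using a b alt_closed Q_closed by auto
  have "s \<otimes> a \<otimes> s' = t \<otimes> b \<otimes> t'"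
    using a(4) b(4) by simp
  then have "inv s \<otimes> (s \<otimes> a \<otimes> s') \<otimes> inv t' \<otimes> inv b = inv s \<otimes> (t \<otimes> b \<otimes> t') \<otimes> inv t' \<otimes> inv b"
    by simp
  then have eq: "a \<otimes> (s' \<otimes> inv t') \<otimes> inv b = inv s \<otimes> t"
    using cl by (simp add: m_assoc)
  have q: "s' \<otimes> inv t' \<in> Q" "a \<otimes> (s' \<otimes> inv t') \<otimes> inv b \<in> Q"
    using a b by (simp_all add: eq)
  show ?thesis
  proof (cases "s' \<otimes> inv t' \<in> R")
    case True
    then show ?thesis
      using alt_mult_in_Q[OF alt_mult_right[OF a(3) q(1)] alt_inv[OF b(3)] q(2)] by blast
  next
    case False
    then have "alt (n + l) (a \<otimes> (s' \<otimes> inv t') \<otimes> inv b)"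
      using q(1) a(3) alt_inv[OF b(3)] by (intro alt_concat)
    then show ?thesis
      using alt_not_Q q(2) by blast
  qed
qed

lemma subgroup_in_union:
  assumes K: "subgroup K G" and sub: "K \<subseteq> Q \<union> R"
  shows "K \<subseteq> Q \<or> K \<subseteq> R"
proof (rule ccontr)
  assume "\<not> ?thesis"
  then obtain x y where x: "x \<in> K" "x \<notin> Q" "x \<in> R" and y: "y \<in> K" "y \<notin> R" "y \<in> Q"
    using sub by blast
  then have "x \<otimes> y \<in> Q \<union> R"
    using sub K subgroup.m_closed by fastforce
  then show False
    using x y by (auto simp: Q_iff R_iff Q_closed R_closed)
qed

text \<open>In terms of the Bass-Serre tree: a group with a bounded orbit fixes a vertex. Algebraically, let \<open>n\<close>
  be the largest number of syllables of an element of \<open>K\<close>, attained by \<open>q a q'\<close>. The product of the inverse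
  of this element with another element of \<open>K\<close> must not have more than \<open>n\<close> syllables. So cancellation takes
  place, and it forces all elements of \<open>K\<close> outside \<open>Q\<close> to begin with the same coset \<open>q (Q \<inter> R)\<close>. Applied to
  inverses, this says that they end with \<open>(Q \<inter> R) q\<inverse>\<close>. After conjugation by \<open>q\<inverse>\<close> they are alternating.
  If \<open>n \<ge> 2\<close>, the same argument gives those with at least two syllables a common first factor \<open>r\<close>, again
  up to \<open>Q \<inter> R\<close>, and conjugation by \<open>r\<inverse>\<close> removes two syllables from each of them.\<close>

lemma bounded_subgroup_conjugate:
  assumes "subgroup K G" "\<And>g. g \<in> K \<Longrightarrow> g \<in> Q \<or> (\<exists>l\<le>n. reduced l g)"
  shows "\<exists>w\<in>W. conjugate_set G w K \<subseteq> Q \<or> conjugate_set G w K \<subseteq> R"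
  using assms
proof (induction n arbitrary: K rule: less_induct)
  case (less n)
  have Kc: "K \<subseteq> carrier G"
    using less.prems(1) subgroup.subset by blast
  show ?case
  proof (cases "\<exists>g\<in>K. reduced n g")
    case False
    show ?thesis
    proof (cases n)
      case 0
      have "K \<subseteq> Q"
      proof
        fix g assume g: "g \<in> K"
        then show "g \<in> Q"
          using less.prems(2)[OF g] 0 False by auto
      qed
      moreover have "conjugate_set G \<one> K = K"
        using Kc by (force simp: conjugate_set_def image_iff subset_iff)
      ultimately show ?thesis
        using generate.one[of G "Q \<union> R"] by force
    next
      case (Suc n')
      have "g \<in> Q \<or> (\<exists>l\<le>n'. reduced l g)" if "g \<in> K" for g
        using less.prems(2)[OF that] False that Suc by (metis le_Suc_eq)
      then show ?thesis
        using less.IH[of n' K] less.prems(1) Suc by blast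
    qed
  next
    case True
    then obtain q q' a where q: "q \<in> Q" "q' \<in> Q" and a: "alt n a" and qa: "q \<otimes> a \<otimes> q' \<in> K"
      by (auto simp: reduced_def)
    have clq: "q \<in> carrier G" "q' \<in> carrier G" "a \<in> carrier G"
      using q Q_closed a alt_closed by auto
    define K1 where "K1 = conjugate_set G (inv q) K"
    have K1: "subgroup K1 G"
      unfolding K1_def using conjugate_set_subgroup less.prems(1) clq by simp
    have K1c: "g \<in> carrier G" if "g \<in> K1" for g
      using K1 that subgroup.mem_carrier by metis
    have K1_mult: "x \<otimes> y \<in> K1" "inv x \<in> K1" if "x \<in> K1" "y \<in> K1" for x y
      using K1 that by (auto simp: subgroup.m_closed subgroup.m_inv_closed)
    have K1_bound: "g \<in> Q \<or> (\<exists>l\<le>n. reduced l g)" if g: "g \<in> K1" for g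
    proof -
      obtain g' where g': "g' \<in> K" "g = inv q \<otimes> g' \<otimes> q"
        using g clq by (auto simp: K1_def conjugate_set_def)
      from less.prems(2)[OF g'(1)] show ?thesis
        unfolding g'(2) using reduced_mult[of _ g' "inv q" q] q by auto
    qed
    have too_long: "\<not> alt l g" if "g \<in> K1" "l > n" for l g
    proof
      assume l: "alt l g"
      from K1_bound[OF that(1)] show False
        using alt_not_Q[OF l] reduced_unique[OF alt_reduced[OF l]] that(2) by auto
    qed
    have too_long': "\<not> reduced l g" if "g \<in> K1" "l > n" for l g
      using K1_bound[OF that(1)] reduced_not_Q reduced_unique that(2) by (metis leD)
    define p where "p = q' \<otimes> q"
    have p: "p \<in> Q" "p \<in> carrier G"
      using q Q_closed by (auto simp: p_def)
    have "inv q \<otimes> (q \<otimes> a \<otimes> q') \<otimes> inv (inv q) \<in> K1"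
      using qa unfolding K1_def conjugate_set_def by blast
    then have ap: "a \<otimes> p \<in> K1"
      using clq by (simp add: p_def m_assoc)
    \<comment> \<open>The first factor of an element of \<open>K1\<close> is absorbed by the alternating product that follows it.\<close>
    have left_R: "s \<in> R" if "s \<in> Q" "s' \<in> Q" "alt l b" "s \<otimes> b \<otimes> s' \<in> K1" for s s' b l
    proof (rule ccontr)
      assume s: "s \<notin> R"
      have "alt (n + l) (inv a \<otimes> s \<otimes> b)"
        using alt_concat[OF that(3) alt_inv[OF a] that(1) s] .
      then have "reduced (n + l) (inv p \<otimes> (inv a \<otimes> s \<otimes> b) \<otimes> s')"
        using p that(2) by (intro reducedI) auto
      moreover have "inv p \<otimes> (inv a \<otimes> s \<otimes> b) \<otimes> s' = inv (a \<otimes> p) \<otimes> (s \<otimes> b \<otimes> s')"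
        using clq p that Q_closed alt_closed[OF that(3)] by (simp add: inv_mult_group m_assoc)
      ultimately have "reduced (n + l) (inv (a \<otimes> p) \<otimes> (s \<otimes> b \<otimes> s'))"
        by simp
      moreover have "inv (a \<otimes> p) \<otimes> (s \<otimes> b \<otimes> s') \<in> K1"
        using ap that K1_mult by blast
      ultimately show False
        using too_long'[of _ "n + l"] alt_pos[OF that(3)] by simp
    qed
    have K1_alt: "g \<in> Q \<or> (\<exists>l\<le>n. alt l g)" if g: "g \<in> K1" for g
    proof (cases "g \<in> Q")
      case False
      then obtain l where l: "l \<le> n" "reduced l g"
        using K1_bound[OF g] by blast
      then obtain s s' b where b: "s \<in> Q" "s' \<in> Q" "alt l b" "g = s \<otimes> b \<otimes> s'"
        by (auto simp: reduced_def)
      have cl: "s \<in> carrier G" "s' \<in> carrier G" "b \<in> carrier G"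
        using b Q_closed alt_closed by auto
      have s: "s \<in> R"
        using left_R[OF b(1,2,3)] g b(4) by simp
      have "inv g = inv s' \<otimes> inv b \<otimes> inv s"
        unfolding b(4) using cl by (simp add: inv_mult_group m_assoc)
      then have "inv s' \<in> R"
        using left_R[of "inv s'" "inv s" l "inv b"] b alt_inv K1_mult(2)[OF g g] by simp
      then have "s' \<in> R"
        using inv_mem_R cl by simp
      then have "alt l g"
        unfolding b(4) using alt_mult_right alt_mult_left b s by blast
      then show ?thesis
        using l(1) by blast
    qed simp
    show ?thesis
    proof (cases "n = 1")
      case True
      have "K1 \<subseteq> Q \<union> R"
      proof
        fix g assume g: "g \<in> K1"
        show "g \<in> Q \<union> R"
        proof (cases "g \<in> Q")
          case False
          then obtain l where l: "l \<le> n" "alt l g"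
            using K1_alt[OF g] by blast
          then have "l = 1"
            using True alt_pos[OF l(2)] by simp
          then show ?thesis
            using alt_first[OF l(2)] alt_pos by force
        qed simp
      qed
      then have "K1 \<subseteq> Q \<or> K1 \<subseteq> R"
        by (rule subgroup_in_union[OF K1])
      moreover have "inv q \<in> W"
        using q by (intro generate.incl) simp
      ultimately show ?thesis
        unfolding K1_def by blast
    next
      case False
      define \<kappa> where "\<kappa> = a \<otimes> p"
      have \<kappa>: "\<kappa> \<in> K1"
        using ap by (simp add: \<kappa>_def)
      have red: "reduced n \<kappa>"
        unfolding \<kappa>_def using clq p by (intro reducedI[OF a, of \<one> p]) auto
      then have "\<kappa> \<notin> Q"
        by (rule reduced_not_Q)
      then obtain l where "alt l \<kappa>"
        using K1_alt[OF \<kappa>] by blast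
      then have alt_\<kappa>: "alt n \<kappa>"
        using reduced_unique[OF red alt_reduced] by blast
      then obtain r s c k where r: "n = Suc k" "r \<in> R" "r \<notin> Q" "s \<in> Q" "s \<notin> R" "alt k c" "\<kappa> = r \<otimes> s \<otimes> c"
        using alt_first False by blast
      have cl: "r \<in> carrier G" "s \<in> carrier G" "c \<in> carrier G"
        using r Q_closed R_closed alt_closed by auto
      \<comment> \<open>Otherwise conjugation by \<open>\<kappa>\<close> would double the number of syllables.\<close>
      have Q_case: "g \<in> R" if g: "g \<in> K1" "g \<in> Q" for g
      proof (rule ccontr)
        assume "g \<notin> R"
        then have "alt (n + n) (inv \<kappa> \<otimes> g \<otimes> \<kappa>)"
          using alt_concat[OF alt_\<kappa> alt_inv[OF alt_\<kappa>] g(2)] by blast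
        moreover have "inv \<kappa> \<otimes> g \<otimes> \<kappa> \<in> K1"
          using g(1) \<kappa> K1_mult by blast
        ultimately show False
          using too_long[of _ "n + n"] r(1) by simp
      qed
      \<comment> \<open>The factors from \<open>R\<close> at which the elements of \<open>K1\<close> begin agree up to \<open>Q \<inter> R\<close>.\<close>
      have first: "inv r \<otimes> r' \<in> Q"
        if r': "r' \<in> R" "r' \<notin> Q" "s' \<in> Q" "s' \<notin> R" "alt l b" "r' \<otimes> s' \<otimes> b \<in> K1" for r' s' b l
      proof (rule ccontr)
        assume n: "inv r \<otimes> r' \<notin> Q"
        have cl': "r' \<in> carrier G" "s' \<in> carrier G" "b \<in> carrier G"
          using r' Q_closed R_closed alt_closed by auto
        have "alt (Suc k + l) (inv c \<otimes> inv s \<otimes> (inv r \<otimes> r') \<otimes> s' \<otimes> b)"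
          using r r' n cl by (intro alt_concat alternating.extend alt_inv) (auto simp: inv_mem_R)
        moreover have "inv c \<otimes> inv s \<otimes> (inv r \<otimes> r') \<otimes> s' \<otimes> b = inv \<kappa> \<otimes> (r' \<otimes> s' \<otimes> b)"
          unfolding r(7) using cl cl' by (simp add: inv_mult_group m_assoc)
        moreover have "inv \<kappa> \<otimes> (r' \<otimes> s' \<otimes> b) \<in> K1"
          using r'(6) \<kappa> K1_mult by blast
        ultimately show False
          using too_long[of _ "Suc k + l"] r(1) alt_pos[OF r'(5)] by simp
      qed
      define K2 where "K2 = conjugate_set G (inv r) K1"
      have K2: "subgroup K2 G"
        unfolding K2_def using conjugate_set_subgroup K1 cl by simp
      have R_bound: "g \<in> Q \<or> (\<exists>l\<le>k. reduced l g)" if "g \<in> R" for g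
        using alternating.single[OF that] alt_reduced alt_pos[OF r(6)] by blast
      have "x \<in> Q \<or> (\<exists>l\<le>k. reduced l x)" if x: "x \<in> K2" for x
      proof -
        obtain g where g: "g \<in> K1" "x = inv r \<otimes> g \<otimes> r"
          using x cl by (auto simp: K2_def conjugate_set_def)
        consider "g \<in> R" | r' s' b l where "Suc l \<le> n" "r' \<in> R" "r' \<notin> Q" "s' \<in> Q" "s' \<notin> R" "alt l b"
            "g = r' \<otimes> s' \<otimes> b"
          using K1_alt[OF g(1)] Q_case[OF g(1)] alt_first by blast
        then show ?thesis
        proof cases
          case 1
          then show ?thesis
            using R_bound g(2) r(2) by simp
        next
          case 2
          have cl': "r' \<in> carrier G" "s' \<in> carrier G" "b \<in> carrier G"
            using 2 Q_closed R_closed alt_closed by auto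
          have rr': "inv r \<otimes> r' \<in> Q"
            using first[OF 2(2-6)] 2(7) g(1) by simp
          from alt_last[OF 2(6)] consider
            (1) "b \<in> R" "b \<notin> Q"
          | (2) r'' s'' c' k' where "l = Suc k'" "r'' \<in> R" "r'' \<notin> Q" "s'' \<in> Q" "s'' \<notin> R" "alt k' c'"
              "b = c' \<otimes> s'' \<otimes> r''"
            by blast
          then show ?thesis
          proof cases
            case 1
            have "inv g = inv b \<otimes> inv s' \<otimes> inv r'"
              unfolding 2(7) using cl' by (simp add: inv_mult_group m_assoc)
            then have "inv b \<otimes> inv s' \<otimes> inv r' \<in> K1"
              using K1_mult(2)[OF g(1) g(1)] by simp
            then have "inv r \<otimes> inv b \<in> Q"
              using 1 2 cl' by (intro first[of "inv b" "inv s'" 1 "inv r'"] alternating.single)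
                (auto simp: inv_mem_Q inv_mem_R)
            then have "b \<otimes> r \<in> Q"
              using inv_mem_Q[of "b \<otimes> r"] cl cl' by (simp add: inv_mult_group)
            moreover have "x = (inv r \<otimes> r') \<otimes> s' \<otimes> (b \<otimes> r)"
              unfolding g(2) 2(7) using cl cl' by (simp add: m_assoc)
            ultimately show ?thesis
              using rr' 2(4) by simp
          next
            case last: 2
            have cl'': "r'' \<in> carrier G" "s'' \<in> carrier G" "c' \<in> carrier G"
              using last Q_closed R_closed alt_closed by auto
            have "inv g = inv r'' \<otimes> inv s'' \<otimes> (inv c' \<otimes> inv s' \<otimes> inv r')"
              unfolding 2(7) last(7) using cl' cl'' by (simp add: inv_mult_group m_assoc)
            then have "inv r'' \<otimes> inv s'' \<otimes> (inv c' \<otimes> inv s' \<otimes> inv r') \<in> K1"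
              using K1_mult(2)[OF g(1) g(1)] by simp
            moreover have "alt (Suc k') (inv c' \<otimes> inv s' \<otimes> inv r')"
              using last 2 cl' by (intro alternating.extend alt_inv) (auto simp: inv_mem_Q inv_mem_R)
            ultimately have "inv r \<otimes> inv r'' \<in> Q"
              using last cl'' by (intro first[of "inv r''" "inv s''"]) (auto simp: inv_mem_Q inv_mem_R)
            then have "r'' \<otimes> r \<in> Q"
              using inv_mem_Q[of "r'' \<otimes> r"] cl cl'' by (simp add: inv_mult_group)
            moreover have "x = ((inv r \<otimes> r') \<otimes> s') \<otimes> c' \<otimes> (s'' \<otimes> (r'' \<otimes> r))"
              unfolding g(2) 2(7) last(7) using cl cl' cl'' by (simp add: m_assoc)
            ultimately have "reduced k' x"
              using rr' 2(4) last(4) by (intro reducedI[OF last(6), of "(inv r \<otimes> r') \<otimes> s'" "s'' \<otimes> (r'' \<otimes> r)"]) auto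
            then show ?thesis
              using last(1) 2(1) r(1) by (intro disjI2 exI[of _ k']) auto
          qed
        qed
      qed
      then obtain w where w: "w \<in> W" "conjugate_set G w K2 \<subseteq> Q \<or> conjugate_set G w K2 \<subseteq> R"
        using less.IH[of k K2] K2 r(1) by blast
      have wc: "w \<in> carrier G"
        using w(1) W_subgroup subgroup.mem_carrier by metis
      have "K2 = conjugate_set G (inv r \<otimes> inv q) K"
        unfolding K2_def K1_def using conjugate_set_mult cl clq Kc by simp
      then have "conjugate_set G w K2 = conjugate_set G (w \<otimes> (inv r \<otimes> inv q)) K"
        using conjugate_set_mult[OF wc _ Kc] cl clq by simp
      then have "conjugate_set G (w \<otimes> (inv r \<otimes> inv q)) K \<subseteq> Q \<or>
          conjugate_set G (w \<otimes> (inv r \<otimes> inv q)) K \<subseteq> R"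
        using w(2) by simp
      moreover have "inv r \<in> W"
        using r(2) by (intro generate.inv) simp
      moreover have "inv q \<in> W"
        using q(1) by (intro generate.inv) simp
      ultimately show ?thesis
        using generate.eng[OF w(1) generate.eng[of "inv r" G "Q \<union> R" "inv q"]] by blast
    qed
  qed
qed

end

section \<open>Normal forms in the amalgam\<close>

text \<open>Injectivity concerns words and not their values, so the reduction to normal form has to be carried
  out with words and their equivalence in the amalgam.\<close>

inductive alternating_word :: "'a set \<Rightarrow> 'a set \<Rightarrow> ('a + 'a) list \<Rightarrow> bool" for Q R where
  single: "r \<in> R \<Longrightarrow> r \<notin> Q \<Longrightarrow> alternating_word Q R [Inr r]"
| extend: "alternating_word Q R u \<Longrightarrow> s \<in> Q \<Longrightarrow> s \<notin> R \<Longrightarrow> r \<in> R \<Longrightarrow> r \<notin> Q \<Longrightarrow>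
     alternating_word Q R (u @ [Inl s, Inr r])"

context two_subgroups
begin

abbreviation "words \<equiv> amalgam_words Q R"
abbreviation "eval_word \<equiv> amalgam_eval G"
abbreviation eq_word (infix "\<approx>" 50) where "u \<approx> v \<equiv> amalgam_eq G Q R u v"

lemmas eval_append = amalgam_eval_append[OF is_group Q_subgroup R_subgroup]
lemmas eq_sound = amalgam_eq_sound[OF is_group Q_subgroup R_subgroup]

lemma words_simps [simp]:
  "[] \<in> words" "u @ v \<in> words \<longleftrightarrow> u \<in> words \<and> v \<in> words"
  "Inl q # u \<in> words \<longleftrightarrow> q \<in> Q \<and> u \<in> words" "Inr r # u \<in> words \<longleftrightarrow> r \<in> R \<and> u \<in> words"
  by (auto simp: amalgam_words_def)

lemma alternating_word_eval:
  "alternating_word Q R u \<Longrightarrow> u \<in> words \<and> (\<exists>n. alt n (eval_word u))"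
proof (induction rule: alternating_word.induct)
  case (single r)
  then have "alt 1 r"
    by (rule alternating.single)
  then show ?case
    using single R_closed by auto
next
  case (extend u s r)
  then obtain n where n: "u \<in> words" "alt n (eval_word u)"
    by blast
  have "eval_word (u @ [Inl s, Inr r]) = eval_word u \<otimes> s \<otimes> r"
    using eval_append[OF n(1), of "[Inl s, Inr r]"] extend alt_closed[OF n(2)] by (simp add: Q_closed R_closed m_assoc)
  moreover have "alt (Suc n) (eval_word u \<otimes> s \<otimes> r)"
    using n extend by (intro alternating.extend)
  ultimately show ?case
    using n(1) extend by auto
qed

lemma eq_word_context: "u \<approx> v \<Longrightarrow> p \<in> words \<Longrightarrow> s \<in> words \<Longrightarrow> p @ u @ s \<approx> p @ v @ s"
  by (intro amalgam_eq.congr amalgam_eq.refl)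

lemma eq_word_merge_r:
  assumes "a \<in> R" "q \<in> Q" "q \<in> R" "b \<in> R"
  shows "[Inr a, Inl q, Inr b] \<approx> [Inr (a \<otimes> q \<otimes> b)]"
proof -
  have "[Inr a] @ [Inl q] @ [Inr b] \<approx> [Inr a] @ [Inr q] @ [Inr b]"
    using assms by (intro eq_word_context amalgam_eq.glue) auto
  moreover have "[] @ [Inr a, Inr q] @ [Inr b] \<approx> [] @ [Inr (a \<otimes> q)] @ [Inr b]"
    using assms by (intro eq_word_context amalgam_eq.mult_r) auto
  moreover have "[Inr (a \<otimes> q), Inr b] \<approx> [Inr (a \<otimes> q \<otimes> b)]"
    using assms by (intro amalgam_eq.mult_r) auto
  ultimately show ?thesis
    by simp (meson amalgam_eq.trans)
qed

definition reduced_word :: "('a + 'a) list \<Rightarrow> bool" where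
  "reduced_word w \<longleftrightarrow> (\<exists>q\<in>Q. w = [Inl q]) \<or>
     (\<exists>q\<in>Q. \<exists>q'\<in>Q. \<exists>u. alternating_word Q R u \<and> w = Inl q # u @ [Inl q'])"

lemma reducible_mult_Q:
  assumes w: "reduced_word w" and q: "q \<in> Q"
  shows "\<exists>v. reduced_word v \<and> w @ [Inl q] \<approx> v"
proof -
  have "\<exists>p a. w = p @ [Inl a] \<and> p \<in> words \<and> a \<in> Q \<and> (\<forall>b\<in>Q. reduced_word (p @ [Inl b]))"
    using w unfolding reduced_word_def
  proof
    assume "\<exists>q\<in>Q. w = [Inl q]"
    then show "\<exists>p a. w = p @ [Inl a] \<and> p \<in> words \<and> a \<in> Q \<and> (\<forall>b\<in>Q. (\<exists>q\<in>Q. p @ [Inl b] = [Inl q]) \<or>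
       (\<exists>q\<in>Q. \<exists>q'\<in>Q. \<exists>u. alternating_word Q R u \<and> p @ [Inl b] = Inl q # u @ [Inl q']))"
      by (intro exI[of _ "[]"]) auto
  next
    assume "\<exists>q\<in>Q. \<exists>q'\<in>Q. \<exists>u. alternating_word Q R u \<and> w = Inl q # u @ [Inl q']"
    then obtain s s' u where u: "s \<in> Q" "s' \<in> Q" "alternating_word Q R u" "w = Inl s # u @ [Inl s']"
      by blast
    then show "\<exists>p a. w = p @ [Inl a] \<and> p \<in> words \<and> a \<in> Q \<and> (\<forall>b\<in>Q. (\<exists>q\<in>Q. p @ [Inl b] = [Inl q]) \<or>
       (\<exists>q\<in>Q. \<exists>q'\<in>Q. \<exists>u. alternating_word Q R u \<and> p @ [Inl b] = Inl q # u @ [Inl q']))"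
      using alternating_word_eval[OF u(3)] by (intro exI[of _ "Inl s # u"] exI[of _ s']) auto
  qed
  then obtain p a where p: "w = p @ [Inl a]" "p \<in> words" "a \<in> Q" "\<And>b. b \<in> Q \<Longrightarrow> reduced_word (p @ [Inl b])"
    by blast
  have "p @ [Inl a, Inl q] @ [] \<approx> p @ [Inl (a \<otimes> q)] @ []"
    using p q by (intro eq_word_context amalgam_eq.mult_l) auto
  then show ?thesis
    using p q by (intro exI[of _ "p @ [Inl (a \<otimes> q)]"]) auto
qed

lemma reducible_mult_R:
  assumes w: "reduced_word w" and r: "r \<in> R" "r \<notin> Q"
  shows "\<exists>v. reduced_word v \<and> w @ [Inr r] \<approx> v"
proof -
  have redI: "reduced_word (Inl q # u @ [Inl q'])"
    if "q \<in> Q" "q' \<in> Q" "alternating_word Q R u" for q q' u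
    using that unfolding reduced_word_def by blast
  have pad: "p \<approx> p @ [Inl \<one>]" if "p \<in> words" for p
  proof -
    have "p @ [Inl \<one>] @ [] \<approx> p @ [] @ []"
      using that by (intro eq_word_context amalgam_eq.one_l) auto
    then show ?thesis
      using amalgam_eq.sym by simp
  qed
  show ?thesis
    using w unfolding reduced_word_def[of w]
  proof
    assume "\<exists>q\<in>Q. w = [Inl q]"
    then obtain q where q: "q \<in> Q" "w = [Inl q]"
      by blast
    have "alternating_word Q R [Inr r]"
      by (rule alternating_word.single[OF r])
    then have "reduced_word (Inl q # [Inr r] @ [Inl \<one>])"
      using q by (intro redI) auto
    moreover have "w @ [Inr r] \<approx> Inl q # [Inr r] @ [Inl \<one>]"
      using pad[of "[Inl q, Inr r]"] q r by simp
    ultimately show ?thesis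
      by blast
  next
    assume "\<exists>q\<in>Q. \<exists>q'\<in>Q. \<exists>u. alternating_word Q R u \<and> w = Inl q # u @ [Inl q']"
    then obtain q q' u where u: "q \<in> Q" "q' \<in> Q" "alternating_word Q R u" "w = Inl q # u @ [Inl q']"
      by blast
    have uw: "u \<in> words"
      using alternating_word_eval[OF u(3)] by blast
    show ?thesis
    proof (cases "q' \<in> R")
      case False
      then have "alternating_word Q R (u @ [Inl q', Inr r])"
        using u r by (intro alternating_word.extend)
      then have "reduced_word (Inl q # (u @ [Inl q', Inr r]) @ [Inl \<one>])"
        using u by (intro redI) auto
      moreover have "w @ [Inr r] \<approx> Inl q # (u @ [Inl q', Inr r]) @ [Inl \<one>]"
        using pad[of "Inl q # (u @ [Inl q', Inr r])"] u uw r by simp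
      ultimately show ?thesis
        by blast
    next
      case q'R: True
      from u(3) show ?thesis
      proof cases
        case (single t)
        define t' where "t' = t \<otimes> q' \<otimes> r"
        have t': "t' \<in> R"
          using single q'R r by (simp add: t'_def)
        have "[Inl q] @ [Inr t, Inl q', Inr r] @ [] \<approx> [Inl q] @ [Inr t'] @ []"
          unfolding t'_def using u single q'R r by (intro eq_word_context eq_word_merge_r) auto
        then have eq: "w @ [Inr r] \<approx> [Inl q, Inr t']"
          using u single by simp
        show ?thesis
        proof (cases "t' \<in> Q")
          case True
          have "[Inl q] @ [Inr t'] @ [] \<approx> [Inl q] @ [Inl t'] @ []"
            using True t' u by (intro eq_word_context amalgam_eq.sym[OF amalgam_eq.glue]) auto
          moreover have "[Inl q, Inl t'] \<approx> [Inl (q \<otimes> t')]"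
            using True u by (intro amalgam_eq.mult_l) auto
          ultimately have "w @ [Inr r] \<approx> [Inl (q \<otimes> t')]"
            using eq by simp (meson amalgam_eq.trans)
          then show ?thesis
            using True u unfolding reduced_word_def by (intro exI[of _ "[Inl (q \<otimes> t')]"]) auto
        next
          case False
          have "alternating_word Q R [Inr t']"
            by (rule alternating_word.single[OF t' False])
          then have "reduced_word (Inl q # [Inr t'] @ [Inl \<one>])"
            using u by (intro redI) auto
          moreover have "[Inl q, Inr t'] \<approx> Inl q # [Inr t'] @ [Inl \<one>]"
            using pad[of "[Inl q, Inr t']"] u t' by simp
          ultimately show ?thesis
            using eq amalgam_eq.trans by blast
        qed
      next
        case (extend u0 s t)
        have u0: "u0 \<in> words"
          using alternating_word_eval[OF extend(2)] by blast
        define t' where "t' = t \<otimes> q' \<otimes> r"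
        have t': "t' \<in> R"
          using extend q'R r by (simp add: t'_def)
        have "(Inl q # u0 @ [Inl s]) @ [Inr t, Inl q', Inr r] @ [] \<approx> (Inl q # u0 @ [Inl s]) @ [Inr t'] @ []"
          unfolding t'_def using u extend q'R r u0 by (intro eq_word_context eq_word_merge_r) auto
        then have eq: "w @ [Inr r] \<approx> Inl q # u0 @ [Inl s, Inr t']"
          using u extend by simp
        show ?thesis
        proof (cases "t' \<in> Q")
          case True
          have "(Inl q # u0 @ [Inl s]) @ [Inr t'] @ [] \<approx> (Inl q # u0 @ [Inl s]) @ [Inl t'] @ []"
            using True t' u extend u0 by (intro eq_word_context amalgam_eq.sym[OF amalgam_eq.glue]) auto
          moreover have "(Inl q # u0) @ [Inl s, Inl t'] @ [] \<approx> (Inl q # u0) @ [Inl (s \<otimes> t')] @ []"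
            using True u extend u0 by (intro eq_word_context amalgam_eq.mult_l) auto
          ultimately have "w @ [Inr r] \<approx> Inl q # u0 @ [Inl (s \<otimes> t')]"
            using eq by simp (meson amalgam_eq.trans)
          moreover have "reduced_word (Inl q # u0 @ [Inl (s \<otimes> t')])"
            using True u extend by (intro redI) auto
          ultimately show ?thesis
            by blast
        next
          case False
          have "alternating_word Q R (u0 @ [Inl s, Inr t'])"
            using extend t' False by (intro alternating_word.extend)
          then have "reduced_word (Inl q # (u0 @ [Inl s, Inr t']) @ [Inl \<one>])"
            using u by (intro redI) auto
          moreover have "Inl q # u0 @ [Inl s, Inr t'] \<approx> Inl q # (u0 @ [Inl s, Inr t']) @ [Inl \<one>]"
            using pad[of "Inl q # u0 @ [Inl s, Inr t']"] u extend u0 t' by simp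
          ultimately show ?thesis
            using eq amalgam_eq.trans by blast
        qed
      qed
    qed
  qed
qed

lemma reducible: "w \<in> words \<Longrightarrow> \<exists>v. reduced_word v \<and> w \<approx> v"
proof (induction w rule: rev_induct)
  case Nil
  have "[] \<approx> [Inl \<one>]"
    using amalgam_eq.one_l amalgam_eq.sym by blast
  then show ?case
    unfolding reduced_word_def by (intro exI[of _ "[Inl \<one>]"]) auto
next
  case (snoc l w)
  then obtain v where v: "reduced_word v" "w \<approx> v"
    by auto
  have step: ?case if l: "[l] \<approx> [l']" and v': "\<exists>v'. reduced_word v' \<and> v @ [l'] \<approx> v'" for l'
  proof -
    have "w @ [l] \<approx> v @ [l']"
      using v(2) l by (rule amalgam_eq.congr)
    then show ?thesis
      using v' amalgam_eq.trans by blast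
  qed
  show ?case
  proof (cases l)
    case (Inl q)
    then have "q \<in> Q"
      using snoc.prems by simp
    then show ?thesis
      using step[of l] reducible_mult_Q[OF v(1)] amalgam_eq.refl[of "[l]" Q R G] Inl by simp
  next
    case (Inr r)
    then have r: "r \<in> R"
      using snoc.prems by simp
    show ?thesis
    proof (cases "r \<in> Q")
      case True
      then have "[l] \<approx> [Inl r]"
        unfolding Inr using r by (intro amalgam_eq.sym[OF amalgam_eq.glue]) simp
      then show ?thesis
        using step reducible_mult_Q[OF v(1) True] by blast
    next
      case False
      then show ?thesis
        using step[of l] reducible_mult_R[OF v(1) r] amalgam_eq.refl[of "[l]" Q R G] r Inr by simp
    qed
  qed
qed

lemma reduced_word_eval:
  assumes "reduced_word w"
  shows "(\<exists>q\<in>Q. w = [Inl q] \<and> eval_word w = q) \<or> (\<exists>n. reduced n (eval_word w))"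
  using assms unfolding reduced_word_def
proof
  assume "\<exists>q\<in>Q. w = [Inl q]"
  then show ?thesis
    using Q_closed by auto
next
  assume "\<exists>q\<in>Q. \<exists>q'\<in>Q. \<exists>u. alternating_word Q R u \<and> w = Inl q # u @ [Inl q']"
  then obtain q q' u where u: "q \<in> Q" "q' \<in> Q" "alternating_word Q R u" "w = Inl q # u @ [Inl q']"
    by blast
  obtain n where n: "u \<in> words" "alt n (eval_word u)"
    using alternating_word_eval[OF u(3)] by blast
  have "eval_word w = q \<otimes> eval_word u \<otimes> q'"
    using u n eval_append[OF n(1), of "[Inl q']"] alt_closed by (simp add: Q_closed m_assoc)
  then show ?thesis
    using reducedI[OF n(2) u(1,2)] by blast
qed

lemma eval_words_eq_generate: "eval_word ` words = W"
proof
  have "w \<in> words \<Longrightarrow> eval_word w \<in> W" for w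
  proof (induction w)
    case Nil
    then show ?case by (simp add: generate.one)
  next
    case (Cons l w)
    then show ?case
      by (cases l) (auto intro!: generate.eng intro: generate.incl)
  qed
  then show "eval_word ` words \<subseteq> W"
    by blast
  show "W \<subseteq> eval_word ` words"
  proof
    fix g assume "g \<in> W"
    then show "g \<in> eval_word ` words"
    proof induction
      case one
      show ?case by (rule image_eqI[of _ _ "[]"]) auto
    next
      case (incl g)
      then show ?case
        using Q_closed R_closed by (elim UnE) (rule image_eqI[of _ _ "[Inl g]"] image_eqI[of _ _ "[Inr g]"]; simp)+
    next
      case (inv g)
      then show ?case
        using Q_closed R_closed by (elim UnE) (rule image_eqI[of _ _ "[Inl (inv g)]"] image_eqI[of _ _ "[Inr (inv g)]"]; simp)+
    next
      case (eng g g')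
      then obtain u v where "u \<in> words" "v \<in> words" "g = eval_word u" "g' = eval_word v"
        by blast
      then show ?case
        using eval_append by (intro image_eqI[of _ _ "u @ v"]) auto
    qed
  qed
qed

lemma generate_reduced: "g \<in> W \<Longrightarrow> g \<in> Q \<or> (\<exists>n. reduced n g)"
proof -
  assume "g \<in> W"
  then obtain w where w: "w \<in> words" "g = eval_word w"
    using eval_words_eq_generate by blast
  obtain v where "reduced_word v" "w \<approx> v"
    using reducible[OF w(1)] by blast
  then show ?thesis
    using reduced_word_eval[of v] eq_sound[of w v] w(2) by auto
qed

lemma amalgam_hom_image: "amalgam_hom G ` carrier (amalgam G Q R) = W"
proof -
  have "carrier (amalgam G Q R) = (\<lambda>w. amalgam_rel G Q R `` {w}) ` words"
    by (auto simp: amalgam_def quotient_def)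
  then have "amalgam_hom G ` carrier (amalgam G Q R) = eval_word ` words"
    using amalgam_hom_class[OF is_group Q_subgroup R_subgroup] by (simp add: image_image)
  then show ?thesis
    using eval_words_eq_generate by simp
qed

end

context faithful_subgroups
begin

text \<open>A word with value \<open>\<one>\<close> is equivalent to a reduced word. Since the value lies in \<open>Q\<close>, the reduced word
  has no alternating part; it is a single letter from \<open>Q\<close>, which must be \<open>\<one>\<close>.\<close>

lemma amalgam_hom_mon: "amalgam_hom G \<in> mon (amalgam G Q R) G"
proof -
  have hom: "amalgam_hom G \<in> hom (amalgam G Q R) G"
    by (rule amalgam_hom_hom[OF is_group Q_subgroup R_subgroup])
  have "x = \<one>\<^bsub>amalgam G Q R\<^esub>"
    if x: "x \<in> carrier (amalgam G Q R)" "amalgam_hom G x = \<one>" for x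
  proof -
    obtain w where w: "w \<in> words" "x = amalgam_rel G Q R `` {w}"
      using x(1) by (auto simp: amalgam_def elim!: quotientE)
    have one: "eval_word w = \<one>"
      using x(2) amalgam_hom_class[OF is_group Q_subgroup R_subgroup w(1)] w(2) by simp
    obtain v where v: "reduced_word v" "w \<approx> v"
      using reducible[OF w(1)] by blast
    have ev: "eval_word v = \<one>"
      using eq_sound[OF v(2)] one by simp
    have "\<not> reduced n (eval_word v)" for n
      using ev reduced_not_Q by fastforce
    then obtain q where "q \<in> Q" "v = [Inl q]" "eval_word v = q"
      using reduced_word_eval[OF v(1)] by blast
    then have "w \<approx> []"
      using v(2) ev amalgam_eq.one_l amalgam_eq.trans by metis
    then have "x = amalgam_rel G Q R `` {[]}"
      unfolding w(2) by (intro equiv_class_eq[OF amalgam_equiv[OF is_group Q_subgroup R_subgroup]]) (simp add: amalgam_rel_def)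
    then show ?thesis
      by (simp add: amalgam_def)
  qed
  then show ?thesis
    using hom inj_on_one_iff'[OF hom amalgam_group[OF is_group Q_subgroup R_subgroup] is_group] by (simp add: mon_def)
qed

end

section \<open>Geodesics along alternating products\<close>

context peripheral_cayley
begin

lemma walk_translate:
  "k \<in> carrier G \<Longrightarrow> x \<in> carrier G \<Longrightarrow> set w \<subseteq> letters \<Longrightarrow> walk G (k \<otimes> x) w = k \<otimes> walk G x w"
proof (induction w arbitrary: x)
  case (Cons l w)
  then have "letter_val l \<in> carrier G"
    using letter_val_closed by simp
  then show ?case
    using Cons by (simp add: m_assoc)
qed simp

lemma path_vertex_translate:
  "k \<in> carrier G \<Longrightarrow> x \<in> carrier G \<Longrightarrow> set w \<subseteq> letters \<Longrightarrow>
     vertex (k \<otimes> x) w n = k \<otimes> vertex x w n"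
  unfolding path_vertex_def using walk_translate set_take_subset[of n w] by simp

lemma geodesic_translate:
  assumes "k \<in> carrier G" "geodesic x w y"
  shows "geodesic (k \<otimes> x) w (k \<otimes> y)"
  using assms geodesic_closed[OF assms(2)] walk_translate dg_translate by (simp add: geodesic_def)

text \<open>Quasiconvexity in the form needed: uniform over all left translates of \<open>Q\<close>, and for geodesics that
  start and end only near the translate.\<close>

definition coset_stable :: "'a set \<Rightarrow> nat \<Rightarrow> nat \<Rightarrow> bool" where
  "coset_stable Q k M \<longleftrightarrow> (\<forall>g x w y f f' n. g \<in> carrier G \<longrightarrow> geodesic x w y \<longrightarrow>
     f \<in> Q \<longrightarrow> f' \<in> Q \<longrightarrow> dx (g \<otimes> f) x \<le> k \<longrightarrow> dx (g \<otimes> f') y \<le> k \<longrightarrow> n \<le> length w \<longrightarrow>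
     (\<exists>q\<in>Q. dx (g \<otimes> q) (vertex x w n) \<le> M))"

lemma relatively_quasiconvex_coset_stable:
  assumes Q: "relatively_quasiconvex G X m H Q" and bcp: "bounded_coset_penetration G X m H"
  shows "\<exists>M. coset_stable Q k M"
proof -
  have sub: "subgroup Q G"
    using Q by (simp add: relatively_quasiconvex_def)
  obtain \<sigma> :: real where \<sigma>: "\<And>f g p n. f \<in> Q \<Longrightarrow> g \<in> Q \<Longrightarrow> geodesic_path G X m H p \<Longrightarrow>
      path_start G p = f \<Longrightarrow> path_end G p = g \<Longrightarrow> n \<le> path_len p \<Longrightarrow>
      \<exists>w\<in>Q. real (dx (path_vertex G p n) w) \<le> \<sigma>"
    using Q unfolding relatively_quasiconvex_def by blast
  obtain \<epsilon> :: nat where \<epsilon>: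
    "\<And>x w y u n. comparable 0 k x w y u \<Longrightarrow> n \<le> length w \<Longrightarrow>
       \<exists>n'\<le>length u. dx (vertex x w n) (vertex y u n') \<le> \<epsilon>"
    by (rule bcp_tight[OF bcp, of 0 k]) blast
  have "coset_stable Q k (\<epsilon> + nat \<lfloor>\<sigma>\<rfloor>)"
    unfolding coset_stable_def
  proof (intro allI impI)
    fix g x w y f f' n
    assume g: "g \<in> carrier G" and w: "geodesic x w y" and f: "f \<in> Q" "f' \<in> Q"
      and near: "dx (g \<otimes> f) x \<le> k" "dx (g \<otimes> f') y \<le> k" and n: "n \<le> length w"
    have clf: "f \<in> carrier G" "f' \<in> carrier G"
      using f sub subgroup.mem_carrier by metis+
    note cl = geodesic_closed[OF w]
    obtain u where u: "geodesic f u f'"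
      using geodesic_exists clf by metis
    have gu: "geodesic (g \<otimes> f) u (g \<otimes> f')"
      by (rule geodesic_translate[OF g u])
    have "dx x (g \<otimes> f) \<le> k" "dx y (g \<otimes> f') \<le> k"
      using near X.word_dist_sym g clf cl by simp_all
    then obtain n' where n': "n' \<le> length u"
      "dx (vertex x w n) (vertex (g \<otimes> f) u n') \<le> \<epsilon>"
      using \<epsilon>[OF geodesics_comparable[OF w gu] n] by blast
    let ?v = "vertex x w n" and ?u = "vertex f u n'"
    have clu: "?u \<in> carrier G"
      using geodesic_closed(4)[OF u] .
    have vu: "vertex (g \<otimes> f) u n' = g \<otimes> ?u"
      using path_vertex_translate g clf geodesic_closed(3)[OF u] by simp
    obtain q where q: "q \<in> Q" "real (dx ?u q) \<le> \<sigma>"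
      using \<sigma>[OF f, of "(f, u)" n'] n'(1) u geodesic_path_iff[of f u f'] by auto
    have clq: "q \<in> carrier G"
      using q(1) sub subgroup.mem_carrier by metis
    have "dx ?u q \<le> nat \<lfloor>\<sigma>\<rfloor>"
      using q(2) by (rule le_nat_floor)
    then have "dx (g \<otimes> ?u) (g \<otimes> q) \<le> nat \<lfloor>\<sigma>\<rfloor>"
      using X.word_dist_translate[OF g clu clq] by simp
    then have "dx ?v (g \<otimes> q) \<le> \<epsilon> + nat \<lfloor>\<sigma>\<rfloor>"
      using X.word_dist_triangle[of ?v "g \<otimes> ?u" "g \<otimes> q"] n'(2) vu cl(4) g clu clq by fastforce
    then show "\<exists>q\<in>Q. dx (g \<otimes> q) ?v \<le> \<epsilon> + nat \<lfloor>\<sigma>\<rfloor>"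
      using q(1) X.word_dist_sym cl(4) g clq by (metis m_closed)
  qed
  then show ?thesis
    by blast
qed

end

text \<open>The products \<open>q\<^sub>0 r\<^sub>1 q\<^sub>1 \<dots> r\<^sub>n q\<^sub>n\<close> after which the next factor from \<open>R - Q\<close> may follow; only \<open>q\<^sub>0\<close> is
  allowed to lie in \<open>R\<close>.\<close>

inductive prefix :: "('a, 'b) monoid_scheme \<Rightarrow> 'a set \<Rightarrow> 'a set \<Rightarrow> nat \<Rightarrow> 'a \<Rightarrow> bool"
  for G Q R where
  start: "q \<in> Q \<Longrightarrow> prefix G Q R 0 q"
| extend: "prefix G Q R n f \<Longrightarrow> r \<in> R \<Longrightarrow> r \<notin> Q \<Longrightarrow> q \<in> Q \<Longrightarrow> q \<notin> R \<Longrightarrow>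
     prefix G Q R (Suc n) (f \<otimes>\<^bsub>G\<^esub> r \<otimes>\<^bsub>G\<^esub> q)"

text \<open>The parabolic subgroup \<open>P = h H\<^sub>i h\<inverse>\<close> enters only through \<open>R \<subseteq> P\<close> and \<open>Q \<inter> P \<subseteq> R\<close>. The constant \<open>K\<close>
  bounds how far the projections of the points \<open>q h\<close> to \<open>h H\<^sub>i\<close> are from \<open>Q \<inter> P\<close>. In the proof the
  endpoints of a factor from \<open>R - Q\<close> are known up to an error of \<open>K + E\<close> each, and their distance must
  still exceed \<open>E\<close>; this explains the bound \<open>2 * K + 3 * E\<close>. Geodesics are started at \<open>h\<close> and not
  at \<open>\<one>\<close>, because \<open>h\<close> is a point of the coset \<open>h H\<^sub>i\<close>.\<close>

locale long_syllables = peripheral_cayley G X m H + two_subgroups G Q R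
  for G :: "('a, 'b) monoid_scheme" (structure) and X m H Q R +
  fixes i :: nat and h :: 'a and E K k M :: nat
  assumes i: "i \<in> {1..m}" and h: "h \<in> carrier G"
    and R_parabolic: "r \<in> R \<Longrightarrow> inv h \<otimes> r \<otimes> h \<in> H i"
    and Q_parabolic: "q \<in> Q \<Longrightarrow> inv h \<otimes> q \<otimes> h \<in> H i \<Longrightarrow> q \<in> R"
    and E: "penetration_constant E"
    and K: "q \<in> Q \<Longrightarrow> nearest i h (q \<otimes> h) a \<Longrightarrow> \<exists>z\<in>Q \<inter> R. dx z a \<le> K"
    and long: "r \<in> R \<Longrightarrow> r \<notin> Q \<Longrightarrow> lx r > 2 * K + 3 * E"
    and stable: "coset_stable Q k M"
    and k: "K + 2 * E \<le> k" "lx h \<le> k"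
begin

lemma QR_closed: "z \<in> Q \<inter> R \<Longrightarrow> z \<in> carrier G"
  using Q_closed by blast

lemma Q_in_W: "q \<in> Q \<Longrightarrow> q \<in> W" and R_in_W: "r \<in> R \<Longrightarrow> r \<in> W"
  by (auto intro: generate.incl)

lemma prefix_in_W: "prefix G Q R n f \<Longrightarrow> f \<in> W"
proof (induction rule: prefix.induct)
  case (start q)
  then show ?case by (rule Q_in_W)
next
  case (extend n f r q)
  then show ?case
    using Q_in_W R_in_W W_subgroup by (simp add: subgroup.m_closed)
qed

lemma prefix_closed: "prefix G Q R n f \<Longrightarrow> f \<in> carrier G"
  using prefix_in_W W_subgroup subgroup.mem_carrier by metis

lemma same_coset_R:
  assumes "f \<in> carrier G" "r \<in> R"
  shows "same_coset i (f \<otimes> h) (f \<otimes> r \<otimes> h)"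
proof -
  have "inv (f \<otimes> h) \<otimes> (f \<otimes> r \<otimes> h) = inv h \<otimes> r \<otimes> h"
    using assms R_closed h by (simp add: inv_mult_group m_assoc)
  then show ?thesis
    using R_parabolic assms by (simp add: same_coset_def)
qed

lemma distinct_cosets:
  assumes f: "f \<in> carrier G" and r: "r \<in> R" and q: "q \<in> Q" "q \<notin> R"
  shows "\<not> same_coset i (f \<otimes> h) (f \<otimes> r \<otimes> q \<otimes> h)"
proof
  assume c: "same_coset i (f \<otimes> h) (f \<otimes> r \<otimes> q \<otimes> h)"
  have cl: "r \<in> carrier G" "q \<in> carrier G" "f \<otimes> h \<in> carrier G" "f \<otimes> r \<otimes> h \<in> carrier G"
    "f \<otimes> r \<otimes> q \<otimes> h \<in> carrier G"
    using f r q h Q_closed R_closed by auto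
  have "same_coset i (f \<otimes> r \<otimes> h) (f \<otimes> r \<otimes> q \<otimes> h)"
    using same_coset_trans[OF i cl(4,3,5) same_coset_sym[OF i cl(3,4) same_coset_R[OF f r]] c] .
  moreover have "inv (f \<otimes> r \<otimes> h) \<otimes> (f \<otimes> r \<otimes> q \<otimes> h) = inv h \<otimes> q \<otimes> h"
    using cl f h by (simp add: inv_mult_group m_assoc)
  ultimately show False
    using Q_parabolic q by (simp add: same_coset_def)
qed

text \<open>As \<open>r \<in> P\<close>, the coset is also that of \<open>f r h\<close>, and the claim is a left translate of the assumption on \<open>K\<close>.\<close>

lemma nearest_to_product:
  assumes f: "f \<in> carrier G" and r: "r \<in> R" and q: "q \<in> Q"
    and b: "nearest i (f \<otimes> h) (f \<otimes> r \<otimes> q \<otimes> h) b"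
  shows "\<exists>z\<in>Q \<inter> R. dx (f \<otimes> r \<otimes> z) b \<le> K"
proof -
  have cl: "r \<in> carrier G" "q \<in> carrier G" "f \<otimes> h \<in> carrier G" "f \<otimes> r \<otimes> h \<in> carrier G"
    "f \<otimes> r \<otimes> q \<otimes> h \<in> carrier G" "f \<otimes> r \<in> carrier G" "b \<in> carrier G"
    using f r q h Q_closed R_closed nearest_closed[OF b] by auto
  have "nearest i (f \<otimes> r \<otimes> h) (f \<otimes> r \<otimes> q \<otimes> h) b"
    using nearest_representative[OF i cl(3,4) same_coset_R[OF f r]] b by simp
  then have "nearest i (inv (f \<otimes> r) \<otimes> (f \<otimes> r \<otimes> h)) (inv (f \<otimes> r) \<otimes> (f \<otimes> r \<otimes> q \<otimes> h)) (inv (f \<otimes> r) \<otimes> b)"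
    using cl by (intro nearest_translate) auto
  moreover have "inv (f \<otimes> r) \<otimes> (f \<otimes> r \<otimes> h) = h" "inv (f \<otimes> r) \<otimes> (f \<otimes> r \<otimes> q \<otimes> h) = q \<otimes> h"
    using cl f h by (simp_all add: inv_mult_group m_assoc)
  ultimately have "nearest i h (q \<otimes> h) (inv (f \<otimes> r) \<otimes> b)"
    by simp
  then obtain z where z: "z \<in> Q \<inter> R" "dx z (inv (f \<otimes> r) \<otimes> b) \<le> K"
    using K[OF q] by blast
  then have "dx (f \<otimes> r \<otimes> z) (f \<otimes> r \<otimes> (inv (f \<otimes> r) \<otimes> b)) \<le> K"
    using X.word_dist_translate[of "f \<otimes> r" z "inv (f \<otimes> r) \<otimes> b"] cl QR_closed by simp
  moreover have "f \<otimes> r \<otimes> (inv (f \<otimes> r) \<otimes> b) = b"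
    using cl by simp
  ultimately show ?thesis
    using z(1) by auto
qed

lemma projection_of_next_coset:
  assumes f: "f \<in> carrier G" and r: "r \<in> R" and q: "q \<in> Q" "q \<notin> R"
    and y: "y \<in> carrier G" "same_coset i (f \<otimes> r \<otimes> q \<otimes> h) y"
    and b: "nearest i (f \<otimes> h) y b"
  shows "\<exists>z\<in>Q \<inter> R. dx (f \<otimes> r \<otimes> z) b \<le> K + E"
proof -
  have cl: "f \<otimes> h \<in> carrier G" "f \<otimes> r \<otimes> q \<otimes> h \<in> carrier G" "f \<otimes> r \<in> carrier G" "b \<in> carrier G"
    using f r q h Q_closed R_closed nearest_closed[OF b] by auto
  obtain b' where b': "nearest i (f \<otimes> h) (f \<otimes> r \<otimes> q \<otimes> h) b'"
    using nearest_exists[OF i cl(1)] .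
  have "dx b' b \<le> E"
    using distinct_coset_projection[OF E i cl(1,2) y(1) y(2) distinct_cosets[OF f r q] b' b] .
  moreover obtain z where z: "z \<in> Q \<inter> R" "dx (f \<otimes> r \<otimes> z) b' \<le> K"
    using nearest_to_product[OF f r q(1) b'] by blast
  moreover have "dx (f \<otimes> r \<otimes> z) b \<le> dx (f \<otimes> r \<otimes> z) b' + dx b' b"
    using cl nearest_closed[OF b'] QR_closed[OF z(1)] by (intro X.word_dist_triangle) auto
  ultimately show ?thesis
    by (intro bexI[of _ z]) auto
qed

text \<open>The projections of \<open>h\<close> and \<open>y\<close> to the coset are near \<open>f z\<close> and \<open>f r z'\<close>. These points differ by
  \<open>z\<inverse> r z'\<close>, which is an element of \<open>R - Q\<close> and hence long.\<close>

lemma penetrates_syllable: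
  assumes f: "f \<in> carrier G" and r: "r \<in> R" "r \<notin> Q"
    and a: "\<And>a. nearest i (f \<otimes> h) h a \<Longrightarrow> \<exists>z\<in>Q \<inter> R. dx (f \<otimes> z) a \<le> K + E"
    and y: "y \<in> carrier G" and b: "nearest i (f \<otimes> h) y b"
    and z': "z' \<in> Q \<inter> R" "dx (f \<otimes> r \<otimes> z') b \<le> K + E" and w: "geodesic h w y"
  obtains n z where "peripheral_edge i w n" "same_coset i (f \<otimes> h) (vertex h w n)"
    "z \<in> Q \<inter> R" "dx (f \<otimes> z) (vertex h w n) \<le> K + 2 * E"
    "dx (f \<otimes> r \<otimes> z') (vertex h w (Suc n)) \<le> K + 2 * E"
proof -
  have clr: "r \<in> carrier G"
    using r R_closed by blast
  have fh: "f \<otimes> h \<in> carrier G"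
    using f h by simp
  obtain a where na: "nearest i (f \<otimes> h) h a"
    using nearest_exists[OF i fh] .
  then obtain z where z: "z \<in> Q \<inter> R" "dx (f \<otimes> z) a \<le> K + E"
    using a by blast
  have cl: "a \<in> carrier G" "b \<in> carrier G" "z \<in> carrier G" "z' \<in> carrier G"
    using na b nearest_closed z(1) z'(1) QR_closed by auto
  have "inv z \<otimes> r \<otimes> z' \<in> R"
    using r z(1) z'(1) R_subgroup by (simp add: subgroup.m_closed subgroup.m_inv_closed)
  moreover have "inv z \<otimes> r \<otimes> z' \<notin> Q"
  proof
    assume "inv z \<otimes> r \<otimes> z' \<in> Q"
    then have "z \<otimes> (inv z \<otimes> r \<otimes> z') \<otimes> inv z' \<in> Q"
      using z(1) z'(1) Q_subgroup by (simp add: subgroup.m_closed subgroup.m_inv_closed)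
    moreover have "z \<otimes> (inv z \<otimes> r \<otimes> z') \<otimes> inv z' = r"
      using cl clr by (simp add: m_assoc)
    ultimately show False
      using r by simp
  qed
  ultimately have "lx (inv z \<otimes> r \<otimes> z') > 2 * K + 3 * E"
    by (rule long)
  moreover have "inv (f \<otimes> z) \<otimes> (f \<otimes> r \<otimes> z') = inv z \<otimes> r \<otimes> z'"
    using cl clr f by (simp add: inv_mult_group m_assoc)
  ultimately have "dx (f \<otimes> z) (f \<otimes> r \<otimes> z') > 2 * K + 3 * E"
    by (simp add: word_dist_def)
  moreover have "dx (f \<otimes> z) (f \<otimes> r \<otimes> z') \<le> dx (f \<otimes> z) a + (dx a b + dx b (f \<otimes> r \<otimes> z'))"
    using X.word_dist_triangle[of "f \<otimes> z" a "f \<otimes> r \<otimes> z'"]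
      X.word_dist_triangle[of a b "f \<otimes> r \<otimes> z'"] cl clr f by simp
  moreover have "dx b (f \<otimes> r \<otimes> z') \<le> K + E"
    using z'(2) X.word_dist_sym cl clr f by simp
  ultimately have "dx a b > E"
    using z(2) by linarith
  then obtain n where n: "peripheral_edge i w n" "same_coset i (f \<otimes> h) (vertex h w n)"
    "dx a (vertex h w n) \<le> E" "dx b (vertex h w (Suc n)) \<le> E"
    using E[unfolded penetration_constant_def, rule_format, OF i fh h y na b _ w] by blast
  have "dx (f \<otimes> z) (vertex h w n) \<le> K + 2 * E"
    using X.word_dist_triangle[of "f \<otimes> z" a "vertex h w n"] z(2) n(3)
      geodesic_closed(4)[OF w] cl f by fastforce
  moreover have "dx (f \<otimes> r \<otimes> z') (vertex h w (Suc n)) \<le> K + 2 * E"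
    using X.word_dist_triangle[of "f \<otimes> r \<otimes> z'" b "vertex h w (Suc n)"] z'(2) n(4)
      geodesic_closed(4)[OF w] cl clr f by fastforce
  ultimately show ?thesis
    using that n(1,2) z(1) by blast
qed

text \<open>The projection of \<open>h\<close> to the coset of \<open>f r q h\<close> is the projection of a point of the preceding coset,
  that of \<open>f h\<close>: a geodesic from \<open>h\<close> to a closest point passes through the preceding coset by the induction
  hypothesis. All points of the preceding coset have nearly the same projection, and for the point \<open>f r h\<close>
  it is near \<open>f r q (Q \<inter> P)\<close>, because \<open>f r h = (f r q) q\<inverse> h\<close>.\<close>

lemma nearest_to_basepoint:
  "prefix G Q R n f \<Longrightarrow> nearest i (f \<otimes> h) h a \<Longrightarrow> \<exists>z\<in>Q \<inter> R. dx (f \<otimes> z) a \<le> K + E"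
proof (induction arbitrary: a rule: prefix.induct)
  case (start q)
  have q: "q \<in> carrier G" "inv q \<in> Q" "\<one> \<in> R"
    using start Q_closed Q_subgroup R_subgroup by (auto simp: subgroup.m_inv_closed subgroup.one_closed)
  have "nearest i (q \<otimes> h) (q \<otimes> \<one> \<otimes> inv q \<otimes> h) a"
    using start(2) q h by simp
  from nearest_to_product[OF q(1,3,2) this] obtain z where "z \<in> Q \<inter> R" "dx (q \<otimes> \<one> \<otimes> z) a \<le> K"
    by blast
  then show ?case
    using q by (intro bexI[of _ z]) auto
next
  case (extend n f r q)
  let ?f' = "f \<otimes> r \<otimes> q"
  have f: "f \<in> carrier G"
    using extend.hyps prefix_closed by blast
  have cl: "r \<in> carrier G" "q \<in> carrier G" "?f' \<in> carrier G" "?f' \<otimes> h \<in> carrier G" "f \<otimes> h \<in> carrier G"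
    "f \<otimes> r \<otimes> h \<in> carrier G" "a \<in> carrier G"
    using extend f h Q_closed R_closed nearest_closed by auto
  obtain w where w: "geodesic h w a"
    using geodesic_exists h cl by metis
  obtain b where b: "nearest i (f \<otimes> h) a b"
    using nearest_exists[OF i cl(5)] .
  have "same_coset i (?f' \<otimes> h) a"
    using extend.prems by (simp add: nearest_def)
  then obtain z' where z': "z' \<in> Q \<inter> R" "dx (f \<otimes> r \<otimes> z') b \<le> K + E"
    using projection_of_next_coset[OF f extend.hyps(2,4,5) cl(7) _ b] by blast
  obtain l where l: "peripheral_edge i w l" "same_coset i (f \<otimes> h) (vertex h w l)"
    using penetrates_syllable[OF f extend.hyps(2,3) extend.IH cl(7) b z' w] by metis
  let ?v = "vertex h w (Suc l)"
  have clv: "?v \<in> carrier G" "vertex h w l \<in> carrier G"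
    using geodesic_closed(4)[OF w] by auto
  have len: "Suc l \<le> length w"
    using l(1) by (simp add: peripheral_edge_def)
  have "same_coset i (f \<otimes> h) ?v"
    using same_coset_trans[OF i cl(5) clv(2,1) l(2)] peripheral_edge_same_coset[OF h geodesic_closed(3)[OF w] l(1)]
    by blast
  then have v: "same_coset i (f \<otimes> r \<otimes> h) ?v"
    using same_coset_trans[OF i cl(6,5) clv(1) same_coset_sym[OF i cl(5,6) same_coset_R[OF f extend.hyps(2)]]]
    by blast
  have nv: "nearest i (?f' \<otimes> h) ?v a"
    using nearest_between[OF h extend.prems geodesic_between[OF w len]] .
  have "inv q \<in> Q" "\<one> \<in> R" "?f' \<otimes> \<one> \<otimes> inv q \<otimes> h = f \<otimes> r \<otimes> h"
    using extend.hyps Q_subgroup R_subgroup cl f h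
    by (auto simp: subgroup.m_inv_closed subgroup.one_closed m_assoc)
  moreover obtain e where e: "nearest i (?f' \<otimes> h) (f \<otimes> r \<otimes> h) e"
    using nearest_exists[OF i cl(4)] .
  ultimately obtain z where z: "z \<in> Q \<inter> R" "dx (?f' \<otimes> z) e \<le> K"
    using nearest_to_product[OF cl(3), of \<one> "inv q" e] cl by auto
  have "\<not> same_coset i (?f' \<otimes> h) (f \<otimes> r \<otimes> h)"
  proof
    assume "same_coset i (?f' \<otimes> h) (f \<otimes> r \<otimes> h)"
    then have "same_coset i (f \<otimes> h) (?f' \<otimes> h)"
      using same_coset_trans[OF i cl(5,6,4) same_coset_R[OF f extend.hyps(2)] same_coset_sym[OF i cl(4,6)]]
      by blast
    then show False
      using distinct_cosets[OF f extend.hyps(2,4,5)] by blast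
  qed
  then have "dx e a \<le> E"
    using distinct_coset_projection[OF E i cl(4,6) clv(1) v _ e nv] by blast
  moreover have "dx (?f' \<otimes> z) a \<le> dx (?f' \<otimes> z) e + dx e a"
    using cl nearest_closed[OF e] QR_closed[OF z(1)] by (intro X.word_dist_triangle) auto
  ultimately show ?case
    using z by (intro bexI[of _ z]) auto
qed

definition tracked :: "'a letter list \<Rightarrow> bool" where
  "tracked w \<longleftrightarrow> (\<forall>j\<le>length w. \<exists>v\<in>W. dx v (vertex h w j) \<le> M)"

lemma near_coset_in_W:
  assumes g: "g \<in> W" and w: "geodesic x w y" and f: "f \<in> Q" "f' \<in> Q"
    and near: "dx (g \<otimes> f) x \<le> k" "dx (g \<otimes> f') y \<le> k" and n: "n \<le> length w"
  shows "\<exists>v\<in>W. dx v (vertex x w n) \<le> M"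
proof -
  have "g \<in> carrier G"
    using g W_subgroup subgroup.mem_carrier by metis
  then obtain q where "q \<in> Q" "dx (g \<otimes> q) (vertex x w n) \<le> M"
    using stable w f near n unfolding coset_stable_def by blast
  then show ?thesis
    using g Q_in_W W_subgroup subgroup.m_closed by metis
qed

text \<open>The geodesic is split at its edge in the coset of \<open>f h\<close>. The part before that edge is covered by the
  induction hypothesis; the part after it joins two points near \<open>f r Q\<close>, a translate of \<open>Q\<close> inside \<open>W\<close>.\<close>

lemma track_through_syllable:
  assumes f: "prefix G Q R l f" and r: "r \<in> R" "r \<notin> Q"
    and IH: "\<And>y z w. \<lbrakk>y \<in> carrier G; same_coset i (f \<otimes> h) y; z \<in> Q \<inter> R; dx (f \<otimes> z) y \<le> K + 2 * E;
        geodesic h w y\<rbrakk> \<Longrightarrow> l \<le> length w \<and> tracked w"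
    and y: "y \<in> carrier G" and b: "nearest i (f \<otimes> h) y b"
    and z': "z' \<in> Q \<inter> R" "dx (f \<otimes> r \<otimes> z') b \<le> K + E" and w: "geodesic h w y"
    and q: "q \<in> Q" "dx (f \<otimes> r \<otimes> q) y \<le> k"
  shows "Suc l \<le> length w \<and> tracked w"
proof -
  have clf: "f \<in> carrier G"
    using f prefix_closed by blast
  obtain n z where n: "peripheral_edge i w n" "same_coset i (f \<otimes> h) (vertex h w n)"
    "z \<in> Q \<inter> R" "dx (f \<otimes> z) (vertex h w n) \<le> K + 2 * E"
    "dx (f \<otimes> r \<otimes> z') (vertex h w (Suc n)) \<le> K + 2 * E"
    using penetrates_syllable[OF clf r nearest_to_basepoint[OF f] y b z' w] by metis
  have len: "Suc n \<le> length w" "n \<le> length w"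
    using n(1) by (auto simp: peripheral_edge_def)
  have head: "l \<le> n" "tracked (take n w)"
    using IH[OF geodesic_closed(4)[OF w] n(2,3,4) geodesic_take[OF w len(2)]] len by auto
  have tail: "geodesic (vertex h w (Suc n)) (drop (Suc n) w) y"
    by (rule geodesic_drop[OF w len(1)])
  have fr: "f \<otimes> r \<in> W"
    using prefix_in_W[OF f] R_in_W[OF r(1)] W_subgroup by (simp add: subgroup.m_closed)
  have "\<exists>v\<in>W. dx v (vertex h w j) \<le> M" if "j \<le> length w" for j
  proof (cases "j \<le> n")
    case True
    then show ?thesis
      using head(2) len by (auto simp: tracked_def path_vertex_take)
  next
    case False
    have "dx (f \<otimes> r \<otimes> z') (vertex h w (Suc n)) \<le> k" "z' \<in> Q"
      using n(5) k z'(1) by auto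
    then have "\<exists>v\<in>W. dx v (vertex (vertex h w (Suc n)) (drop (Suc n) w) (j - Suc n)) \<le> M"
      using near_coset_in_W[OF fr tail _ q(1) _ q(2), of z' "j - Suc n"] that by simp
    then show ?thesis
      using path_vertex_drop[of "Suc n" "j - Suc n" w h] False that by simp
  qed
  then show ?thesis
    using head(1) len unfolding tracked_def by auto
qed

lemma track_prefix:
  "\<lbrakk>prefix G Q R l f; y \<in> carrier G; same_coset i (f \<otimes> h) y; z \<in> Q \<inter> R; dx (f \<otimes> z) y \<le> K + 2 * E;
    geodesic h w y\<rbrakk> \<Longrightarrow> l \<le> length w \<and> tracked w"
proof (induction arbitrary: y z w rule: prefix.induct)
  case (start q)
  have one: "\<one> \<in> Q" "\<one> \<in> W"
    using Q_subgroup Q_in_W by (auto simp: subgroup.one_closed)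
  have qz: "q \<otimes> z \<in> Q"
    using start Q_subgroup by (simp add: subgroup.m_closed)
  have "dx (\<one> \<otimes> \<one>) h \<le> k"
    using k h by (simp add: word_dist_def)
  moreover have "dx (\<one> \<otimes> (q \<otimes> z)) y \<le> k"
    using start k qz Q_closed by auto
  ultimately show ?case
    unfolding tracked_def using near_coset_in_W[OF one(2) start(6) one(1) qz] by blast
next
  case (extend n f r q)
  let ?f' = "f \<otimes> r \<otimes> q"
  have f: "f \<in> carrier G" "f \<otimes> h \<in> carrier G" "r \<in> carrier G" "q \<in> carrier G"
    using extend.hyps prefix_closed h R_closed Q_closed by auto
  obtain b where b: "nearest i (f \<otimes> h) y b"
    using nearest_exists[OF i f(2)] .
  obtain z' where z': "z' \<in> Q \<inter> R" "dx (f \<otimes> r \<otimes> z') b \<le> K + E"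
    using projection_of_next_coset[OF f(1) extend.hyps(2,4,5) extend.prems(1,2) b] by blast
  have qz: "q \<otimes> z \<in> Q" "dx (f \<otimes> r \<otimes> (q \<otimes> z)) y \<le> k"
    using extend k Q_subgroup f QR_closed[OF extend.prems(3)] by (auto simp: subgroup.m_closed m_assoc)
  show ?case
    by (rule track_through_syllable[OF extend.hyps(1-3) _ extend.prems(1) b z' extend.prems(5) qz])
      (rule extend.IH)
qed

lemma track_product:
  assumes f: "prefix G Q R l f" and r: "r \<in> R" "r \<notin> Q" and q: "q \<in> Q"
    and w: "geodesic h w (f \<otimes> r \<otimes> q \<otimes> h)"
  shows "Suc l \<le> length w \<and> tracked w"
proof -
  have cl: "f \<in> carrier G" "f \<otimes> h \<in> carrier G" "r \<in> carrier G" "q \<in> carrier G"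
    using f r q prefix_closed h R_closed Q_closed by auto
  obtain b where b: "nearest i (f \<otimes> h) (f \<otimes> r \<otimes> q \<otimes> h) b"
    using nearest_exists[OF i cl(2)] .
  obtain z' where z': "z' \<in> Q \<inter> R" "dx (f \<otimes> r \<otimes> z') b \<le> K"
    using nearest_to_product[OF cl(1) r(1) q b] by blast
  have "dx (f \<otimes> r \<otimes> q) (f \<otimes> r \<otimes> q \<otimes> h) \<le> k"
    using X.word_dist_mult_right[of "f \<otimes> r \<otimes> q" h] cl h k by simp
  then show ?thesis
    using track_through_syllable[OF f r track_prefix[OF f] _ b z'(1) _ w q] z'(2) cl h by simp
qed

lemma track_Q:
  assumes "q \<in> Q" "geodesic h w (q \<otimes> h)"
  shows "tracked w"
proof -
  have one: "\<one> \<in> Q" "\<one> \<in> W"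
    using Q_subgroup Q_in_W by (auto simp: subgroup.one_closed)
  have "dx (\<one> \<otimes> \<one>) h \<le> k" "dx (\<one> \<otimes> q) (q \<otimes> h) \<le> k"
    using k h assms(1) Q_closed by (simp_all add: X.word_dist_mult_right) (simp add: word_dist_def)
  then show ?thesis
    unfolding tracked_def using near_coset_in_W[OF one(2) assms(2) one(1) assms(1)] by blast
qed

end

section \<open>The combination of a quasiconvex and a parabolic subgroup\<close>

context peripheral_cayley
begin

text \<open>Let \<open>a\<close> be a point of \<open>h H\<^sub>i\<close> closest to \<open>q h\<close>. If it is far from \<open>h\<close>, a geodesic from \<open>h\<close> to \<open>q h\<close> leaves
  the coset near \<open>a\<close>; as this geodesic stays near \<open>Q\<close>, it follows that \<open>a = p e\<close> with \<open>p \<in> Q\<close> and \<open>e\<close> from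
  a finite ball \<open>F\<close>. Choose for every \<open>e\<close> one element \<open>c e\<close> of \<open>Q\<close> with \<open>c e e \<in> h H\<^sub>i\<close>. Then \<open>p (c e)\<inverse>\<close> lies in
  \<open>Q \<inter> P\<close>, and its distance to \<open>a\<close> is the length of \<open>c e e\<close>, which takes finitely many values.\<close>

lemma projection_near_intersection:
  assumes Q: "relatively_quasiconvex G X m H Q" and bcp: "bounded_coset_penetration G X m H"
    and E: "penetration_constant E" and i: "i \<in> {1..m}" and h: "h \<in> carrier G"
  obtains K :: nat where
    "\<And>q a. q \<in> Q \<Longrightarrow> nearest i h (q \<otimes> h) a \<Longrightarrow> \<exists>z\<in>Q. inv h \<otimes> z \<otimes> h \<in> H i \<and> dx z a \<le> K"
proof -
  have sub: "subgroup Q G"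
    using Q by (simp add: relatively_quasiconvex_def)
  have Qc: "q \<in> carrier G" if "q \<in> Q" for q
    using that sub subgroup.mem_carrier by metis
  have one: "\<one> \<in> Q"
    using sub by (simp add: subgroup.one_closed)
  obtain M where M: "coset_stable Q (lx h) M"
    using relatively_quasiconvex_coset_stable[OF Q bcp] by blast
  define F where "F = {e \<in> carrier G. lx e \<le> M + E}"
  define c where "c e = (SOME w. w \<in> Q \<and> same_coset i h (w \<otimes> e))" for e
  define K where "K = Max (insert (lx h + E) ((\<lambda>e. lx (c e \<otimes> e)) ` F))"
  have fin: "finite F"
    unfolding F_def using X.finite_word_ball[OF X_finite] .
  have K1: "lx h + E \<le> K" and K2: "e \<in> F \<Longrightarrow> lx (c e \<otimes> e) \<le> K" for e
    unfolding K_def using fin by (auto intro: Max_ge)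
  show ?thesis
  proof (rule that[of K])
    fix q a assume q: "q \<in> Q" and a: "nearest i h (q \<otimes> h) a"
    have cla: "a \<in> carrier G" and ha: "same_coset i h a"
      using a by (auto simp: nearest_def)
    show "\<exists>z\<in>Q. inv h \<otimes> z \<otimes> h \<in> H i \<and> dx z a \<le> K"
    proof (cases "dx h a \<le> E")
      case True
      have "dx \<one> a \<le> dx \<one> h + dx h a"
        using X.word_dist_triangle h cla by simp
      then have "dx \<one> a \<le> K"
        using True K1 h by (simp add: word_dist_def)
      moreover have "inv h \<otimes> \<one> \<otimes> h \<in> H i"
        using h H_subgroup[OF i] by (simp add: subgroup.one_closed)
      ultimately show ?thesis
        using one by blast
    next
      case False
      have qh: "q \<otimes> h \<in> carrier G"
        using q Qc h by simp
      obtain w where w: "geodesic h w (q \<otimes> h)"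
        using geodesic_exists h qh by metis
      have "nearest i h h h"
        using h same_coset_refl[OF i h] by (simp add: nearest_def)
      then obtain n where n: "peripheral_edge i w n" "dx a (vertex h w (Suc n)) \<le> E"
        using E[unfolded penetration_constant_def, rule_format, OF i h h qh _ a _ w] False
        by (meson not_le)
      let ?v = "vertex h w (Suc n)"
      have clv: "?v \<in> carrier G"
        using geodesic_closed(4)[OF w] .
      have "dx (\<one> \<otimes> \<one>) h \<le> lx h" "dx (\<one> \<otimes> q) (q \<otimes> h) \<le> lx h" "Suc n \<le> length w"
        using n(1) h q Qc by (simp_all add: X.word_dist_mult_right peripheral_edge_def)
          (simp add: word_dist_def)
      then obtain p where p: "p \<in> Q" "dx (\<one> \<otimes> p) ?v \<le> M"
        using M[unfolded coset_stable_def, rule_format, OF one_closed w one q] by blast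
      have clp: "p \<in> carrier G"
        using p Qc by blast
      define e where "e = inv p \<otimes> a"
      have e: "e \<in> carrier G" "p \<otimes> e = a"
        using clp cla by (auto simp: e_def)
      have "dx p a \<le> dx p ?v + dx ?v a" "dx ?v a = dx a ?v"
        using X.word_dist_triangle[OF clp clv cla] X.word_dist_sym[OF clv cla] by auto
      then have "dx p a \<le> M + E"
        using p(2) n(2) clp by simp
      then have eF: "e \<in> F"
        using e(1) by (simp add: F_def e_def word_dist_def)
      have "p \<in> Q \<and> same_coset i h (p \<otimes> e)"
        using p e ha by simp
      then have "c e \<in> Q \<and> same_coset i h (c e \<otimes> e)"
        unfolding c_def by (rule someI)
      then have c: "c e \<in> Q" "same_coset i h (c e \<otimes> e)"
        by simp_all
      have clc: "c e \<in> carrier G"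
        using c Qc by blast
      define z where "z = p \<otimes> inv (c e)"
      have "z \<in> Q"
        using p c sub by (simp add: z_def subgroup.m_closed subgroup.m_inv_closed)
      moreover have "inv h \<otimes> z \<otimes> h = (inv h \<otimes> a) \<otimes> inv (inv h \<otimes> (c e \<otimes> e))"
        using h clp clc cla by (simp add: z_def e_def inv_mult_group m_assoc)
      then have "inv h \<otimes> z \<otimes> h \<in> H i"
        using ha c(2) H_subgroup[OF i] by (simp add: same_coset_def subgroup.m_closed subgroup.m_inv_closed)
      moreover have "inv z \<otimes> a = c e \<otimes> e"
        using clp clc cla by (simp add: z_def e_def inv_mult_group m_assoc)
      then have "dx z a \<le> K"
        using K2[OF eF] by (simp add: word_dist_def)
      ultimately show ?thesis
        by blast
    qed
  qed
qed

lemma maximal_parabolic_eq_conjugate: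
  assumes "maximal_parabolic G m H P"
  obtains i h where "i \<in> {1..m}" "h \<in> carrier G" "P = {x \<in> carrier G. inv h \<otimes> x \<otimes> h \<in> H i}"
proof -
  have P: "subgroup P G"
    using assms by (simp add: maximal_parabolic_def parabolic_def)
  obtain g i where g: "g \<in> carrier G" "i \<in> {1..m}" "conjugate_set G g P \<subseteq> H i"
    using assms unfolding maximal_parabolic_def parabolic_def by blast
  define P' where "P' = conjugate_set G (inv g) (H i)"
  have Hc: "H i \<subseteq> carrier G"
    using H_closed g(2) by blast
  have P'_eq: "P' = {x \<in> carrier G. g \<otimes> x \<otimes> inv g \<in> H i}"
  proof
    show "P' \<subseteq> {x \<in> carrier G. g \<otimes> x \<otimes> inv g \<in> H i}"
      using g Hc by (auto simp: P'_def conjugate_set_def m_assoc)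
    show "{x \<in> carrier G. g \<otimes> x \<otimes> inv g \<in> H i} \<subseteq> P'"
    proof
      fix x assume x: "x \<in> {x \<in> carrier G. g \<otimes> x \<otimes> inv g \<in> H i}"
      then have "x = inv g \<otimes> (g \<otimes> x \<otimes> inv g) \<otimes> inv (inv g)"
        using g by (simp add: m_assoc)
      then show "x \<in> P'"
        using x unfolding P'_def conjugate_set_def by blast
    qed
  qed
  have "parabolic G m H P'"
    unfolding parabolic_def
  proof (intro conjI bexI)
    show "subgroup P' G"
      unfolding P'_def using conjugate_set_subgroup H_subgroup g by simp
    show "conjugate_set G g P' \<subseteq> H i"
      unfolding P'_eq conjugate_set_def by blast
  qed (use g in auto)
  moreover have "P \<subseteq> P'"
    using g(3) subgroup.mem_carrier[OF P] unfolding P'_eq conjugate_set_def by blast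
  ultimately have "P = P'"
    using assms unfolding maximal_parabolic_def by blast
  then show ?thesis
    using that[of i "inv g"] g P'_eq by simp
qed

end

context long_syllables
begin

lemma alternating_prefix:
  "alt n a \<Longrightarrow> q \<in> Q \<Longrightarrow>
     \<exists>l f r. n = Suc l \<and> prefix G Q R l f \<and> r \<in> R \<and> r \<notin> Q \<and> q \<otimes> a = f \<otimes> r"
proof (induction rule: alternating.induct)
  case (single r)
  then show ?case
    using prefix.start by fastforce
next
  case (extend n a s r)
  then obtain l f t where f: "n = Suc l" "prefix G Q R l f" "t \<in> R" "t \<notin> Q" "q \<otimes> a = f \<otimes> t"
    by blast
  have "prefix G Q R (Suc l) (f \<otimes> t \<otimes> s)"
    using f extend by (intro prefix.extend)
  moreover have "q \<otimes> (a \<otimes> s \<otimes> r) = (q \<otimes> a) \<otimes> s \<otimes> r"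
    using extend alt_closed[OF extend.hyps(1)] Q_closed R_closed by (simp add: m_assoc)
  ultimately show ?case
    using f(1,5) extend.hyps(4,5) by auto
qed

text \<open>In particular an element whose normal form has \<open>n\<close> factors from \<open>R - Q\<close> moves \<open>h\<close> by at least \<open>n\<close>.\<close>

lemma track_reduced:
  assumes "reduced n g" "geodesic h w (g \<otimes> h)"
  shows "n \<le> length w \<and> tracked w"
proof -
  obtain q q' a where a: "q \<in> Q" "q' \<in> Q" "alt n a" "g = q \<otimes> a \<otimes> q'"
    using assms(1) by (auto simp: reduced_def)
  then obtain l f r where f: "n = Suc l" "prefix G Q R l f" "r \<in> R" "r \<notin> Q" "q \<otimes> a = f \<otimes> r"
    using alternating_prefix by blast
  then show ?thesis
    using track_product[OF f(2-4) a(2), of w] assms(2) a(4) by simp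
qed

sublocale F: faithful_subgroups G Q R
proof
  fix n a assume a: "alt n a"
  show "a \<notin> Q"
  proof
    assume "a \<in> Q"
    then have "reduced n \<one>"
      using a Q_closed by (intro reducedI[of n a \<one> "inv a"]) auto
    moreover have "geodesic h [] (\<one> \<otimes> h)"
      using h by (simp add: geodesic_def)
    ultimately show False
      using track_reduced alt_pos[OF a] by fastforce
  qed
qed

lemma track_W: "g \<in> W \<Longrightarrow> geodesic h w (g \<otimes> h) \<Longrightarrow> tracked w"
  using generate_reduced track_Q track_reduced by blast

text \<open>Geodesics between elements of \<open>W\<close> are compared with geodesics between their right translates by \<open>h\<close>,
  for which \<open>track_W\<close> applies after a left translation.\<close>

lemma W_relatively_quasiconvex:
  assumes bcp: "bounded_coset_penetration G X m H"
  shows "relatively_quasiconvex G X m H W"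
proof -
  obtain \<epsilon> :: nat where \<epsilon>:
    "\<And>x w y u n. comparable 0 (lx h) x w y u \<Longrightarrow> n \<le> length w \<Longrightarrow>
       \<exists>n'\<le>length u. dx (vertex x w n) (vertex y u n') \<le> \<epsilon>"
    by (rule bcp_tight[OF bcp, of 0 "lx h"]) blast
  have Wc: "g \<in> carrier G" if "g \<in> W" for g
    using that W_subgroup subgroup.mem_carrier by metis
  have "\<exists>v\<in>W. real (dx (path_vertex G p n) v) \<le> real (\<epsilon> + M)"
    if fg: "f \<in> W" "g \<in> W" and p: "geodesic_path G X m H p" "path_start G p = f" "path_end G p = g"
      and n: "n \<le> path_len p" for f g p n
  proof -
    obtain u where pu: "p = (f, u)"
      using p(2) by (cases p) simp
    have u: "geodesic f u g" "n \<le> length u"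
      using geodesic_path_iff[of f u g] p n pu by simp_all
    have clfg: "f \<in> carrier G" "g \<in> carrier G"
      using fg Wc by auto
    define g' where "g' = inv f \<otimes> g"
    have g': "g' \<in> W" "g' \<in> carrier G" "f \<otimes> g' = g"
      using fg clfg W_subgroup by (auto simp: g'_def subgroup.m_closed subgroup.m_inv_closed)
    obtain w where w: "geodesic h w (g' \<otimes> h)"
      using geodesic_exists h g' by (metis m_closed)
    have fw: "geodesic (f \<otimes> h) w (g \<otimes> h)"
      using geodesic_translate[OF clfg(1) w] g' clfg h by (simp add: m_assoc[symmetric])
    have "dx f (f \<otimes> h) \<le> lx h" "dx g (g \<otimes> h) \<le> lx h"
      using clfg h by (simp_all add: X.word_dist_mult_right)
    then obtain l where l: "l \<le> length w"
      "dx (vertex f u n) (vertex (f \<otimes> h) w l) \<le> \<epsilon>"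
      using \<epsilon>[OF geodesics_comparable[OF u(1) fw] u(2)] by blast
    obtain v where v: "v \<in> W" "dx v (vertex h w l) \<le> M"
      using track_W[OF g'(1) w] l(1) by (auto simp: tracked_def)
    have cl: "v \<in> carrier G" "vertex h w l \<in> carrier G" "vertex f u n \<in> carrier G"
      using v Wc geodesic_closed(4)[OF w] geodesic_closed(4)[OF u(1)] by auto
    have eq: "vertex (f \<otimes> h) w l = f \<otimes> vertex h w l"
      using path_vertex_translate[OF clfg(1) h geodesic_closed(3)[OF w]] .
    have "dx (f \<otimes> vertex h w l) (f \<otimes> v) \<le> M"
      using v(2) X.word_dist_translate[OF clfg(1) cl(2,1)] X.word_dist_sym[OF cl(1,2)] by simp
    moreover have "dx (vertex f u n) (f \<otimes> v) \<le>
        dx (vertex f u n) (f \<otimes> vertex h w l) + dx (f \<otimes> vertex h w l) (f \<otimes> v)"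
      using cl clfg by (intro X.word_dist_triangle) auto
    ultimately have "dx (vertex f u n) (f \<otimes> v) \<le> \<epsilon> + M"
      using l(2) eq by simp
    moreover have "f \<otimes> v \<in> W"
      using fg v W_subgroup by (simp add: subgroup.m_closed)
    ultimately show ?thesis
      unfolding pu by (intro bexI[of _ "f \<otimes> v"]) auto
  qed
  then show ?thesis
    unfolding relatively_quasiconvex_def using W_subgroup
    by (intro conjI exI[of _ "real (\<epsilon> + M)"]) auto
qed

text \<open>An element of a parabolic subgroup moves a suitable vertex by at most one, so it moves \<open>h\<close> by a bounded
  amount and has a bounded number of syllables.\<close>

lemma parabolic_in_W_conjugate:
  assumes par: "parabolic G m H K'" and sub: "K' \<subseteq> W"
  shows "\<exists>g\<in>W. conjugate_set G g K' \<subseteq> Q \<or> conjugate_set G g K' \<subseteq> R"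
proof -
  obtain g j where g: "g \<in> carrier G" "j \<in> {1..m}" "conjugate_set G g K' \<subseteq> H j"
    using par unfolding parabolic_def by blast
  have K': "subgroup K' G"
    using par by (simp add: parabolic_def)
  define N where "N = dg h (inv g) + 1 + dg (inv g) h"
  have "x \<in> Q \<or> (\<exists>l\<le>N. reduced l x)" if x: "x \<in> K'" for x
  proof (cases "x \<in> Q")
    case False
    have clx: "x \<in> carrier G"
      using x K' subgroup.mem_carrier by metis
    obtain l where l: "reduced l x"
      using generate_reduced[of x] x sub False by blast
    obtain w where w: "geodesic h w (x \<otimes> h)"
      using geodesic_exists h clx by (metis m_closed)
    have "l \<le> dg h (x \<otimes> h)"
      using track_reduced[OF l w] w by (simp add: geodesic_def)
    also have "\<dots> \<le> dg h (inv g) + (dg (inv g) (x \<otimes> inv g) + dg (x \<otimes> inv g) (x \<otimes> h))"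
      using dg_triangle[of h "inv g" "x \<otimes> h"] dg_triangle[of "inv g" "x \<otimes> inv g" "x \<otimes> h"] h clx g by simp
    also have "dg (x \<otimes> inv g) (x \<otimes> h) = dg (inv g) h"
      using dg_translate clx g h by simp
    also have "dg (inv g) (x \<otimes> inv g) \<le> 1"
    proof (rule dg_same_coset_le[OF g(2)])
      have "g \<otimes> x \<otimes> inv g \<in> H j"
        using g(3) x unfolding conjugate_set_def by blast
      then show "same_coset j (inv g) (x \<otimes> inv g)"
        using g clx by (simp add: same_coset_def m_assoc)
    qed (use g clx in auto)
    finally show ?thesis
      using l unfolding N_def by (intro disjI2 exI[of _ l]) auto
  qed simp
  then show ?thesis
    by (rule F.bounded_subgroup_conjugate[OF K'])
qed

end

theorem theorem1p1:
  fixes G :: "('a, 'b) monoid_scheme" and X :: "'a set" and m :: nat and H :: "nat \<Rightarrow> 'a set"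
    and Q P :: "'a set"
  assumes "group G"
    and "X \<subseteq> carrier G" and "finite X" and "\<forall>x\<in>X. inv\<^bsub>G\<^esub> x \<in> X"
    and "generate G X = carrier G"
    and "\<forall>i\<in>{1..m}. subgroup (H i) G"
    and "relatively_hyperbolic G X m H"
    and "relatively_quasiconvex G X m H Q"
    and "maximal_parabolic G m H P"
  shows "\<exists>C::real. C \<ge> 0 \<and>
    (\<forall>R. subgroup R G \<and> R \<subseteq> P \<and> Q \<inter> P \<subseteq> R \<and>
         (\<forall>g\<in>R - Q. real (word_length G X g) \<ge> C) \<longrightarrow>
       amalgam_hom G \<in> mon (amalgam G Q R) G \<and>
       amalgam_hom G ` carrier (amalgam G Q R) = generate G (Q \<union> R) \<and>
       relatively_quasiconvex G X m H (generate G (Q \<union> R)) \<and>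
       (\<forall>K. parabolic G m H K \<and> K \<subseteq> generate G (Q \<union> R) \<longrightarrow>
          (\<exists>g\<in>generate G (Q \<union> R). conjugate_set G g K \<subseteq> Q \<or> conjugate_set G g K \<subseteq> R)))"
proof -
  interpret peripheral_cayley G X m H
    using assms(1-6) by (intro peripheral_cayley.intro peripheral_cayley_axioms.intro) auto
  have bcp: "bounded_coset_penetration G X m H"
    using assms(7) by (simp add: relatively_hyperbolic_def)
  have Q: "subgroup Q G"
    using assms(8) by (simp add: relatively_quasiconvex_def)
  obtain E where E: "penetration_constant E"
    using relatively_hyperbolic_penetration_constant[OF assms(7)] .
  obtain i h where i: "i \<in> {1..m}" and h: "h \<in> carrier G"
    and P: "P = {x \<in> carrier G. inv\<^bsub>G\<^esub> h \<otimes>\<^bsub>G\<^esub> x \<otimes>\<^bsub>G\<^esub> h \<in> H i}"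
    using maximal_parabolic_eq_conjugate[OF assms(9)] .
  obtain K where K: "\<And>q a. q \<in> Q \<Longrightarrow> nearest i h (q \<otimes>\<^bsub>G\<^esub> h) a \<Longrightarrow>
      \<exists>z\<in>Q. inv\<^bsub>G\<^esub> h \<otimes>\<^bsub>G\<^esub> z \<otimes>\<^bsub>G\<^esub> h \<in> H i \<and> dx z a \<le> K"
    using projection_near_intersection[OF assms(8) bcp E i h] by blast
  define k where "k = max (K + 2 * E) (word_length G X h)"
  obtain M where M: "coset_stable Q k M"
    using relatively_quasiconvex_coset_stable[OF assms(8) bcp] by blast
  show ?thesis
  proof (intro exI[of _ "real (2 * K + 3 * E + 1)"] conjI allI impI)
    fix R assume R: "subgroup R G \<and> R \<subseteq> P \<and> Q \<inter> P \<subseteq> R \<and>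
         (\<forall>g\<in>R - Q. real (word_length G X g) \<ge> real (2 * K + 3 * E + 1))"
    interpret long_syllables G X m H Q R i h E K k M
    proof (intro long_syllables.intro long_syllables_axioms.intro two_subgroups.intro
        two_subgroups_axioms.intro peripheral_cayley_axioms is_group)
      show "subgroup Q G" "subgroup R G"
        using Q R by auto
      show "i \<in> {1..m}" "h \<in> carrier G" "penetration_constant E" "coset_stable Q k M"
        by (fact i h E M)+
      show "inv\<^bsub>G\<^esub> h \<otimes>\<^bsub>G\<^esub> r \<otimes>\<^bsub>G\<^esub> h \<in> H i" if "r \<in> R" for r
        using R that P by blast
      have QP: "q \<in> R" if "q \<in> Q" "inv\<^bsub>G\<^esub> h \<otimes>\<^bsub>G\<^esub> q \<otimes>\<^bsub>G\<^esub> h \<in> H i" for q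
        using R that P subgroup.mem_carrier[OF Q] by blast
      then show "q \<in> R" if "q \<in> Q" "inv\<^bsub>G\<^esub> h \<otimes>\<^bsub>G\<^esub> q \<otimes>\<^bsub>G\<^esub> h \<in> H i" for q
        using that .
      show "\<exists>z\<in>Q \<inter> R. dx z a \<le> K" if "q \<in> Q" "nearest i h (q \<otimes>\<^bsub>G\<^esub> h) a" for q a
        using K[OF that] QP by blast
      show "word_length G X r > 2 * K + 3 * E" if "r \<in> R" "r \<notin> Q" for r
      proof -
        have "real (word_length G X r) \<ge> real (2 * K + 3 * E + 1)"
          using R that by blast
        then show ?thesis
          by linarith
      qed
      show "K + 2 * E \<le> k" "word_length G X h \<le> k"
        by (simp_all add: k_def)
    qed
    show "amalgam_hom G \<in> mon (amalgam G Q R) G"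
      by (rule F.amalgam_hom_mon)
    show "amalgam_hom G ` carrier (amalgam G Q R) = generate G (Q \<union> R)"
      by (rule amalgam_hom_image)
    show "relatively_quasiconvex G X m H (generate G (Q \<union> R))"
      by (rule W_relatively_quasiconvex[OF bcp])
    show "\<exists>g\<in>generate G (Q \<union> R). conjugate_set G g K' \<subseteq> Q \<or> conjugate_set G g K' \<subseteq> R"
      if "parabolic G m H K' \<and> K' \<subseteq> generate G (Q \<union> R)" for K'
      using parabolic_in_W_conjugate that by blast
  qed simp
qed

end
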